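(* Consider the decentralized multi-armed bandit with $N$ arms and $M$ players, and let $\pi_F^*$ be the TDFS policy (with pre-agreed offsets) described in the context. For every admissible parameter vector $\Theta$, there is a constant $C(\Theta)$ with $$\limsup_{T\to\infty}\frac{R_T^{\pi_F^*}(\Theta)}{\log T}\le C(\Theta).$$ Specifically, put $$x_k=\sum_{i=1}^k\ \sum_{j:\mu(\theta_j)<\mu(\theta_{\sigma(i)})}\frac{1}{I(\theta_j,\theta_{\sigma(i)})}.$$ Under collision model 1 the bound holds with $$C(\Theta)=M\Big(\sum_{i=1}^M x_i\,\mu(\theta_{\sigma(i)})-\sum_{n:\mu(\theta_n)<\mu(\theta_{\sigma(M)})}\frac{\mu(\theta_n)}{I(\theta_n,\theta_{\sigma(M)})}\Big),$$ and under collision model 2 it holds with $$C(\Theta)=M\Big(\sum_{i=1}^M\sum_{k=1}^M x_k\,\mu(\theta_{\sigma(i)})-\sum_{n:\mu(\theta_n)<\mu(\theta_{\sigma(M)})}\mu(\theta_n)\max\Big\{\frac{1}{I(\theta_n,\theta_{\sigma(M)})}-\sum_{i=1}^{M-1}\frac{1}{I(\theta_n,\theta_{\sigma(i)})},\,0\Big\}\Big).$$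
   Context: **Arms.** There are $N$ independent arms and $M$ players, $1\le M<N$. At times $t=1,2,\dots$ arm $i$ has state $S_i(t)$, i.i.d. over $t$ with univariate density $f(s;\theta_i)$, where $\theta_i$ is an unknown element of a parameter space $\mathcal H$; $\Theta=(\theta_1,\dots,\theta_N)$. $\mu(\theta)$ is the mean of $f(\cdot;\theta)$ and $I(\theta,\theta')=\mathbb E_\theta[\log(f(y;\theta)/f(y;\theta'))]$ is the Kullback–Leibler distance. $\sigma$ is a permutation of $\{1,\dots,N\}$ with $\mu(\theta_{\sigma(1)})\ge\dots\ge\mu(\theta_{\sigma(N)})$; $\sigma(i)$ is the $i$th best arm. $\Theta$ is admissible if the $M$ best arms have distinct nonnegative means (with no tie at the $M$th largest mean). **Players.** At each time $t$ each player $i$ chooses an arm $a_i(t)$ based only on its own past observations and decisions, and observes the state $S_{a_i(t)}(t)$. No information is exchanged. **Collision models.** $Y(t)$ is the total reward at time $t$. Collision model 1: $Y(t)=\sum_{j=1}^N \mathbb I_j(t)S_j(t)$, $\mathbb I_j(t)=1$ if arm $j$ is played by at least one player, else $0$. Collision model 2: $Y(t)=\sum_{j=1}^N\hat{\mathbb I}_j(t)S_j(t)$, $\hat{\mathbb I}_j(t)=1$ if arm $j$ is played by exactly one player, else $0$. Regret: $R_T^\pi(\Theta)=T\sum_{j=1}^M\mu(\theta_{\sigma(j)})-\mathbb E_\pi[\sum_{t=1}^T Y(t)]$. **Standing conditions.** C1: $\mu(\theta)$ exists for all $\theta\in\mathcal H$. C2: $0<I(\theta,\theta')<\infty$ whenever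 $\mu(\theta)<\mu(\theta')$. C3: for all $\epsilon>0$ and $\mu(\theta)<\mu(\theta')$ there is $\delta>0$ such that $|I(\theta,\theta')-I(\theta,\theta'')|<\epsilon$ whenever $\mu(\theta')\le\mu(\theta'')\le\mu(\theta')+\delta$. C4: for all $\theta\in\mathcal H$ and $\delta>0$ there is $\theta'\in\mathcal H$ with $\mu(\theta)<\mu(\theta')<\mu(\theta)+\delta$. C5: we are given functions $h_k$ (point estimate) and $g_{t,k}$ (confidence upper bound) of $k$ observations such that, for i.i.d. observations $S(1),S(2),\dots$ from $f(\cdot;\theta)$ and every $\theta\in\mathcal H$: (i) $\Pr_\theta\{g_{t,k}(S(1),\dots,S(k))\ge r\text{ for all }k<t\}=1-o(t^{-1})$ for every $r<\mu(\theta)$; (ii) $\lim_{\epsilon\downarrow0}\limsup_{t\to\infty}\frac{1}{\log t}\sum_{k=1}^{t-1}\Pr_\theta\{g_{t,k}(S(1),\dots,S(k))\ge\mu(\theta')-\epsilon\}\le 1/I(\theta,\theta')$ whenever $\mu(\theta')>\mu(\theta)$; (iii) $g_{t,k}$ is nondecreasing in $t$ for each fixed $k$; (iv) $g_{t,k}\ge h_k$ for all $t$; (v) $\Pr_\theta\{\max_{\delta t\le k\le t}|h_k-\mu(\theta)|>\epsilon\}=o(t^{-1})$ for all $\epsilon>0$, $0<\delta<1$. **TDFS policy $\pi_F^*$.** Write $k\oslash l=((k-1)\bmod l)+1$. Fix $\delta\in(0,1/N)$. Time is split into $M$ subsequences; slot $t$ belongs to the $k$th subsequence if $t\oslash M=k$.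 For a given player, $\tau_{n,t}$ is the number of times it has played arm $n$ before time $t$; the point estimate of arm $n$ at time $t$ is $h_{\tau_{n,t}}$ and its confidence upper bound is $g_{t,\tau_{n,t}}$, both evaluated at all the observations of arm $n$ made by this player before $t$. Let $m_k(t)$ be the number of slots of the $k$th subsequence up to and including $t$. In slot $t$ of the $k$th subsequence player $i$ acts as follows. If $m_k(t)\le N$, play arm $m_k(t)$. Otherwise the player targets the $j$th best arm with $j=(k-i+M+1)\oslash M$: let $\mathcal A_t$ be the set of $j-1$ arms it played in the previous $j-1$ slots ($\mathcal A_t=\emptyset$ if $j=1$), and $\mathcal N_t=\{1,\dots,N\}\setminus\mathcal A_t$; the slot is said to belong to the mini-sequence (of this subsequence) associated with the arm set $\mathcal N_t$. Let $m_{\mathcal N_t}(t)$ be the number of slots in that mini-sequence up to and including $t$. The leader $l_t$ is the arm with the largest point estimate among the arms of $\mathcal N_t$ played at least $(m_{\mathcal N_t}(t)-1)\delta$ times by the player; the round-robin candidate $r_t$ is the $(m_{\mathcal N_t}(t)\oslash(N-j+1))$th arm of $\mathcal N_t$ (in a fixed ordering). The player plays $l_t$ if the point estimate of $l_t$ exceeds the confidence upper bound of $r_t$, and plays $r_t$ otherwise. (For $j=1$ there is a single mini-sequence, the whole subsequence, with $\mathcal N_t=\{1,\dots,N\}$.) Only in finitely many slots right after initialization can the previous $j-1$ slots contain repeated arms; any convention may be used there.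
   Formalization: The explicit constant for collision model 2 is proved only when all N arm means are nonnegative; with a negative-mean bad arm the stated constant can fail. A finite C(Θ) for both models and the explicit model 1 constant hold for every admissible Θ. *)

theory Defs
  imports "HOL-Probability.Probability" "HOL-Library.Landau_Symbols"
    "HOL-Combinatorics.Permutations"
begin

section \<open>Univariate density families\<close>

text \<open>Densities are taken with respect to an arbitrary sigma-finite measure \<open>\<nu>\<close> on the real
  line, so that Lebesgue densities and probability mass functions are both covered.\<close>

definition density_family :: "real measure \<Rightarrow> ('p \<Rightarrow> real \<Rightarrow> real) \<Rightarrow> 'p set \<Rightarrow> bool" where
  "density_family \<nu> f H \<longleftrightarrow> sigma_finite_measure \<nu> \<and> sets \<nu> = sets borel \<and>
     (\<forall>\<theta>\<in>H. f \<theta> \<in> borel_measurable borel \<and> (\<forall>s. 0 \<le> f \<theta> s) \<and>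
        (\<integral>\<^sup>+ s. ennreal (f \<theta> s) \<partial>\<nu>) = 1)"

definition arm_law :: "real measure \<Rightarrow> ('p \<Rightarrow> real \<Rightarrow> real) \<Rightarrow> 'p \<Rightarrow> real measure" where
  "arm_law \<nu> f \<theta> = density \<nu> (\<lambda>s. ennreal (f \<theta> s))"

definition mean :: "real measure \<Rightarrow> ('p \<Rightarrow> real \<Rightarrow> real) \<Rightarrow> 'p \<Rightarrow> real" where
  "mean \<nu> f \<theta> = (\<integral>s. s \<partial>arm_law \<nu> f \<theta>)"

definition KL :: "real measure \<Rightarrow> ('p \<Rightarrow> real \<Rightarrow> real) \<Rightarrow> 'p \<Rightarrow> 'p \<Rightarrow> real" where
  "KL \<nu> f \<theta> \<theta>' = (\<integral>y. ln (f \<theta> y / f \<theta>' y) \<partial>arm_law \<nu> f \<theta>)"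

text \<open>As an extended real, the Kullback-Leibler distance is finite iff \<open>f \<theta>'\<close> is almost surely
  positive under \<open>\<theta>\<close> and the log-likelihood ratio is integrable.  Positivity must be required
  explicitly, because \<open>ln (x / 0) = 0\<close> in HOL.\<close>

definition KL_finite :: "real measure \<Rightarrow> ('p \<Rightarrow> real \<Rightarrow> real) \<Rightarrow> 'p \<Rightarrow> 'p \<Rightarrow> bool" where
  "KL_finite \<nu> f \<theta> \<theta>' \<longleftrightarrow> (AE y in arm_law \<nu> f \<theta>. 0 < f \<theta>' y) \<and>
     integrable (arm_law \<nu> f \<theta>) (\<lambda>y. ln (f \<theta> y / f \<theta>' y))"

definition C1 :: "real measure \<Rightarrow> ('p \<Rightarrow> real \<Rightarrow> real) \<Rightarrow> 'p set \<Rightarrow> bool" where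
  "C1 \<nu> f H \<longleftrightarrow> (\<forall>\<theta>\<in>H. integrable (arm_law \<nu> f \<theta>) (\<lambda>s. s))"

definition C2 :: "real measure \<Rightarrow> ('p \<Rightarrow> real \<Rightarrow> real) \<Rightarrow> 'p set \<Rightarrow> bool" where
  "C2 \<nu> f H \<longleftrightarrow> (\<forall>\<theta>\<in>H. \<forall>\<theta>'\<in>H. mean \<nu> f \<theta> < mean \<nu> f \<theta>' \<longrightarrow>
     0 < KL \<nu> f \<theta> \<theta>' \<and> KL_finite \<nu> f \<theta> \<theta>')"

definition C3 :: "real measure \<Rightarrow> ('p \<Rightarrow> real \<Rightarrow> real) \<Rightarrow> 'p set \<Rightarrow> bool" where
  "C3 \<nu> f H \<longleftrightarrow> (\<forall>\<epsilon>>0. \<forall>\<theta>\<in>H. \<forall>\<theta>'\<in>H. mean \<nu> f \<theta> < mean \<nu> f \<theta>' \<longrightarrow>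
     (\<exists>\<delta>>0. \<forall>\<theta>''\<in>H. mean \<nu> f \<theta>' \<le> mean \<nu> f \<theta>'' \<and> mean \<nu> f \<theta>'' \<le> mean \<nu> f \<theta>' + \<delta> \<longrightarrow>
        \<bar>KL \<nu> f \<theta> \<theta>' - KL \<nu> f \<theta> \<theta>''\<bar> < \<epsilon>))"

definition C4 :: "real measure \<Rightarrow> ('p \<Rightarrow> real \<Rightarrow> real) \<Rightarrow> 'p set \<Rightarrow> bool" where
  "C4 \<nu> f H \<longleftrightarrow> (\<forall>\<theta>\<in>H. \<forall>\<delta>>0. \<exists>\<theta>'\<in>H. mean \<nu> f \<theta> < mean \<nu> f \<theta>' \<and> mean \<nu> f \<theta>' < mean \<nu> f \<theta> + \<delta>)"


section \<open>Point estimates and confidence upper bounds\<close>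

text \<open>A statistic of \<open>k\<close> observations is a measurable function on the product space indexed by
  \<open>{1..k}\<close>; \<open>h k\<close> is the point estimate and \<open>g t k\<close> the confidence upper bound.\<close>

definition iid :: "real measure \<Rightarrow> ('p \<Rightarrow> real \<Rightarrow> real) \<Rightarrow> 'p \<Rightarrow> (nat \<Rightarrow> real) measure" where
  "iid \<nu> f \<theta> = PiM {1..} (\<lambda>_. arm_law \<nu> f \<theta>)"

abbreviation obs_space :: "nat \<Rightarrow> (nat \<Rightarrow> real) measure" where
  "obs_space k \<equiv> PiM {1..k} (\<lambda>_. borel)"

definition C5 :: "real measure \<Rightarrow> ('p \<Rightarrow> real \<Rightarrow> real) \<Rightarrow> 'p set \<Rightarrow>
    (nat \<Rightarrow> (nat \<Rightarrow> real) \<Rightarrow> real) \<Rightarrow> (nat \<Rightarrow> nat \<Rightarrow> (nat \<Rightarrow> real) \<Rightarrow> real) \<Rightarrow> bool" where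
  "C5 \<nu> f H h g \<longleftrightarrow>
     (\<forall>k\<ge>1. h k \<in> borel_measurable (obs_space k)) \<and>
     (\<forall>t\<ge>1. \<forall>k\<ge>1. g t k \<in> borel_measurable (obs_space k)) \<and>
     (\<forall>\<theta>\<in>H. \<forall>r < mean \<nu> f \<theta>.
        (\<lambda>t. 1 - \<P>(S in iid \<nu> f \<theta>. \<forall>k\<in>{1..<t}. r \<le> g t k (restrict S {1..k})))
          \<in> o(\<lambda>t. 1 / real t)) \<and>
     (\<forall>\<theta>\<in>H. \<forall>\<theta>'\<in>H. mean \<nu> f \<theta> < mean \<nu> f \<theta>' \<longrightarrow>
        (\<exists>L. ((\<lambda>\<epsilon>. limsup (\<lambda>t. ereal (1 / ln (real t) *
                 (\<Sum>k=1..t-1. \<P>(S in iid \<nu> f \<theta>. mean \<nu> f \<theta>' - \<epsilon> \<le> g t k (restrict S {1..k}))))))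
               \<longlongrightarrow> L) (at_right (0::real)) \<and>
             L \<le> ereal (1 / KL \<nu> f \<theta> \<theta>'))) \<and>
     (\<forall>k\<ge>1. \<forall>t\<ge>1. \<forall>t'\<ge>t. \<forall>x\<in>space (obs_space k). g t k x \<le> g t' k x) \<and>
     (\<forall>k\<ge>1. \<forall>t\<ge>1. \<forall>x\<in>space (obs_space k). h k x \<le> g t k x) \<and>
     (\<forall>\<theta>\<in>H. \<forall>\<epsilon>>0. \<forall>\<delta>. 0 < \<delta> \<and> \<delta> < 1 \<longrightarrow>
        (\<lambda>t. \<P>(S in iid \<nu> f \<theta>.
                 Max ((\<lambda>k. \<bar>h k (restrict S {1..k}) - mean \<nu> f \<theta>\<bar>) ` {k. \<delta> * real t \<le> real k \<and> k \<le> t}) > \<epsilon>))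
          \<in> o(\<lambda>t. 1 / real t))"


section \<open>Arms, decentralized policies and regret\<close>

definition ranking :: "real measure \<Rightarrow> ('p \<Rightarrow> real \<Rightarrow> real) \<Rightarrow> nat \<Rightarrow> (nat \<Rightarrow> 'p) \<Rightarrow> (nat \<Rightarrow> nat) \<Rightarrow> bool" where
  "ranking \<nu> f N \<Theta> \<sigma> \<longleftrightarrow> \<sigma> permutes {1..N} \<and>
     (\<forall>i\<in>{1..N}. \<forall>j\<in>{1..N}. i \<le> j \<longrightarrow> mean \<nu> f (\<Theta> (\<sigma> j)) \<le> mean \<nu> f (\<Theta> (\<sigma> i)))"

definition admissible ::
  "real measure \<Rightarrow> ('p \<Rightarrow> real \<Rightarrow> real) \<Rightarrow> 'p set \<Rightarrow> nat \<Rightarrow> nat \<Rightarrow> (nat \<Rightarrow> 'p) \<Rightarrow> (nat \<Rightarrow> nat) \<Rightarrow> bool" where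
  "admissible \<nu> f H N M \<Theta> \<sigma> \<longleftrightarrow> (\<forall>i\<in>{1..N}. \<Theta> i \<in> H) \<and>
     inj_on (\<lambda>i. mean \<nu> f (\<Theta> (\<sigma> i))) {1..M} \<and>
     (\<forall>i\<in>{1..M}. 0 \<le> mean \<nu> f (\<Theta> (\<sigma> i))) \<and>
     (\<forall>j\<in>{M<..N}. mean \<nu> f (\<Theta> (\<sigma> j)) < mean \<nu> f (\<Theta> (\<sigma> M)))"

text \<open>An outcome \<open>\<omega>\<close> assigns to \<open>(j, t)\<close> the state of arm \<open>j\<close> at time \<open>t\<close>.\<close>

definition arm_states ::
  "real measure \<Rightarrow> ('p \<Rightarrow> real \<Rightarrow> real) \<Rightarrow> nat \<Rightarrow> (nat \<Rightarrow> 'p) \<Rightarrow> (nat \<times> nat \<Rightarrow> real) measure" where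
  "arm_states \<nu> f N \<Theta> = PiM ({1..N} \<times> {1..}) (\<lambda>(j, t). arm_law \<nu> f (\<Theta> j))"

text \<open>A history lists, in chronological order, the arms a player has played together with the
  states it has observed.  A decentralized policy maps a player and its own history to the next
  arm, so that no information is shared.\<close>

type_synonym history = "(nat \<times> real) list"
type_synonym policy = "nat \<Rightarrow> history \<Rightarrow> nat"

primrec history_of :: "policy \<Rightarrow> (nat \<times> nat \<Rightarrow> real) \<Rightarrow> nat \<Rightarrow> nat \<Rightarrow> history" where
  "history_of \<pi> \<omega> i 0 = []"
| "history_of \<pi> \<omega> i (Suc t) =
     (let a = \<pi> i (history_of \<pi> \<omega> i t) in history_of \<pi> \<omega> i t @ [(a, \<omega> (a, Suc t))])"

definition action :: "policy \<Rightarrow> (nat \<times> nat \<Rightarrow> real) \<Rightarrow> nat \<Rightarrow> nat \<Rightarrow> nat" where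
  "action \<pi> \<omega> i t = \<pi> i (history_of \<pi> \<omega> i (t - 1))"

datatype collision_model = Model1 | Model2

fun rewarded :: "collision_model \<Rightarrow> nat \<Rightarrow> (nat \<Rightarrow> nat) \<Rightarrow> nat \<Rightarrow> bool" where
  "rewarded Model1 M a j \<longleftrightarrow> (\<exists>i\<in>{1..M}. a i = j)"
| "rewarded Model2 M a j \<longleftrightarrow> (\<exists>!i. i \<in> {1..M} \<and> a i = j)"

definition total_reward ::
  "collision_model \<Rightarrow> nat \<Rightarrow> nat \<Rightarrow> policy \<Rightarrow> (nat \<times> nat \<Rightarrow> real) \<Rightarrow> nat \<Rightarrow> real" where
  "total_reward c N M \<pi> \<omega> t =
     (\<Sum>j=1..N. (if rewarded c M (\<lambda>i. action \<pi> \<omega> i t) j then 1 else 0) * \<omega> (j, t))"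

definition regret :: "real measure \<Rightarrow> ('p \<Rightarrow> real \<Rightarrow> real) \<Rightarrow> collision_model \<Rightarrow> nat \<Rightarrow> nat \<Rightarrow>
    policy \<Rightarrow> (nat \<Rightarrow> 'p) \<Rightarrow> (nat \<Rightarrow> nat) \<Rightarrow> nat \<Rightarrow> real" where
  "regret \<nu> f c N M \<pi> \<Theta> \<sigma> T =
     real T * (\<Sum>j=1..M. mean \<nu> f (\<Theta> (\<sigma> j))) -
     (\<integral>\<omega>. (\<Sum>t=1..T. total_reward c N M \<pi> \<omega> t) \<partial>arm_states \<nu> f N \<Theta>)"


section \<open>The TDFS policy\<close>

definition oslash :: "nat \<Rightarrow> nat \<Rightarrow> nat" (infixl "\<oslash>" 70) where
  "k \<oslash> l = (k - 1) mod l + 1"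

definition slot_index :: "nat \<Rightarrow> nat \<Rightarrow> nat" where
  "slot_index M t = card {s \<in> {1..t}. s \<oslash> M = t \<oslash> M}"

text \<open>For players \<open>i \<le> M\<close> the truncated subtraction below is exact.\<close>

definition target :: "nat \<Rightarrow> nat \<Rightarrow> nat \<Rightarrow> nat" where
  "target M i t = (t \<oslash> M + M + 1 - i) \<oslash> M"

definition plays :: "history \<Rightarrow> nat \<Rightarrow> nat" where
  "plays hs n = length (filter (\<lambda>(a, _). a = n) hs)"

definition observed :: "history \<Rightarrow> nat \<Rightarrow> nat \<Rightarrow> real" where
  "observed hs n = (\<lambda>k\<in>{1..plays hs n}. map snd (filter (\<lambda>(a, _). a = n) hs) ! (k - 1))"

definition point_estimate :: "(nat \<Rightarrow> (nat \<Rightarrow> real) \<Rightarrow> real) \<Rightarrow> history \<Rightarrow> nat \<Rightarrow> real" where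
  "point_estimate h hs n = h (plays hs n) (observed hs n)"

definition upper_bound :: "(nat \<Rightarrow> nat \<Rightarrow> (nat \<Rightarrow> real) \<Rightarrow> real) \<Rightarrow> history \<Rightarrow> nat \<Rightarrow> real" where
  "upper_bound g hs n = g (Suc (length hs)) (plays hs n) (observed hs n)"

text \<open>The set \<open>\<N>\<^sub>s\<close> for a slot \<open>s \<le> length hs + 1\<close>.  Slot \<open>r\<close> is entry \<open>r - 1\<close> of the history.\<close>

definition available :: "nat \<Rightarrow> nat \<Rightarrow> nat \<Rightarrow> history \<Rightarrow> nat \<Rightarrow> nat set" where
  "available N M i hs s =
     {1..N} - (\<lambda>r. fst (hs ! (r - 1))) ` {s + 1 - target M i s ..< s}"

text \<open>The position of the current slot in its mini-sequence.  The mini-sequence of target 1 is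
  the whole subsequence, initialization included; for the other targets mini-sequences consist of
  slots after the initialization.\<close>

definition mini_index :: "nat \<Rightarrow> nat \<Rightarrow> nat \<Rightarrow> history \<Rightarrow> nat" where
  "mini_index N M i hs = (let t = Suc (length hs) in
     card {s \<in> {1..t}. s \<oslash> M = t \<oslash> M \<and> (target M i s = 1 \<or> N < slot_index M s) \<and>
                        available N M i hs s = available N M i hs t})"

definition leader ::
  "(nat \<Rightarrow> (nat \<Rightarrow> real) \<Rightarrow> real) \<Rightarrow> real \<Rightarrow> nat \<Rightarrow> nat \<Rightarrow> nat \<Rightarrow> history \<Rightarrow> nat" where
  "leader h \<delta> N M i hs = arg_max_on (point_estimate h hs)
     {n \<in> available N M i hs (Suc (length hs)).
        (real (mini_index N M i hs) - 1) * \<delta> \<le> real (plays hs n)}"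

definition candidate :: "nat \<Rightarrow> nat \<Rightarrow> nat \<Rightarrow> history \<Rightarrow> nat" where
  "candidate N M i hs = (let t = Suc (length hs) in
     sorted_list_of_set (available N M i hs t) !
       (mini_index N M i hs \<oslash> (N + 1 - target M i t) - 1))"

definition TDFS :: "(nat \<Rightarrow> (nat \<Rightarrow> real) \<Rightarrow> real) \<Rightarrow> (nat \<Rightarrow> nat \<Rightarrow> (nat \<Rightarrow> real) \<Rightarrow> real) \<Rightarrow>
    real \<Rightarrow> nat \<Rightarrow> nat \<Rightarrow> policy" where
  "TDFS h g \<delta> N M i hs = (let t = Suc (length hs); l = leader h \<delta> N M i hs; r = candidate N M i hs in
     if slot_index M t \<le> N then slot_index M t
     else if point_estimate h hs l > upper_bound g hs r then l else r)"


section \<open>The regret constants\<close>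

definition x_coef ::
  "real measure \<Rightarrow> ('p \<Rightarrow> real \<Rightarrow> real) \<Rightarrow> nat \<Rightarrow> (nat \<Rightarrow> 'p) \<Rightarrow> (nat \<Rightarrow> nat) \<Rightarrow> nat \<Rightarrow> real" where
  "x_coef \<nu> f N \<Theta> \<sigma> k =
     (\<Sum>i=1..k. \<Sum>j | j \<in> {1..N} \<and> mean \<nu> f (\<Theta> j) < mean \<nu> f (\<Theta> (\<sigma> i)). 1 / KL \<nu> f (\<Theta> j) (\<Theta> (\<sigma> i)))"

definition const1 ::
  "real measure \<Rightarrow> ('p \<Rightarrow> real \<Rightarrow> real) \<Rightarrow> nat \<Rightarrow> nat \<Rightarrow> (nat \<Rightarrow> 'p) \<Rightarrow> (nat \<Rightarrow> nat) \<Rightarrow> real" where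
  "const1 \<nu> f N M \<Theta> \<sigma> = real M *
     ((\<Sum>i=1..M. x_coef \<nu> f N \<Theta> \<sigma> i * mean \<nu> f (\<Theta> (\<sigma> i))) -
      (\<Sum>n | n \<in> {1..N} \<and> mean \<nu> f (\<Theta> n) < mean \<nu> f (\<Theta> (\<sigma> M)).
         mean \<nu> f (\<Theta> n) / KL \<nu> f (\<Theta> n) (\<Theta> (\<sigma> M))))"

definition const2 ::
  "real measure \<Rightarrow> ('p \<Rightarrow> real \<Rightarrow> real) \<Rightarrow> nat \<Rightarrow> nat \<Rightarrow> (nat \<Rightarrow> 'p) \<Rightarrow> (nat \<Rightarrow> nat) \<Rightarrow> real" where
  "const2 \<nu> f N M \<Theta> \<sigma> = real M *
     ((\<Sum>i=1..M. \<Sum>k=1..M. x_coef \<nu> f N \<Theta> \<sigma> k * mean \<nu> f (\<Theta> (\<sigma> i))) -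
      (\<Sum>n | n \<in> {1..N} \<and> mean \<nu> f (\<Theta> n) < mean \<nu> f (\<Theta> (\<sigma> M)).
         mean \<nu> f (\<Theta> n) *
         max (1 / KL \<nu> f (\<Theta> n) (\<Theta> (\<sigma> M)) - (\<Sum>i=1..M-1. 1 / KL \<nu> f (\<Theta> n) (\<Theta> (\<sigma> i)))) 0))"

end

theory Submission
  imports Defs
begin

text \<open>
  Why logarithmic regret with these constants.  By the offsets, a player goes through the targets
  \<open>1, \<dots>, M\<close> in consecutive slots, a \<^emph>\<open>frame\<close>, and at each time the \<open>M\<close> players have distinct
  targets.  Reward is lost only where some player does not play the arm of its target.  Such a wrong
  slot is charged to the first wrong slot of its frame (\<open>wrong_has_first_wrong\<close>).  There the earlier
  targets have been played correctly, so the available arms are exactly \<open>\<sigma> ` {j..N}\<close>: one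
  mini-sequence per target accounts for all wrong slots.

  In such a mini-sequence the best arm \<open>b\<close> is separated from the others.  Suppose that the
  observations are regular from a level on: the estimates are accurate, and at dyadic times the
  confidence bounds of the best arms are valid.  A pathwise argument (\<open>best_played_each_turn\<close>,
  \<open>wrong_play_bound\<close>) then shows that \<open>b\<close> has as many plays as round-robin turns, which makes it
  eligible because \<open>\<delta> < 1 / N\<close>, and so it is the leader.  A worse arm \<open>n\<close> is then played only if
  its confidence bound reaches \<open>\<mu> b - \<epsilon>\<close>, and each play count of \<open>n\<close> occurs in only one such slot.
  So the number of these plays is at most the number of \<open>k < T\<close> for which \<open>g\<^sub>T\<^sub>,\<^sub>k\<close> is at least
  \<open>\<mu> b - \<epsilon>\<close>, which by C5 is about \<open>ln T / I(n, b)\<close> on average, plus the number of irregular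
  mini-indices.  Summing the failure probabilities \<open>o(2\<^sup>-\<^sup>e)\<close> over dyadic blocks, the mini-index \<open>m\<close> is
  irregular with probability \<open>o(1 / m)\<close> (\<open>prob_not_regular\<close>), and these add up to \<open>o(ln T)\<close>.

  The conditions C5 speak of i.i.d. observations, whereas a player samples adaptively.  The two are
  linked by \<open>distr_obs_seq\<close>: the observations of an arm, continued by states after the horizon, are
  i.i.d., because each play exchanges two coordinates of the product space that have the same law,
  on an event determined by the past.

  It remains to weigh the counts.  The loss of a slot is bounded by charges for the wrong players,
  minus the mean of a bad arm that is played as the first wrong arm at the last target
  (\<open>loss_model1\<close>, \<open>loss_model2_nonneg\<close>).  That gain is at most the charge of the same slot,
  so all coefficients of the counts stay nonnegative and upper bounds on the counts suffice
  (\<open>charge_mono\<close>).  Arms with a negative mean cost extra whenever they are played.  Their plays in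
  all mini-sequences share one sequence of observations, and every mini-sequence contains an arm of
  mean at least \<open>\<mu> (\<sigma> M)\<close>, so the total is about \<open>ln T / I(n, \<sigma> M)\<close> only (\<open>total_plays_rate\<close>).  For
  collision model 2 this weighing gives a constant at most the stated one.\<close>

section \<open>Slots, frames and mini-sequences\<close>

lemma slot_index_eq:
  assumes "1 \<le> M" "1 \<le> t"
  shows "slot_index M t = (t - 1) div M + 1"
proof -
  define c where "c = (t - 1) mod M"
  have eq: "{s \<in> {1..t}. s \<oslash> M = t \<oslash> M} = (\<lambda>q. q * M + c + 1) ` {..(t - 1) div M}"
  proof (intro subset_antisym subsetI)
    fix s assume "s \<in> {s \<in> {1..t}. s \<oslash> M = t \<oslash> M}"
    then have s: "1 \<le> s" "s \<le> t" "(s - 1) mod M = c"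
      by (auto simp: oslash_def c_def)
    have "s = (s - 1) div M * M + c + 1"
      using s(1) div_mult_mod_eq[of "s - 1" M] unfolding s(3) by simp
    moreover have "(s - 1) div M \<le> (t - 1) div M"
      using s(2) by (intro div_le_mono) simp
    ultimately show "s \<in> (\<lambda>q. q * M + c + 1) ` {..(t - 1) div M}" by blast
  next
    fix s assume "s \<in> (\<lambda>q. q * M + c + 1) ` {..(t - 1) div M}"
    then obtain q where q: "q \<le> (t - 1) div M" "s = q * M + c + 1" by auto
    have "q * M + c \<le> (t - 1) div M * M + c" using q(1) by simp
    also have "\<dots> = t - 1" by (simp add: c_def)
    finally have "s \<le> t" using q(2) assms(2) by simp
    moreover have "(s - 1) mod M = c" using q(2) assms(1) by (simp add: c_def)
    ultimately show "s \<in> {s \<in> {1..t}. s \<oslash> M = t \<oslash> M}"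
      using q(2) by (auto simp: oslash_def c_def)
  qed
  have "inj_on (\<lambda>q. q * M + c + 1) {..(t - 1) div M}"
    using assms(1) by (auto simp: inj_on_def)
  then show ?thesis
    unfolding slot_index_def eq by (simp add: card_image)
qed

lemma mod_add_right_cancel:
  fixes a b c M :: nat
  shows "(a + c) mod M = (b + c) mod M \<longleftrightarrow> a mod M = b mod M"
proof
  assume "(a + c) mod M = (b + c) mod M"
  then obtain p q where "a + c + M * p = b + c + M * q"
    unfolding nat_mod_eq_iff by blast
  then have "a + M * p = b + M * q" by simp
  then show "a mod M = b mod M"
    unfolding nat_mod_eq_iff by blast
qed (metis mod_add_left_eq)

lemma target_eq:
  assumes "i \<in> {1..M}" "1 \<le> t"
  shows "target M i t = (t + M - i) mod M + 1"
proof -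
  have "(t \<oslash> M + M + 1 - i) - 1 = (t - 1) mod M + (M + 1 - i)"
    using assms by (auto simp: oslash_def)
  moreover have "((t - 1) mod M + (M + 1 - i)) mod M = ((t - 1) + (M + 1 - i)) mod M"
    by (rule mod_add_left_eq)
  moreover have "(t - 1) + (M + 1 - i) = t + M - i" using assms by auto
  ultimately show ?thesis by (simp add: target_def oslash_def[of _ M])
qed

lemma target_bounds: "i \<in> {1..M} \<Longrightarrow> 1 \<le> t \<Longrightarrow> target M i t \<in> {1..M}"
  by (auto simp: target_eq Suc_le_eq)

lemma target_eq_iff:
  assumes "i \<in> {1..M}" "1 \<le> s" "1 \<le> t"
  shows "target M i s = target M i t \<longleftrightarrow> s \<oslash> M = t \<oslash> M"
proof -
  have *: "u + M - i = (u - 1) + (M + 1 - i)" if "1 \<le> u" for u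
    using assms(1) that by auto
  have "(s + M - i) mod M = (t + M - i) mod M \<longleftrightarrow> (s - 1) mod M = (t - 1) mod M"
    unfolding *[OF assms(2)] *[OF assms(3)]
    by (rule mod_add_right_cancel)
  then show ?thesis
    using assms by (simp add: target_eq oslash_def)
qed

text \<open>The offsets turn the slots of one player into frames: the targets of consecutive slots are
  \<open>1, 2, \<dots>, M, 1, 2, \<dots>\<close>.\<close>

lemma target_shift:
  assumes "i \<in> {1..M}" "d < target M i t" "target M i t \<le> t"
  shows "target M i (t - d) = target M i t - d"
proof -
  have t: "1 \<le> t" "d < t" using assms by auto
  have "d \<le> (t + M - i) mod M" using assms(2) t by (simp add: target_eq[OF assms(1)])
  then have "(t + M - i) mod M - d < M"
    using assms(1) by (meson less_imp_diff_less mod_less_divisor atLeastAtMost_iff le_trans less_le_trans zero_less_one)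
  moreover have "t + M - i = (t + M - i) div M * M + (t + M - i) mod M" by simp
  then have "t + M - i - d = (t + M - i) div M * M + ((t + M - i) mod M - d)"
    using \<open>d \<le> (t + M - i) mod M\<close> by linarith
  ultimately have "(t + M - i - d) mod M = (t + M - i) mod M - d"
    by (metis mod_less mod_mult_self3)
  moreover have "t - d + M - i = t + M - i - d" using t assms(1) by auto
  ultimately show ?thesis
    using t less_imp_le_nat[OF zero_less_diff[THEN iffD2, OF t(2)]] target_eq[OF assms(1), of t] target_eq[OF assms(1), of "t - d"]
      Suc_diff_le[OF \<open>d \<le> (t + M - i) mod M\<close>] by (simp add: Suc_le_eq)
qed

lemma ex1_player_with_target:
  assumes "1 \<le> t" "k \<in> {1..M}"
  shows "\<exists>!i. i \<in> {1..M} \<and> target M i t = k"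
proof (intro ex_ex1I)
  define i where "i = (t + M - k) mod M + 1"
  have M: "0 < M" using assms by auto
  have i: "i \<in> {1..M}" using M by (auto simp: i_def Suc_le_eq)
  have "(t + M - i + (i - 1)) mod M = (t + M - 1) mod M" using i by auto
  moreover have "(k - 1 + (t + M - k)) mod M = (t + M - 1) mod M"
    using assms by auto
  moreover have "(k - 1 + (i - 1)) mod M = (k - 1 + (t + M - k)) mod M"
    unfolding i_def by (simp add: mod_add_right_eq)
  ultimately have "(t + M - i) mod M = (k - 1) mod M"
    using mod_add_right_cancel[of "t + M - i" "i - 1" M "k - 1"] by simp
  then show "\<exists>i. i \<in> {1..M} \<and> target M i t = k"
    using i assms by (intro exI[of _ i]) (auto simp: target_eq)
next
  fix i i' assume a: "i \<in> {1..M} \<and> target M i t = k" "i' \<in> {1..M} \<and> target M i' t = k"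
  have *: "x = y" if "(t + M - x) mod M = (t + M - y) mod M" "x \<in> {1..M}" "y \<in> {1..M}" "x \<le> y" for x y
  proof -
    have "(t + M - x) = (t + M - y) + (y - x)" using that by auto
    then have "(y - x + (t + M - y)) mod M = (0 + (t + M - y)) mod M" using that(1) by (simp add: add.commute)
    then have "M dvd y - x" unfolding mod_add_right_cancel by (simp add: mod_eq_0_iff_dvd)
    moreover have "y - x < M" using that by auto
    ultimately have "\<not> 0 < y - x" using dvd_imp_le[of M "y - x"] by linarith
    then show "x = y" using that by simp
  qed
  have "(t + M - i) mod M = (t + M - i') mod M"
    using a target_eq[of i M t] target_eq[of i' M t] assms(1) by simp
  then show "i = i'"
    using a *[of i i'] *[of i' i] le_cases[of i i'] by argo
qed

section \<open>The run of one player\<close>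

lemma arg_max_on_finite:
  fixes f :: "'a \<Rightarrow> 'b :: linorder"
  assumes "finite S" "S \<noteq> {}"
  shows "arg_max_on f S \<in> S" and "\<And>y. y \<in> S \<Longrightarrow> f y \<le> f (arg_max_on f S)"
proof -
  have "Max (f ` S) \<in> f ` S" using assms by (intro Max_in) simp_all
  then obtain x where x: "x \<in> S" "Max (f ` S) = f x" by (elim imageE)
  have "f y \<le> f x" if "y \<in> S" for y
    unfolding x(2)[symmetric] using that assms(1) by (intro Max_ge) simp_all
  with x(1) have "is_arg_max f (\<lambda>x. x \<in> S) x" by (auto simp: is_arg_max_linorder)
  then have "is_arg_max f (\<lambda>x. x \<in> S) (arg_max_on f S)"
    unfolding arg_max_on_def arg_max_def by (rule someI)
  then show "arg_max_on f S \<in> S" "\<And>y. y \<in> S \<Longrightarrow> f y \<le> f (arg_max_on f S)"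
    by (auto simp: is_arg_max_linorder)
qed

locale tdfs =
  fixes N M :: nat and \<delta> :: real and h :: "nat \<Rightarrow> (nat \<Rightarrow> real) \<Rightarrow> real"
    and g :: "nat \<Rightarrow> nat \<Rightarrow> (nat \<Rightarrow> real) \<Rightarrow> real"
  assumes M_pos: "1 \<le> M" and M_less_N: "M < N"
    and \<delta>_pos: "0 < \<delta>" and \<delta>_less: "\<delta> < 1 / real N"
begin

definition hist :: "nat \<Rightarrow> (nat \<times> nat \<Rightarrow> real) \<Rightarrow> nat \<Rightarrow> history" where
  "hist i \<omega> t = history_of (TDFS h g \<delta> N M) \<omega> i t"

definition act :: "nat \<Rightarrow> (nat \<times> nat \<Rightarrow> real) \<Rightarrow> nat \<Rightarrow> nat" where
  "act i \<omega> t = action (TDFS h g \<delta> N M) \<omega> i t"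

lemma hist_0 [simp]: "hist i \<omega> 0 = []"
  by (simp add: hist_def)

lemma hist_Suc: "hist i \<omega> (Suc t) = hist i \<omega> t @ [(act i \<omega> (Suc t), \<omega> (act i \<omega> (Suc t), Suc t))]"
  by (simp add: hist_def act_def action_def Let_def)

lemma act_eq: "act i \<omega> t = TDFS h g \<delta> N M i (hist i \<omega> (t - 1))"
  by (simp add: hist_def act_def action_def)

lemma length_hist [simp]: "length (hist i \<omega> t) = t"
  by (induction t) (auto simp: hist_Suc)

lemma hist_nth: "r < t \<Longrightarrow> hist i \<omega> t ! r = (act i \<omega> (Suc r), \<omega> (act i \<omega> (Suc r), Suc r))"
  by (induction t) (auto simp: hist_Suc nth_append less_Suc_eq)

lemma plays_Nil [simp]: "plays [] n = 0"
  by (simp add: plays_def)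

lemma plays_hist_Suc:
  "plays (hist i \<omega> (Suc t)) n = plays (hist i \<omega> t) n + (if act i \<omega> (Suc t) = n then 1 else 0)"
  by (simp add: hist_Suc plays_def)

lemma plays_eq_card: "plays (hist i \<omega> t) n = card {r \<in> {1..t}. act i \<omega> r = n}"
proof (induction t)
  case (Suc t)
  have "{r \<in> {1..Suc t}. act i \<omega> r = n} =
      (if act i \<omega> (Suc t) = n then insert (Suc t) {r \<in> {1..t}. act i \<omega> r = n}
       else {r \<in> {1..t}. act i \<omega> r = n})"
    by (auto simp: le_Suc_eq)
  with Suc show ?case by (simp add: plays_hist_Suc)
qed simp

lemma plays_hist_mono: "s \<le> t \<Longrightarrow> plays (hist i \<omega> s) n \<le> plays (hist i \<omega> t) n"
  unfolding plays_eq_card by (intro card_mono) auto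

lemma plays_hist_le: "plays (hist i \<omega> t) n \<le> t"
  by (induction t) (auto simp: plays_hist_Suc)

text \<open>The set \<open>\<N>\<^sub>s\<close> in terms of the actions, so that it can be read off without a history.\<close>

definition avail :: "nat \<Rightarrow> (nat \<times> nat \<Rightarrow> real) \<Rightarrow> nat \<Rightarrow> nat set" where
  "avail i \<omega> s = {1..N} - act i \<omega> ` {s + 1 - target M i s..<s}"

lemma available_hist:
  assumes "1 \<le> s" "s \<le> Suc t" "target M i s \<le> s"
  shows "available N M i (hist i \<omega> t) s = avail i \<omega> s"
proof -
  have "fst (hist i \<omega> t ! (r - 1)) = act i \<omega> r" if "r \<in> {s + 1 - target M i s..<s}" for r
  proof -
    have "1 \<le> r" "r - 1 < t" using that assms by auto
    then show ?thesis by (simp add: hist_nth)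
  qed
  then show ?thesis by (simp add: available_def avail_def)
qed

lemma finite_avail [simp]: "finite (avail i \<omega> s)"
  by (simp add: avail_def)

lemma avail_subset: "avail i \<omega> s \<subseteq> {1..N}"
  by (auto simp: avail_def)

lemma card_avail_ge:
  assumes "i \<in> {1..M}" "1 \<le> s"
  shows "N + 1 - target M i s \<le> card (avail i \<omega> s)"
proof -
  have "card (act i \<omega> ` {s + 1 - target M i s..<s}) \<le> card {s + 1 - target M i s..<s}"
    by (rule card_image_le) simp
  also have "\<dots> \<le> target M i s - 1" using target_bounds[OF assms] by auto
  finally show ?thesis
    using diff_card_le_card_Diff[of "act i \<omega> ` {s + 1 - target M i s..<s}" "{1..N}"]
      target_bounds[OF assms] by (auto simp: avail_def)
qed

text \<open>As in the definition of the mini-index, initialization slots count for target 1 only.\<close>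

definition mini :: "nat \<Rightarrow> (nat \<times> nat \<Rightarrow> real) \<Rightarrow> nat \<Rightarrow> nat set \<Rightarrow> nat set" where
  "mini i \<omega> j A = {s. 1 \<le> s \<and> target M i s = j \<and> (j = 1 \<or> N < slot_index M s) \<and> avail i \<omega> s = A}"

lemma after_init_ge:
  assumes "1 \<le> s" "N < slot_index M s"
  shows "N * M < s"
proof -
  have "N \<le> (s - 1) div M" using assms M_pos by (simp add: slot_index_eq)
  then have "N * M \<le> s - 1" using M_pos by (simp add: less_eq_div_iff_mult_less_eq)
  then show ?thesis using assms by simp
qed

lemma after_init_iff:
  assumes "1 \<le> s"
  shows "N < slot_index M s \<longleftrightarrow> N * M < s"
proof
  assume "N * M < s"
  then have "N \<le> (s - 1) div M" using M_pos by (simp add: less_eq_div_iff_mult_less_eq)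
  then show "N < slot_index M s" using assms M_pos by (simp add: slot_index_eq)
qed (use after_init_ge assms in blast)

lemma M_le_NM: "M \<le> N * M"
  using M_less_N by simp

lemma target_le_slot:
  assumes "i \<in> {1..M}" "1 \<le> s" "target M i s = 1 \<or> N < slot_index M s"
  shows "target M i s \<le> s"
proof (cases "target M i s = 1")
  case False
  then have "N * M < s" using assms after_init_ge by blast
  moreover have "target M i s \<le> M" using target_bounds[OF assms(1,2)] by simp
  ultimately show ?thesis using M_le_NM by linarith
qed (use assms in simp)

lemma mini_index_hist:
  assumes "i \<in> {1..M}" "t \<in> mini i \<omega> j A"
  shows "mini_index N M i (hist i \<omega> (t - 1)) = card (mini i \<omega> j A \<inter> {1..t})"
proof -
  have t: "1 \<le> t" "target M i t = j" "j = 1 \<or> N < slot_index M t" "avail i \<omega> t = A"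
    using assms(2) by (auto simp: mini_def)
  have t': "Suc (t - 1) = t" using t by simp
  have "{s \<in> {1..t}. s \<oslash> M = t \<oslash> M \<and> (target M i s = 1 \<or> N < slot_index M s) \<and>
          available N M i (hist i \<omega> (t - 1)) s = available N M i (hist i \<omega> (t - 1)) t}
        = mini i \<omega> j A \<inter> {1..t}" (is "?L = ?R")
  proof -
    have *: "available N M i (hist i \<omega> (t - 1)) s = avail i \<omega> s"
      if "1 \<le> s" "s \<le> t" "target M i s = 1 \<or> N < slot_index M s" for s
      using that t target_le_slot[OF assms(1) that(1,3)] by (intro available_hist) auto
    have "s \<in> ?L \<longleftrightarrow> s \<in> ?R" for s
      using t target_eq_iff[OF assms(1), of s t] *[of s] *[of t] by (auto simp: mini_def)
    then show ?thesis by blast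
  qed
  then show ?thesis
    unfolding mini_index_def Let_def length_hist t' by simp
qed

lemma mini_index_le_slot_index:
  assumes "i \<in> {1..M}" "t \<in> mini i \<omega> j A"
  shows "card (mini i \<omega> j A \<inter> {1..t}) \<le> slot_index M t"
  unfolding slot_index_def
  using assms target_eq_iff[OF assms(1)] by (intro card_mono) (auto simp: mini_def)

lemma act_init:
  assumes "1 \<le> t" "slot_index M t \<le> N"
  shows "act i \<omega> t = slot_index M t"
  using assms by (simp add: act_eq TDFS_def Let_def)

lemma act_after_init:
  assumes "1 \<le> t" "N < slot_index M t"
  shows "act i \<omega> t =
    (if upper_bound g (hist i \<omega> (t - 1)) (candidate N M i (hist i \<omega> (t - 1)))
          < point_estimate h (hist i \<omega> (t - 1)) (leader h \<delta> N M i (hist i \<omega> (t - 1)))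
     then leader h \<delta> N M i (hist i \<omega> (t - 1)) else candidate N M i (hist i \<omega> (t - 1)))"
  using assms by (simp add: act_eq TDFS_def Let_def)

lemma plays_pos:
  assumes "1 \<le> t" "N < slot_index M t" "n \<in> {1..N}"
  shows "1 \<le> plays (hist i \<omega> (t - 1)) n"
proof -
  define r where "r = (n - 1) * M + 1"
  have sr: "slot_index M r = n" using M_pos assms by (auto simp: r_def slot_index_eq)
  have "(n - 1) * M + M \<le> N * M"
  proof -
    have "(n - 1) * M + M = n * M" using assms by (cases n) auto
    then show ?thesis using assms by auto
  qed
  then have "r \<le> t - 1" using after_init_ge[OF assms(1,2)] M_pos by (auto simp: r_def)
  moreover have "1 \<le> r" by (simp add: r_def)
  moreover from this have "act i \<omega> r = n" using sr assms by (auto simp: act_init)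
  ultimately have "{r} \<subseteq> {r \<in> {1..t - 1}. act i \<omega> r = n}" by auto
  then have "card {r} \<le> card {r \<in> {1..t - 1}. act i \<omega> r = n}" by (intro card_mono) auto
  then show ?thesis by (simp add: plays_eq_card)
qed

lemma candidate_eq:
  assumes "i \<in> {1..M}" "t \<in> mini i \<omega> j A"
  shows "candidate N M i (hist i \<omega> (t - 1)) =
    sorted_list_of_set A ! ((card (mini i \<omega> j A \<inter> {1..t}) - 1) mod (N + 1 - j))"
proof -
  have t: "1 \<le> t" "target M i t = j" "j = 1 \<or> N < slot_index M t" "avail i \<omega> t = A"
    using assms(2) by (auto simp: mini_def)
  have t': "Suc (t - 1) = t" using t by simp
  have "available N M i (hist i \<omega> (t - 1)) t = A"
    using t assms(1) target_le_slot[of i t] by (subst available_hist) auto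
  then show ?thesis
    using mini_index_hist[OF assms] t(2) unfolding candidate_def Let_def length_hist t' oslash_def
    by simp
qed

text \<open>Requiring a share of the plays is what makes the estimate of the leader reliable.\<close>

definition eligible :: "nat \<Rightarrow> (nat \<times> nat \<Rightarrow> real) \<Rightarrow> nat \<Rightarrow> nat set \<Rightarrow> nat \<Rightarrow> nat set" where
  "eligible i \<omega> j A t = {n \<in> A. (real (card (mini i \<omega> j A \<inter> {1..t})) - 1) * \<delta> \<le> real (plays (hist i \<omega> (t - 1)) n)}"

lemma leader_eq:
  assumes "i \<in> {1..M}" "t \<in> mini i \<omega> j A"
  shows "leader h \<delta> N M i (hist i \<omega> (t - 1)) =
    arg_max_on (point_estimate h (hist i \<omega> (t - 1))) (eligible i \<omega> j A t)"
proof -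
  have t: "1 \<le> t" "target M i t = j" "j = 1 \<or> N < slot_index M t" "avail i \<omega> t = A"
    using assms(2) by (auto simp: mini_def)
  have t': "Suc (t - 1) = t" using t by simp
  have "available N M i (hist i \<omega> (t - 1)) t = A"
    using t assms(1) target_le_slot[of i t] by (subst available_hist) auto
  then show ?thesis
    using mini_index_hist[OF assms] unfolding leader_def eligible_def length_hist t' by simp
qed

lemma mini_arms:
  assumes "i \<in> {1..M}" "t \<in> mini i \<omega> j A"
  shows "finite A" "A \<subseteq> {1..N}" "N + 1 - j \<le> card A" "j \<in> {1..M}"
  using assms card_avail_ge[OF assms(1), of t \<omega>] avail_subset[of i \<omega> t] finite_avail[of i \<omega> t]
    target_bounds[of i M t] by (auto simp: mini_def)

text \<open>A pigeonhole argument: the earlier slots of the mini-sequence were all spent on arms of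
  \<open>A\<close>, so one of these at most \<open>N < 1 / \<delta>\<close> arms has received its share.\<close>

lemma eligible_nonempty:
  assumes "i \<in> {1..M}" "t \<in> mini i \<omega> j A"
    and "\<And>s. s \<in> mini i \<omega> j A \<Longrightarrow> s < t \<Longrightarrow> act i \<omega> s \<in> A"
  shows "eligible i \<omega> j A t \<noteq> {}"
proof
  assume empty: "eligible i \<omega> j A t = {}"
  note A = mini_arms[OF assms(1,2)]
  have A0: "A \<noteq> {}" using A M_less_N by auto
  have "1 \<le> t" using assms(2) by (simp add: mini_def)
  then have "mini i \<omega> j A \<inter> {1..t} = insert t (mini i \<omega> j A \<inter> {1..t - 1})"
    using assms(2) by (auto simp: le_Suc_eq)
  then have m: "real (card (mini i \<omega> j A \<inter> {1..t})) - 1 = card (mini i \<omega> j A \<inter> {1..t - 1})"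
    using \<open>1 \<le> t\<close> by (auto simp: card_insert_if)
  define m' where "m' = card (mini i \<omega> j A \<inter> {1..t - 1})"
  have less: "real (plays (hist i \<omega> (t - 1)) n) < real m' * \<delta>" if "n \<in> A" for n
    using empty that unfolding eligible_def m m'_def by auto
  have "mini i \<omega> j A \<inter> {1..t - 1} \<subseteq> (\<Union>n\<in>A. {r \<in> {1..t - 1}. act i \<omega> r = n})"
    using assms(3) by auto
  then have "m' \<le> card (\<Union>n\<in>A. {r \<in> {1..t - 1}. act i \<omega> r = n})"
    unfolding m'_def using A by (intro card_mono) auto
  also have "\<dots> \<le> (\<Sum>n\<in>A. plays (hist i \<omega> (t - 1)) n)"
    unfolding plays_eq_card using A(1) by (rule card_UN_le)
  finally have "real m' \<le> (\<Sum>n\<in>A. real (plays (hist i \<omega> (t - 1)) n))"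
    by (metis of_nat_le_iff of_nat_sum)
  also have "\<dots> < (\<Sum>n\<in>A. real m' * \<delta>)"
    using less A0 A(1) by (intro sum_strict_mono) auto
  also have "\<dots> \<le> real m' * (real N * \<delta>)"
  proof -
    have "real (card A) * (real m' * \<delta>) \<le> real N * (real m' * \<delta>)"
      using A card_mono[of "{1..N}" A] \<delta>_pos by (intro mult_right_mono) auto
    then show ?thesis by (simp add: ac_simps)
  qed
  also have "\<dots> \<le> real m' * 1"
    using \<delta>_less M_less_N by (intro mult_left_mono) (auto simp: field_simps)
  finally show False by simp
qed

lemma act_after_init_cases:
  assumes "1 \<le> t" "N < slot_index M t"
  obtains "act i \<omega> t = leader h \<delta> N M i (hist i \<omega> (t - 1))"
    | "act i \<omega> t = candidate N M i (hist i \<omega> (t - 1))"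
proof (cases "upper_bound g (hist i \<omega> (t - 1)) (candidate N M i (hist i \<omega> (t - 1)))
          < point_estimate h (hist i \<omega> (t - 1)) (leader h \<delta> N M i (hist i \<omega> (t - 1)))")
  case True
  show ?thesis by (rule that(1)) (unfold act_after_init[OF assms] if_P[OF True], rule refl)
next
  case False
  show ?thesis by (rule that(2)) (unfold act_after_init[OF assms] if_not_P[OF False], rule refl)
qed

lemma act_in_avail:
  assumes i: "i \<in> {1..M}" and "1 \<le> t" "N < slot_index M t"
  shows "act i \<omega> t \<in> avail i \<omega> t"
  using assms(2,3)
proof (induction t rule: less_induct)
  case (less t)
  define j A where "j = target M i t" and "A = avail i \<omega> t"
  have t: "t \<in> mini i \<omega> j A" using less.prems by (simp add: mini_def j_def A_def)
  note A = mini_arms[OF i t]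
  have prev: "act i \<omega> s \<in> A" if s: "s \<in> mini i \<omega> j A" "s < t" for s
  proof -
    have s': "1 \<le> s" "target M i s = j" "j = 1 \<or> N < slot_index M s" "avail i \<omega> s = A"
      using s(1) by (simp_all add: mini_def)
    show ?thesis
    proof (cases "N < slot_index M s")
      case True
      then show ?thesis using less.IH[OF s(2) s'(1)] unfolding s'(4) by blast
    next
      case False
      then have "avail i \<omega> s = {1..N}" using s'(2,3) by (simp add: avail_def)
      then have "A = {1..N}" by (simp add: s'(4))
      moreover have "act i \<omega> s = slot_index M s" "1 \<le> slot_index M s"
        using False s' M_pos act_init[of s] by (simp_all add: slot_index_eq)
      ultimately show ?thesis using False by simp
    qed
  qed
  have "eligible i \<omega> j A t \<noteq> {}" by (rule eligible_nonempty[OF i t prev])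
  moreover have "finite (eligible i \<omega> j A t)" using A(1) by (simp add: eligible_def)
  ultimately have "leader h \<delta> N M i (hist i \<omega> (t - 1)) \<in> eligible i \<omega> j A t"
    unfolding leader_eq[OF i t] by (intro arg_max_on_finite(1))
  then have l: "leader h \<delta> N M i (hist i \<omega> (t - 1)) \<in> A" by (simp add: eligible_def)
  have r: "candidate N M i (hist i \<omega> (t - 1)) \<in> A"
  proof -
    have "(card (mini i \<omega> j A \<inter> {1..t}) - 1) mod (N + 1 - j) < N + 1 - j"
      using A M_less_N by (intro mod_less_divisor) auto
    then have "(card (mini i \<omega> j A \<inter> {1..t}) - 1) mod (N + 1 - j) < length (sorted_list_of_set A)"
      using A by simp
    then have "sorted_list_of_set A ! ((card (mini i \<omega> j A \<inter> {1..t}) - 1) mod (N + 1 - j))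
        \<in> set (sorted_list_of_set A)"
      by (rule nth_mem)
    then show ?thesis
      unfolding candidate_eq[OF i t] using A(1) by simp
  qed
  have "act i \<omega> t \<in> A"
    using less.prems by (rule act_after_init_cases[where i = i and \<omega> = \<omega>]) (simp_all only: l r)
  then show ?case unfolding A_def .
qed

lemma act_range:
  assumes "i \<in> {1..M}" "1 \<le> t"
  shows "act i \<omega> t \<in> {1..N}"
proof (cases "N < slot_index M t")
  case True
  show ?thesis by (rule subsetD[OF avail_subset act_in_avail[OF assms True]])
next
  case False
  moreover have "1 \<le> slot_index M t" using assms(2) M_pos by (simp add: slot_index_eq)
  ultimately show ?thesis using act_init[OF assms(2), of i \<omega>] by simp
qed

lemma act_in_mini:
  assumes "i \<in> {1..M}" "s \<in> mini i \<omega> j A"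
  shows "act i \<omega> s \<in> A"
proof -
  have s: "1 \<le> s" "target M i s = j" "j = 1 \<or> N < slot_index M s" "A = avail i \<omega> s"
    using assms(2) by (simp_all add: mini_def)
  show ?thesis
  proof (cases "N < slot_index M s")
    case True
    show ?thesis unfolding s(4) by (rule act_in_avail[OF assms(1) s(1) True])
  next
    case False
    then have "avail i \<omega> s = {1..N}" using s(2,3) by (simp add: avail_def)
    then show ?thesis using act_range[OF assms(1) s(1), of \<omega>] s(4) by simp
  qed
qed

lemma card_avail:
  assumes "i \<in> {1..M}" "N * M + M < t"
  shows "card (avail i \<omega> t) = N + 1 - target M i t"
proof -
  define j where "j = target M i t"
  have j: "j \<in> {1..M}" using target_bounds[of i M t] assms by (auto simp: j_def)
  have ne: "act i \<omega> r \<noteq> act i \<omega> s" if "r < s" "s < t" "t + 1 - j \<le> r" for r s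
  proof -
    have "target M i (t - (t - s)) = j - (t - s)"
      using that assms j unfolding j_def by (intro target_shift) auto
    then have ts: "target M i s = j - (t - s)" using that by simp
    have "N < slot_index M s" using that assms j by (subst after_init_iff) auto
    then have "act i \<omega> s \<in> avail i \<omega> s"
      using that assms by (intro act_in_avail) auto
    moreover have "r \<in> {s + 1 - target M i s..<s}" using that ts by auto
    ultimately show ?thesis unfolding avail_def by (metis DiffD2 imageI)
  qed
  have "inj_on (act i \<omega>) {t + 1 - j..<t}"
  proof (rule inj_onI)
    fix r s assume "r \<in> {t + 1 - j..<t}" "s \<in> {t + 1 - j..<t}" "act i \<omega> r = act i \<omega> s"
    then show "r = s" using ne[of r s] ne[of s r] by (metis atLeastLessThan_iff nat_neq_iff)
  qed
  moreover have "act i \<omega> ` {t + 1 - j..<t} \<subseteq> {1..N}"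
    using act_range[OF assms(1)] assms j by (auto simp del: One_nat_def)
  ultimately have "card (avail i \<omega> t) = N - (t - (t + 1 - j))"
    unfolding avail_def j_def[symmetric] by (subst card_Diff_subset) (auto simp: card_image)
  then show ?thesis using assms j by (auto simp: j_def)
qed

end

section \<open>The leader of a mini-sequence\<close>

lemma card_residue_ge:
  fixes a n p L :: nat
  assumes "p < L"
  shows "n div L \<le> card {u \<in> {a..<a + n}. u mod L = p}"
proof -
  define r where "r = (p + (L - a mod L)) mod L"
  have "(a mod L + r) mod L = (a mod L + (p + (L - a mod L))) mod L"
    unfolding r_def by (rule mod_add_right_eq)
  also have "a mod L + (p + (L - a mod L)) = p + L"
    using mod_less_divisor[of L a] assms by linarith
  finally have r: "(a + r) mod L = p" using assms by (simp add: mod_add_left_eq)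
  have rL: "r < L" using assms by (simp add: r_def)
  have "card ((\<lambda>k. a + k * L + r) ` {..<n div L}) = n div L"
    using assms by (subst card_image) (auto simp: inj_on_def)
  moreover have "(\<lambda>k. a + k * L + r) ` {..<n div L} \<subseteq> {u \<in> {a..<a + n}. u mod L = p}"
  proof (intro image_subsetI)
    fix k assume "k \<in> {..<n div L}"
    then have "Suc k * L \<le> n div L * L" by (intro mult_le_mono1) simp
    also have "\<dots> \<le> n" by simp
    finally have "k * L + r < n" using rL by simp
    moreover have "(a + k * L + r) mod L = (a + r + k * L) mod L" by (simp add: ac_simps)
    then have "(a + k * L + r) mod L = p" using r by simp
    ultimately show "a + k * L + r \<in> {u \<in> {a..<a + n}. u mod L = p}" by simp
  qed
  then have "card ((\<lambda>k. a + k * L + r) ` {..<n div L}) \<le> card {u \<in> {a..<a + n}. u mod L = p}"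
    by (intro card_mono) simp_all
  ultimately show ?thesis by simp
qed

lemma card_residue_le:
  fixes a n p L :: nat
  shows "card {u \<in> {a..a + n}. u mod L = p} \<le> n div L + 1"
proof -
  have "inj_on (\<lambda>u. (u - a) div L) {u \<in> {a..a + n}. u mod L = p}"
  proof (rule inj_onI)
    fix u v assume u: "u \<in> {u \<in> {a..a + n}. u mod L = p}" and v: "v \<in> {u \<in> {a..a + n}. u mod L = p}"
      and eq: "(u - a) div L = (v - a) div L"
    have "(u - a + a) mod L = (v - a + a) mod L" using u v by simp
    then have "(u - a) mod L = (v - a) mod L" by (simp only: mod_add_right_cancel)
    with eq have "u - a = v - a" by (metis div_mult_mod_eq)
    then show "u = v" using u v by auto
  qed
  then have "card {u \<in> {a..a + n}. u mod L = p} \<le> card {..n div L}"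
    by (rule card_inj_on_le) (auto intro!: div_le_mono)
  then show ?thesis by simp
qed

lemma dyadic_index:
  fixes k q :: nat
  assumes "2 ^ q \<le> k"
  obtains e where "q \<le> e" "e < k" "2 ^ e \<le> k" "k < 2 ^ (e + 1)"
proof -
  have "1 \<le> k" using assms by (meson le_trans one_le_numeral one_le_power)
  then obtain e where e: "2 ^ e \<le> k" "k < 2 ^ (e + 1)"
    using ex_power_ivl1[of 2 k] by auto
  have "(2::nat) ^ q < 2 ^ (e + 1)" using assms e by linarith
  then have "q < e + 1" by (rule power_less_imp_less_exp[rotated]) simp
  moreover have "e < 2 ^ e" by (rule less_exp)
  ultimately show ?thesis using e by (intro that[of e]) linarith+
qed

text \<open>Both regularity conditions are imposed on dyadic blocks only, so that the probabilities
  in C5, which are \<open>o(1 / t)\<close>, can be summed over the blocks.\<close>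

definition estimates_accurate ::
  "(nat \<Rightarrow> (nat \<Rightarrow> real) \<Rightarrow> real) \<Rightarrow> nat \<Rightarrow> nat \<Rightarrow> real \<Rightarrow> real \<Rightarrow> (nat \<Rightarrow> real) \<Rightarrow> bool" where
  "estimates_accurate h q R m \<epsilon> y \<longleftrightarrow>
     (\<forall>e\<in>{q..R}. \<forall>k\<in>{2 ^ e..2 ^ (e + 1)}. \<bar>h k (restrict y {1..k}) - m\<bar> \<le> \<epsilon>)"

definition bounds_valid ::
  "(nat \<Rightarrow> nat \<Rightarrow> (nat \<Rightarrow> real) \<Rightarrow> real) \<Rightarrow> nat \<Rightarrow> nat \<Rightarrow> real \<Rightarrow> (nat \<Rightarrow> real) \<Rightarrow> bool" where
  "bounds_valid g q R r y \<longleftrightarrow>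
     (\<forall>e\<in>{q..R}. \<forall>k\<in>{1..<2 ^ e}. r \<le> g (2 ^ e) k (restrict y {1..k}))"

lemma estimates_accurateD:
  assumes "estimates_accurate h q R m \<epsilon> y" "2 ^ q \<le> k" "k \<le> R"
  shows "\<bar>h k (restrict y {1..k}) - m\<bar> \<le> \<epsilon>"
proof -
  obtain e where "q \<le> e" "e < k" "2 ^ e \<le> k" "k < 2 ^ (e + 1)"
    using dyadic_index[OF assms(2)] .
  then show ?thesis using assms unfolding estimates_accurate_def by force
qed

text \<open>One run of one player up to time \<open>T\<close>.  The sequence \<open>x n\<close> extends the observations of
  arm \<open>n\<close>, so that statements about the run become statements about these sequences.\<close>

locale tdfs_run = tdfs +
  fixes i :: nat and \<omega> :: "nat \<times> nat \<Rightarrow> real" and T :: nat and x :: "nat \<Rightarrow> nat \<Rightarrow> real"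
    and \<mu> :: "nat \<Rightarrow> real" and \<epsilon> :: real and B :: "nat set"
  assumes player: "i \<in> {1..M}"
    and observed_eq: "\<And>t n. t < T \<Longrightarrow> n \<in> {1..N} \<Longrightarrow>
        observed (hist i \<omega> t) n = restrict (x n) {1..plays (hist i \<omega> t) n}"
    and g_mono: "\<And>k t t' y. 1 \<le> k \<Longrightarrow> 1 \<le> t \<Longrightarrow> t \<le> t' \<Longrightarrow>
        g t k (restrict y {1..k}) \<le> g t' k (restrict y {1..k})"
begin

definition good :: "nat \<Rightarrow> bool" where
  "good q \<longleftrightarrow> (\<forall>n\<in>{1..N}. estimates_accurate h q T (\<mu> n) \<epsilon> (x n)) \<and>
     (\<forall>b\<in>B. bounds_valid g q T (\<mu> b - \<epsilon>) (x b))"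

text \<open>Right after the initialization, repeated arms can leave more than \<open>N + 1 - j\<close> arms available; then
  the round robin does not reach all of them, so the size is part of the condition.  The gap of more
  than \<open>2 * \<epsilon>\<close> separates \<open>b\<close> from the others under estimates of accuracy \<open>\<epsilon>\<close>.\<close>

definition clear_best :: "nat \<Rightarrow> nat set \<Rightarrow> nat \<Rightarrow> bool" where
  "clear_best j A b \<longleftrightarrow> card A = N + 1 - j \<and> b \<in> A \<and> b \<in> B \<and> (\<forall>n\<in>A - {b}. \<mu> n + \<epsilon> < \<mu> b - \<epsilon>)"

abbreviation pl :: "nat \<Rightarrow> nat \<Rightarrow> nat" where
  "pl n t \<equiv> plays (hist i \<omega> t) n"

abbreviation mini_count :: "nat \<Rightarrow> nat set \<Rightarrow> nat \<Rightarrow> nat" where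
  "mini_count j A t \<equiv> card (mini i \<omega> j A \<inter> {1..t})"

lemma point_estimate_eq:
  assumes "1 \<le> t" "t \<le> T" "n \<in> {1..N}"
  shows "point_estimate h (hist i \<omega> (t - 1)) n = h (pl n (t - 1)) (restrict (x n) {1..pl n (t - 1)})"
  using observed_eq[of "t - 1" n] assms by (simp add: point_estimate_def)

lemma upper_bound_eq:
  assumes "1 \<le> t" "t \<le> T" "n \<in> {1..N}"
  shows "upper_bound g (hist i \<omega> (t - 1)) n = g t (pl n (t - 1)) (restrict (x n) {1..pl n (t - 1)})"
  using observed_eq[of "t - 1" n] assms by (simp add: upper_bound_def)

lemma mini_count_Suc:
  "mini_count j A (Suc t) = mini_count j A t + (if Suc t \<in> mini i \<omega> j A then 1 else 0)"
proof -
  have "mini i \<omega> j A \<inter> {1..Suc t} =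
      (if Suc t \<in> mini i \<omega> j A then insert (Suc t) (mini i \<omega> j A \<inter> {1..t}) else mini i \<omega> j A \<inter> {1..t})"
    by (auto simp: le_Suc_eq)
  then show ?thesis by simp
qed

lemma mini_count_mono: "s \<le> t \<Longrightarrow> mini_count j A s \<le> mini_count j A t"
  by (intro card_mono) auto

lemma mini_count_le: "mini_count j A t \<le> t"
  using card_mono[of "{1..t}" "mini i \<omega> j A \<inter> {1..t}"] by simp

lemma mini_count_pred:
  assumes "t \<in> mini i \<omega> j A"
  shows "mini_count j A t = Suc (mini_count j A (t - 1))"
proof -
  have "1 \<le> t" using assms by (simp add: mini_def)
  then show ?thesis using mini_count_Suc[of j A "t - 1"] assms by simp
qed

lemma inj_on_mini_count: "inj_on (mini_count j A) (mini i \<omega> j A)"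
proof (rule linorder_inj_onI')
  fix s t assume "s \<in> mini i \<omega> j A" "t \<in> mini i \<omega> j A" "s < t"
  then have "mini_count j A s \<le> mini_count j A (t - 1)" by (intro mini_count_mono) simp
  then show "mini_count j A s \<noteq> mini_count j A t"
    using mini_count_pred[OF \<open>t \<in> mini i \<omega> j A\<close>] by simp
qed

lemma mini_after_init:
  assumes "t \<in> mini i \<omega> j A" "N < mini_count j A t"
  shows "N < slot_index M t"
  using mini_index_le_slot_index[OF player assms(1)] assms(2) by simp

lemma leader_eligible:
  assumes "t \<in> mini i \<omega> j A"
  shows "leader h \<delta> N M i (hist i \<omega> (t - 1)) \<in> eligible i \<omega> j A t"
    and "\<And>n. n \<in> eligible i \<omega> j A t \<Longrightarrow>
      point_estimate h (hist i \<omega> (t - 1)) n \<le>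
      point_estimate h (hist i \<omega> (t - 1)) (leader h \<delta> N M i (hist i \<omega> (t - 1)))"
proof -
  have fin: "finite (eligible i \<omega> j A t)"
    using mini_arms(1)[OF player assms] by (simp add: eligible_def)
  have ne: "eligible i \<omega> j A t \<noteq> {}"
    by (rule eligible_nonempty[OF player assms act_in_mini[OF player]])
  show "leader h \<delta> N M i (hist i \<omega> (t - 1)) \<in> eligible i \<omega> j A t"
    unfolding leader_eq[OF player assms] by (rule arg_max_on_finite(1)[OF fin ne])
  show "\<And>n. n \<in> eligible i \<omega> j A t \<Longrightarrow>
      point_estimate h (hist i \<omega> (t - 1)) n \<le>
      point_estimate h (hist i \<omega> (t - 1)) (leader h \<delta> N M i (hist i \<omega> (t - 1)))"
    unfolding leader_eq[OF player assms] by (rule arg_max_on_finite(2)[OF fin ne])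
qed

text \<open>An eligible arm has been played often enough for its estimate to be accurate.\<close>

lemma eligible_accurate:
  assumes "good q" "t \<in> mini i \<omega> j A" "t \<le> T" "n \<in> eligible i \<omega> j A t"
    and "2 ^ q \<le> \<delta> * real (mini_count j A (t - 1))"
  shows "\<bar>point_estimate h (hist i \<omega> (t - 1)) n - \<mu> n\<bar> \<le> \<epsilon>"
proof -
  have t: "1 \<le> t" using assms(2) by (simp add: mini_def)
  have n: "n \<in> {1..N}" using assms(4) mini_arms(2)[OF player assms(2)] by (auto simp: eligible_def)
  have "real (mini_count j A (t - 1)) * \<delta> \<le> real (pl n (t - 1))"
    using assms(4) mini_count_pred[OF assms(2)] by (simp add: eligible_def)
  then have "2 ^ q \<le> real (pl n (t - 1))"
    unfolding mult.commute[of _ \<delta>] by (rule order_trans[OF assms(5)])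
  then have "2 ^ q \<le> pl n (t - 1)" by (rule numeral_power_le_of_nat_cancel_iff[THEN iffD1])
  moreover have "pl n (t - 1) \<le> T" using plays_hist_le[of i \<omega> "t - 1" n] assms(3) by simp
  ultimately show ?thesis
    using assms(1) n unfolding point_estimate_eq[OF t assms(3) n] good_def
    by (intro estimates_accurateD) auto
qed

text \<open>The round robin reaches \<open>b\<close> in this slot.  A wrong leader has an accurate and hence small
  estimate, so it can win against \<open>b\<close> only if the confidence bound of \<open>b\<close> is invalid; on dyadic
  times this is excluded, unless \<open>b\<close> has been played very often already.\<close>

lemma best_candidate_played:
  assumes "good q" "clear_best j A b" "t \<in> mini i \<omega> j A" "t \<le> T"
    and "2 ^ q \<le> \<delta> * real (mini_count j A (t - 1))" "2 ^ q \<le> mini_count j A t" "N < mini_count j A t"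
    and cand: "candidate N M i (hist i \<omega> (t - 1)) = b"
  shows "act i \<omega> t = b \<or> mini_count j A t \<le> 2 * pl b (t - 1)"
proof (rule ccontr)
  assume "\<not> ?thesis"
  then have nb: "act i \<omega> t \<noteq> b" and few: "2 * pl b (t - 1) < mini_count j A t" by auto
  define l where "l = leader h \<delta> N M i (hist i \<omega> (t - 1))"
  have t: "1 \<le> t" using assms(3) by (simp add: mini_def)
  have init: "N < slot_index M t" by (rule mini_after_init[OF assms(3,7)])
  have b: "b \<in> A" "b \<in> B" "b \<in> {1..N}" and gap: "\<And>n. n \<in> A - {b} \<Longrightarrow> \<mu> n + \<epsilon> < \<mu> b - \<epsilon>"
    using assms(2) mini_arms(2)[OF player assms(3)] by (auto simp: clear_best_def)
  have act: "act i \<omega> t = l" and less: "upper_bound g (hist i \<omega> (t - 1)) b < point_estimate h (hist i \<omega> (t - 1)) l"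
    using act_after_init[OF t init, of i \<omega>] nb unfolding cand l_def[symmetric]
    by (auto split: if_splits)
  have l: "l \<in> eligible i \<omega> j A t" unfolding l_def by (rule leader_eligible[OF assms(3)])
  then have "l \<in> A - {b}" using act nb by (auto simp: eligible_def)
  from gap[OF this] eligible_accurate[OF assms(1,3,4) l assms(5)] less
  have ub: "upper_bound g (hist i \<omega> (t - 1)) b < \<mu> b - \<epsilon>" by linarith
  define k where "k = pl b (t - 1)"
  have k: "1 \<le> k" unfolding k_def by (rule plays_pos[OF t init b(3)])
  \<comment> \<open>The bound is used at the fixed time \<open>2 ^ e\<close>, because the time of a given mini-index is random.\<close>
  obtain e where e: "q \<le> e" "e < mini_count j A t" "2 ^ e \<le> mini_count j A t" "mini_count j A t < 2 ^ (e + 1)"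
    using dyadic_index[OF assms(6)] .
  have "k < 2 ^ e" using few e(4) by (simp add: k_def)
  moreover have "e \<le> T" "2 ^ e \<le> t" using e(2,3) mini_count_le[of j A t] assms(4) by auto
  ultimately have "\<mu> b - \<epsilon> \<le> g (2 ^ e) k (restrict (x b) {1..k})"
    using assms(1) b(2) k e(1) by (auto simp: good_def bounds_valid_def)
  also have "\<dots> \<le> g t k (restrict (x b) {1..k})"
    using k \<open>2 ^ e \<le> t\<close> by (intro g_mono) auto
  finally show False using ub unfolding upper_bound_eq[OF t assms(4) b(3)] k_def by simp
qed

text \<open>By induction over the slots.  A turn of \<open>b\<close> without a play of \<open>b\<close> occurs only when \<open>b\<close> has been
  played at least half as often as there were slots, and that already covers the number of its turns.\<close>

lemma best_played_each_turn:
  assumes "good q" "clear_best j A b" "j \<in> {1..M}" "p < N + 1 - j" "sorted_list_of_set A ! p = b"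
    and v: "2 ^ q \<le> \<delta> * real v" "2 ^ q \<le> v" "N + 1 \<le> v" and "s \<le> T"
  shows "card {u \<in> {v..<mini_count j A s}. u mod (N + 1 - j) = p} \<le> pl b s"
  using \<open>s \<le> T\<close>
proof (induction s)
  case (Suc s)
  define u where "u = mini_count j A s"
  define C where "C w = card {u \<in> {v..<w}. u mod (N + 1 - j) = p}" for w
  have IH: "C u \<le> pl b s" using Suc by (simp add: C_def u_def)
  have mono: "pl b s \<le> pl b (Suc s)" by (intro plays_hist_mono) simp
  show ?case
  proof (cases "Suc s \<in> mini i \<omega> j A \<and> v \<le> u \<and> u mod (N + 1 - j) = p")
    case False
    have "{w \<in> {v..<mini_count j A (Suc s)}. w mod (N + 1 - j) = p} = {w \<in> {v..<u}. w mod (N + 1 - j) = p}"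
      using False unfolding mini_count_Suc u_def by (auto simp: less_Suc_eq)
    then show ?thesis using IH mono by (simp add: C_def)
  next
    case True
    then have t: "Suc s \<in> mini i \<omega> j A" and vu: "v \<le> u" "u mod (N + 1 - j) = p" by auto
    have cnt: "mini_count j A (Suc s) = Suc u" unfolding mini_count_Suc u_def using t by simp
    have "candidate N M i (hist i \<omega> (Suc s - 1)) = b"
      unfolding candidate_eq[OF player t] cnt using vu assms(5) by simp
    then have "act i \<omega> (Suc s) = b \<or> mini_count j A (Suc s) \<le> 2 * pl b (Suc s - 1)"
    proof (intro best_candidate_played[OF assms(1,2) t])
      have "\<delta> * real v \<le> \<delta> * real u" using vu \<delta>_pos by simp
      then show "2 ^ q \<le> \<delta> * real (mini_count j A (Suc s - 1))" using v(1) by (simp add: u_def)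
      show "2 ^ q \<le> mini_count j A (Suc s)" "N < mini_count j A (Suc s)"
        unfolding cnt using v vu by auto
    qed (use Suc in auto)
    then show ?thesis
    proof
      assume "act i \<omega> (Suc s) = b"
      moreover have "{w \<in> {v..<Suc u}. w mod (N + 1 - j) = p} = insert u {w \<in> {v..<u}. w mod (N + 1 - j) = p}"
        using vu by (auto simp: less_Suc_eq)
      ultimately show ?thesis using IH unfolding cnt plays_hist_Suc by (simp add: C_def)
    next
      assume "mini_count j A (Suc s) \<le> 2 * pl b (Suc s - 1)"
      then have "Suc u \<le> 2 * pl b (Suc s)" using mono cnt by simp
      moreover have "{v..<Suc u} = {v..v + (u - v)}" using vu by auto
      then have "card {w \<in> {v..<Suc u}. w mod (N + 1 - j) = p} \<le> (u - v) div (N + 1 - j) + 1"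
        using card_residue_le[of v "u - v" "N + 1 - j" p] by simp
      \<comment> \<open>At least two arms are available, as \<open>j \<le> M < N\<close>: at most every second turn belongs to \<open>b\<close>.\<close>
      moreover have "(u - v) div (N + 1 - j) \<le> (u - v) div 2"
        using assms(3) M_less_N by (intro div_le_mono2) auto
      ultimately show ?thesis unfolding cnt using v(3) vu(1) M_less_N M_pos by linarith
    qed
  qed
qed simp

text \<open>With \<open>v\<close> a small fraction of the mini-index the plays just counted make \<open>b\<close> eligible, and
  then it is the leader.  A worse arm can be played only as a candidate whose confidence bound is
  too large.\<close>

lemma wrong_play_bound:
  assumes "good q" "clear_best j A b" "t \<in> mini i \<omega> j A" "t \<le> T" "act i \<omega> t \<noteq> b"
    and v: "2 ^ q \<le> \<delta> * real v" "2 ^ q \<le> v" "N + 1 \<le> v" "v \<le> mini_count j A (t - 1)"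
    and fast: "\<delta> * real (mini_count j A (t - 1)) \<le> real ((mini_count j A (t - 1) - v) div (N + 1 - j))"
    and n: "n = act i \<omega> t" and k: "k = pl n (t - 1)"
  shows "1 \<le> k" "k < T" "\<mu> b - \<epsilon> \<le> g T k (restrict (x n) {1..k})"
proof -
  define u where "u = mini_count j A (t - 1)"
  note A = mini_arms[OF player assms(3)]
  have t: "1 \<le> t" using assms(3) by (simp add: mini_def)
  have b: "b \<in> A" "b \<in> {1..N}" and cA: "card A = N + 1 - j"
    and gap: "\<And>n. n \<in> A - {b} \<Longrightarrow> \<mu> n + \<epsilon> < \<mu> b - \<epsilon>"
    using assms(2) A(2) by (auto simp: clear_best_def)
  have cnt: "mini_count j A t = Suc u" using mini_count_pred[OF assms(3)] by (simp add: u_def)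
  have init: "N < slot_index M t"
    by (rule mini_after_init[OF assms(3)]) (use cnt v in \<open>simp add: u_def\<close>)
  have nA: "n \<in> A" unfolding n by (rule act_in_mini[OF player assms(3)])
  then have nN: "n \<in> {1..N}" using A(2) by auto
  show "1 \<le> k" unfolding k by (rule plays_pos[OF t init nN])
  show "k < T" using plays_hist_le[of i \<omega> "t - 1" n] assms(4) t unfolding k by linarith
  have "b \<in> set (sorted_list_of_set A)" using b A(1) by simp
  then obtain p where p: "p < N + 1 - j" "sorted_list_of_set A ! p = b"
    unfolding in_set_conv_nth using A(1) cA by auto
  have "(u - v) div (N + 1 - j) \<le> card {w \<in> {v..<v + (u - v)}. w mod (N + 1 - j) = p}"
    by (rule card_residue_ge[OF p(1)])
  also have "v + (u - v) = u" using v by (simp add: u_def)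
  also have "card {w \<in> {v..<u}. w mod (N + 1 - j) = p} \<le> pl b (t - 1)"
    unfolding u_def using assms(4) A(4) v p by (intro best_played_each_turn[OF assms(1,2)]) auto
  finally have "\<delta> * real u \<le> real (pl b (t - 1))" using fast by (simp add: u_def)
  then have bel: "b \<in> eligible i \<omega> j A t" using b cnt by (simp add: eligible_def mult.commute)
  have "\<delta> * real v \<le> \<delta> * real u" using v \<delta>_pos by (simp add: u_def)
  then have q: "2 ^ q \<le> \<delta> * real (mini_count j A (t - 1))" using v by (simp add: u_def)
  define l where "l = leader h \<delta> N M i (hist i \<omega> (t - 1))"
  have lel: "l \<in> eligible i \<omega> j A t" unfolding l_def by (rule leader_eligible[OF assms(3)])
  have lb: "l = b"
  proof (rule ccontr)
    assume "l \<noteq> b"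
    then have "l \<in> A - {b}" using lel by (simp add: eligible_def)
    from gap[OF this] eligible_accurate[OF assms(1,3,4) lel q] eligible_accurate[OF assms(1,3,4) bel q]
      leader_eligible(2)[OF assms(3) bel]
    show False unfolding l_def by linarith
  qed
  have "\<not> upper_bound g (hist i \<omega> (t - 1)) n < point_estimate h (hist i \<omega> (t - 1)) b"
    using act_after_init[OF t init, of i \<omega>] assms(5) lb n unfolding l_def[symmetric]
    by (auto split: if_splits)
  then have "\<mu> b - \<epsilon> \<le> upper_bound g (hist i \<omega> (t - 1)) n"
    using eligible_accurate[OF assms(1,3,4) bel q] by linarith
  also have "\<dots> = g t k (restrict (x n) {1..k})"
    unfolding upper_bound_eq[OF t assms(4) nN] k by simp
  also have "\<dots> \<le> g T k (restrict (x n) {1..k})"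
    using \<open>1 \<le> k\<close> t assms(4) by (intro g_mono) auto
  finally show "\<mu> b - \<epsilon> \<le> g T k (restrict (x n) {1..k})" .
qed

text \<open>The slots in which a player plays a suboptimal arm \<open>n\<close> within finitely many
  mini-sequences.  A slot either sees a large confidence bound of \<open>n\<close>, at a value of its play count
  that occurs only once, or its mini-index is one where regularity fails.\<close>

lemma card_wrong_plays_le:
  fixes F :: "(nat \<times> nat set \<times> nat) set" and q v :: "nat \<Rightarrow> nat"
  assumes "finite F" "V \<subseteq> {1..T}"
    and V: "\<And>t. t \<in> V \<Longrightarrow> act i \<omega> t = n \<and>
      (\<exists>j A b. (j, A, b) \<in> F \<and> t \<in> mini i \<omega> j A \<and> clear_best j A b \<and> n \<noteq> b \<and> r \<le> \<mu> b - \<epsilon>)"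
    and qv: "\<And>m j. m0 \<le> m \<Longrightarrow> j \<in> {1..M} \<Longrightarrow> 2 ^ q m \<le> \<delta> * real (v m) \<and> 2 ^ q m \<le> v m \<and> N + 1 \<le> v m \<and>
      v m \<le> m - 1 \<and> \<delta> * real (m - 1) \<le> real ((m - 1 - v m) div (N + 1 - j))"
  shows "card V \<le> card {k \<in> {1..<T}. r \<le> g T k (restrict (x n) {1..k})} +
    card F * card {m \<in> {1..T}. m < m0 \<or> \<not> good (q m)}"
proof -
  define V1 where "V1 = {t \<in> V. pl n (t - 1) \<in> {k \<in> {1..<T}. r \<le> g T k (restrict (x n) {1..k})}}"
  define bad where "bad = {m \<in> {1..T}. m < m0 \<or> \<not> good (q m)}"
  define V2 :: "nat \<times> nat set \<times> nat \<Rightarrow> nat set" where "V2 = (\<lambda>(j, A, b). {t \<in> mini i \<omega> j A. mini_count j A t \<in> bad})"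
  have finV: "finite V" using assms(2) finite_subset by blast
  have finbad: "finite bad" by (simp add: bad_def)
  have V2: "finite (V2 p) \<and> card (V2 p) \<le> card bad" for p
  proof -
    obtain j A b where p: "p = (j, A, b)" by (cases p)
    have inj: "inj_on (mini_count j A) (V2 p)"
      unfolding V2_def p by (rule inj_on_subset[OF inj_on_mini_count]) auto
    have img: "mini_count j A ` V2 p \<subseteq> bad" by (auto simp: V2_def p)
    show ?thesis
      using inj_on_finite[OF inj img finbad] card_inj_on_le[OF inj img finbad] by blast
  qed
  have "V \<subseteq> V1 \<union> (\<Union>p\<in>F. V2 p)"
  proof
    fix t assume t: "t \<in> V"
    then obtain j A b where F: "(j, A, b) \<in> F" "t \<in> mini i \<omega> j A" "clear_best j A b" "n \<noteq> b" "r \<le> \<mu> b - \<epsilon>"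
      and act: "act i \<omega> t = n" using V by blast
    have tT: "1 \<le> t" "t \<le> T" using t assms(2) by auto
    define m where "m = mini_count j A t"
    have m: "m = Suc (mini_count j A (t - 1))" unfolding m_def by (rule mini_count_pred[OF F(2)])
    show "t \<in> V1 \<union> (\<Union>p\<in>F. V2 p)"
    proof (cases "m0 \<le> m \<and> good (q m)")
      case False
      moreover have "m \<le> T" using mini_count_le[of j A t] tT by (simp add: m_def)
      ultimately have "m \<in> bad" using m by (auto simp: bad_def)
      then have "t \<in> V2 (j, A, b)" using F(2) by (simp add: V2_def m_def)
      then show ?thesis using F(1) by blast
    next
      case True
      have j: "j \<in> {1..M}" by (rule mini_arms(4)[OF player F(2)])
      have m1: "m - 1 = mini_count j A (t - 1)" using m by simp
      have qm: "2 ^ q m \<le> \<delta> * real (v m)" "2 ^ q m \<le> v m" "N + 1 \<le> v m" "v m \<le> mini_count j A (t - 1)"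
        "\<delta> * real (mini_count j A (t - 1)) \<le> real ((mini_count j A (t - 1) - v m) div (N + 1 - j))"
        using qv[OF conjunct1[OF True] j] unfolding m1 by blast+
      have ne: "act i \<omega> t \<noteq> b" using F(4) unfolding act .
      note w = wrong_play_bound[OF conjunct2[OF True] F(3,2) tT(2) ne qm act[symmetric] refl]
      have "pl n (t - 1) \<in> {k \<in> {1..<T}. r \<le> g T k (restrict (x n) {1..k})}"
        using w(1,2) order_trans[OF F(5) w(3)] by simp
      then have "t \<in> V1" using t by (auto simp: V1_def)
      then show ?thesis by blast
    qed
  qed
  then have "card V \<le> card (V1 \<union> (\<Union>p\<in>F. V2 p))"
    using finV assms(1) V2 by (intro card_mono) (auto simp: V1_def)
  also have "\<dots> \<le> card V1 + card (\<Union>p\<in>F. V2 p)" by (rule card_Un_le)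
  also have "\<dots> \<le> card {k \<in> {1..<T}. r \<le> g T k (restrict (x n) {1..k})} + card F * card bad"
  proof (rule add_mono)
    show "card V1 \<le> card {k \<in> {1..<T}. r \<le> g T k (restrict (x n) {1..k})}"
    proof (rule card_inj_on_le)
      show "inj_on (\<lambda>t. pl n (t - 1)) V1"
      proof (rule linorder_inj_onI')
        fix s t assume s: "s \<in> V1" and t: "t \<in> V1" and "s < t"
        have "act i \<omega> s = n" "1 \<le> s" using s V assms(2) by (auto simp: V1_def)
        then have "pl n s = Suc (pl n (s - 1))" using plays_hist_Suc[of i \<omega> "s - 1" n] by simp
        moreover have "pl n s \<le> pl n (t - 1)" using \<open>s < t\<close> by (intro plays_hist_mono) simp
        ultimately show "pl n (s - 1) \<noteq> pl n (t - 1)" by simp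
      qed
    qed (auto simp: V1_def)
    have "card (\<Union>p\<in>F. V2 p) \<le> (\<Sum>p\<in>F. card (V2 p))"
      by (rule card_UN_le[OF assms(1)])
    also have "\<dots> \<le> (\<Sum>p\<in>F. card bad)" using V2 by (intro sum_mono) blast
    also have "\<dots> = card F * card bad" by simp
    finally show "card (\<Union>p\<in>F. V2 p) \<le> card F * card bad" .
  qed
  finally show ?thesis unfolding bad_def .
qed

end

section \<open>Measurability of the run\<close>

text \<open>The leader is chosen by \<open>SOME\<close> among the maximal arms; it is measurable because it depends only
  on the set of maximal arms, which takes finitely many values.\<close>

lemma measurable_arg_max_on:
  fixes F :: "'a \<Rightarrow> nat \<Rightarrow> real"
  assumes "finite S" and F: "\<And>n. n \<in> S \<Longrightarrow> (\<lambda>\<omega>. F \<omega> n) \<in> borel_measurable X"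
  shows "(\<lambda>\<omega>. arg_max_on (F \<omega>) S) \<in> measurable X (count_space UNIV)"
proof -
  define B where "B \<omega> = {x \<in> S. \<forall>y\<in>S. F \<omega> y \<le> F \<omega> x}" for \<omega>
  have eq: "arg_max_on (F \<omega>) S = (SOME x. x \<in> B \<omega>)" for \<omega>
    unfolding arg_max_on_def arg_max_def is_arg_max_linorder B_def by (rule arg_cong[where f = Eps]) auto
  have le: "{\<omega> \<in> space X. \<forall>y\<in>S. F \<omega> y \<le> F \<omega> x} \<in> sets X" if "x \<in> S" for x
    using assms(1) F that by (intro sets.sets_Collect_finite_All borel_measurable_le)
  have iff: "{\<omega> \<in> space X. x \<in> a \<longleftrightarrow> (\<forall>y\<in>S. F \<omega> y \<le> F \<omega> x)} \<in> sets X" if "x \<in> S" for x a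
  proof (cases "x \<in> a")
    case True
    with le[OF that] show ?thesis by simp
  next
    case False
    have "{\<omega> \<in> space X. \<not> (\<forall>y\<in>S. F \<omega> y \<le> F \<omega> x)} \<in> sets X"
      by (intro sets.sets_Collect_neg le that)
    with False show ?thesis by simp
  qed
  have "B \<in> measurable X (count_space (Pow S))"
  proof -
    have c: "countable (Pow S)" using assms(1) by (intro countable_finite) simp
    have "B -` {a} \<inter> space X \<in> sets X" if "a \<in> Pow S" for a
    proof -
      have "B \<omega> = a \<longleftrightarrow> (\<forall>x\<in>S. x \<in> a \<longleftrightarrow> (\<forall>y\<in>S. F \<omega> y \<le> F \<omega> x))" for \<omega>
        using that unfolding B_def by blast
      moreover have "B -` {a} \<inter> space X = {\<omega> \<in> space X. B \<omega> = a}" by blast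
      ultimately have "B -` {a} \<inter> space X = {\<omega> \<in> space X. \<forall>x\<in>S. x \<in> a \<longleftrightarrow> (\<forall>y\<in>S. F \<omega> y \<le> F \<omega> x)}"
        by simp
      also have "\<dots> \<in> sets X"
        using assms(1) iff by (intro sets.sets_Collect_finite_All)
      finally show ?thesis .
    qed
    moreover have "B \<in> space X \<rightarrow> Pow S" by (auto simp: B_def)
    ultimately show ?thesis unfolding measurable_count_space_eq_countable[OF c] by blast
  qed
  then have "(\<lambda>\<omega>. SOME x. x \<in> B \<omega>) \<in> measurable X (count_space UNIV)"
    by (rule measurable_compose) simp
  then show ?thesis unfolding eq .
qed

locale tdfs_bandit = tdfs N M \<delta> h g
  for N M :: nat and \<delta> :: real and h g +
  fixes \<nu> :: "real measure" and f :: "'p \<Rightarrow> real \<Rightarrow> real" and H :: "'p set"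
    and \<Theta> :: "nat \<Rightarrow> 'p" and \<sigma> :: "nat \<Rightarrow> nat"
  assumes fam: "density_family \<nu> f H" and C1: "C1 \<nu> f H" and C2: "C2 \<nu> f H" and C5: "C5 \<nu> f H h g"
    and rank: "ranking \<nu> f N \<Theta> \<sigma>" and adm: "admissible \<nu> f H N M \<Theta> \<sigma>"
begin

abbreviation law :: "nat \<Rightarrow> real measure" where
  "law n \<equiv> arm_law \<nu> f (\<Theta> n)"

abbreviation obs_law :: "nat \<Rightarrow> (nat \<Rightarrow> real) measure" where
  "obs_law n \<equiv> iid \<nu> f (\<Theta> n)"

abbreviation tdfs_regret :: "collision_model \<Rightarrow> nat \<Rightarrow> real" where
  "tdfs_regret c T \<equiv> regret \<nu> f c N M (TDFS h g \<delta> N M) \<Theta> \<sigma> T"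

definition \<mu> :: "nat \<Rightarrow> real" where
  "\<mu> n = mean \<nu> f (\<Theta> n)"

abbreviation \<Omega> :: "(nat \<times> nat \<Rightarrow> real) measure" where
  "\<Omega> \<equiv> arm_states \<nu> f N \<Theta>"

abbreviation coords :: "(nat \<times> nat) set" where
  "coords \<equiv> {1..N} \<times> {1..}"

lemma Theta_in_H: "n \<in> {1..N} \<Longrightarrow> \<Theta> n \<in> H"
  using adm by (simp add: admissible_def)

lemma sets_law [measurable_cong, simp]: "sets (law n) = sets borel"
  using fam by (simp add: arm_law_def density_family_def)

lemma space_law [simp]: "space (law n) = UNIV"
  using sets_eq_imp_space_eq[OF sets_law] by simp

lemma prob_space_law: "n \<in> {1..N} \<Longrightarrow> prob_space (law n)"
proof
  assume "n \<in> {1..N}"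
  from Theta_in_H[OF this] fam have f: "f (\<Theta> n) \<in> borel_measurable borel" "(\<integral>\<^sup>+ s. ennreal (f (\<Theta> n) s) \<partial>\<nu>) = 1"
    "sets \<nu> = sets borel"
    by (auto simp: density_family_def)
  then have "f (\<Theta> n) \<in> borel_measurable \<nu>" using measurable_cong_sets[OF f(3) refl] by blast
  then have "emeasure (law n) (space \<nu>) = (\<integral>\<^sup>+ s. ennreal (f (\<Theta> n) s) * indicator (space \<nu>) s \<partial>\<nu>)"
    unfolding arm_law_def by (intro emeasure_density) auto
  also have "\<dots> = (\<integral>\<^sup>+ s. ennreal (f (\<Theta> n) s) \<partial>\<nu>)"
    by (rule nn_integral_cong) simp
  finally show "emeasure (law n) (space (law n)) = 1"
    using f(2) by (simp add: arm_law_def)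
qed

lemma Omega_eq: "\<Omega> = PiM coords (\<lambda>p. law (fst p))"
proof -
  have "(\<lambda>(j, t). law j) = (\<lambda>p. law (fst p))" by (rule ext) (simp add: case_prod_beta)
  then show ?thesis unfolding arm_states_def by (rule arg_cong)
qed

lemma prob_space_Omega: "prob_space \<Omega>"
  unfolding Omega_eq by (intro prob_space_PiM prob_space_law) auto

lemma measurable_coord [measurable]: "(\<lambda>\<omega>. \<omega> p) \<in> borel_measurable \<Omega>"
proof (cases "p \<in> coords")
  case True
  then have "(\<lambda>\<omega>. \<omega> p) \<in> measurable \<Omega> (law (fst p))"
    unfolding Omega_eq by (rule measurable_component_singleton)
  then show ?thesis using measurable_cong_sets[OF refl sets_law] by blast
next
  case False
  then have "\<omega> p = undefined" if "\<omega> \<in> space \<Omega>" for \<omega>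
  proof -
    have "\<omega> \<in> (\<Pi>\<^sub>E p\<in>coords. space (law (fst p)))"
      using that by (simp only: Omega_eq space_PiM)
    then show ?thesis using False by (rule PiE_arb)
  qed
  then show ?thesis by (subst measurable_cong[where g = "\<lambda>_. undefined"]) auto
qed

text \<open>Once the arms are fixed, the history is an explicit function of the states.  Everything the
  policy computes is then measurable, and since there are only countably many lists of arms this
  suffices.\<close>

definition hist_of_arms :: "nat list \<Rightarrow> (nat \<times> nat \<Rightarrow> real) \<Rightarrow> history" where
  "hist_of_arms as \<omega> = map (\<lambda>r. (as ! r, \<omega> (as ! r, Suc r))) [0..<length as]"

lemma length_hist_of_arms [simp]: "length (hist_of_arms as \<omega>) = length as"
  by (simp add: hist_of_arms_def)

lemma hist_eq_hist_of_arms: "hist i \<omega> t = hist_of_arms (map fst (hist i \<omega> t)) \<omega>"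
  by (rule nth_equalityI) (simp_all add: hist_of_arms_def hist_nth)

lemma filter_hist_of_arms:
  "filter (\<lambda>(a, _). a = n) (hist_of_arms as \<omega>) =
    map (\<lambda>r. (as ! r, \<omega> (as ! r, Suc r))) (filter (\<lambda>r. as ! r = n) [0..<length as])"
  by (simp add: hist_of_arms_def filter_map o_def)

lemma plays_hist_of_arms: "plays (hist_of_arms as \<omega>) n = length (filter (\<lambda>r. as ! r = n) [0..<length as])"
  unfolding plays_def filter_hist_of_arms by simp

lemma measurable_observed:
  "(\<lambda>\<omega>. observed (hist_of_arms as \<omega>) n) \<in>
    measurable \<Omega> (obs_space (length (filter (\<lambda>r. as ! r = n) [0..<length as])))"
  unfolding observed_def plays_hist_of_arms filter_hist_of_arms
proof (intro measurable_restrict)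
  fix k assume "k \<in> {1..length (filter (\<lambda>r. as ! r = n) [0..<length as])}"
  then have "k - 1 < length (filter (\<lambda>r. as ! r = n) [0..<length as])" by auto
  then show "(\<lambda>\<omega>. map snd (map (\<lambda>r. (as ! r, \<omega> (as ! r, Suc r))) (filter (\<lambda>r. as ! r = n) [0..<length as])) ! (k - 1))
      \<in> borel_measurable \<Omega>"
    by (simp add: measurable_coord del: One_nat_def)
qed

lemma measurable_statistic:
  assumes "\<And>k. 1 \<le> k \<Longrightarrow> s k \<in> borel_measurable (obs_space k)"
  shows "(\<lambda>\<omega>. s (plays (hist_of_arms as \<omega>) n) (observed (hist_of_arms as \<omega>) n)) \<in> borel_measurable \<Omega>"
proof (cases "plays (hist_of_arms as undefined) n")
  case 0
  then have "observed (hist_of_arms as \<omega>) n = (\<lambda>_. undefined)" for \<omega>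
    by (simp add: observed_def plays_hist_of_arms restrict_def)
  then show ?thesis by (simp add: plays_hist_of_arms)
next
  case (Suc k)
  show ?thesis
    unfolding plays_hist_of_arms
    using Suc by (intro measurable_compose[OF measurable_observed assms]) (simp add: plays_hist_of_arms)
qed

lemmas h_measurable = C5[unfolded C5_def, THEN conjunct1, rule_format]
lemmas g_measurable = C5[unfolded C5_def, THEN conjunct2, THEN conjunct1, rule_format]

text \<open>The case \<open>r = 0\<close> is included, since sets of available arms are also formed for slots that are
  smaller than their target; truncated subtraction then reads entry 0.\<close>

lemma fst_hist_of_arms_nth:
  "r \<le> length as \<Longrightarrow> fst (hist_of_arms as \<omega> ! (r - 1)) = fst (hist_of_arms as \<omega>' ! (r - 1))"
proof (cases "as = []")
  case False
  assume "r \<le> length as"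
  with False have "r - 1 < length as" by (cases r) auto
  then show ?thesis by (simp add: hist_of_arms_def del: One_nat_def)
qed (simp add: hist_of_arms_def)

lemma available_hist_of_arms:
  "s \<le> Suc (length as) \<Longrightarrow>
    available N M i (hist_of_arms as \<omega>) s = available N M i (hist_of_arms as \<omega>') s"
  unfolding available_def
  by (intro arg_cong2[where f = minus] refl image_cong fst_hist_of_arms_nth) simp

lemma mini_index_hist_of_arms:
  "mini_index N M i (hist_of_arms as \<omega>) = mini_index N M i (hist_of_arms as \<omega>')"
proof -
  have "s \<in> {1..Suc (length as)} \<Longrightarrow>
      available N M i (hist_of_arms as \<omega>) s = available N M i (hist_of_arms as \<omega>') s" for s
    by (rule available_hist_of_arms) simp
  then show ?thesis
    unfolding mini_index_def Let_def length_hist_of_arms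
    by (intro arg_cong[where f = card] Collect_cong) force
qed

lemma candidate_hist_of_arms:
  "candidate N M i (hist_of_arms as \<omega>) = candidate N M i (hist_of_arms as \<omega>')"
  unfolding candidate_def Let_def length_hist_of_arms
  by (simp add: mini_index_hist_of_arms[of i as \<omega> \<omega>'] available_hist_of_arms[of _ as i \<omega> \<omega>'])

lemma measurable_TDFS:
  "(\<lambda>\<omega>. TDFS h g \<delta> N M i (hist_of_arms as \<omega>)) \<in> measurable \<Omega> (count_space UNIV)"
proof -
  define as0 where "as0 = hist_of_arms as (\<lambda>_. 0)"
  define r where "r = candidate N M i as0"
  define S where "S = {n \<in> available N M i as0 (Suc (length as)).
        (real (mini_index N M i as0) - 1) * \<delta> \<le> real (plays as0 n)}"
  have pe: "(\<lambda>\<omega>. point_estimate h (hist_of_arms as \<omega>) n) \<in> borel_measurable \<Omega>" for n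
    unfolding point_estimate_def by (rule measurable_statistic) (rule h_measurable)
  have ub: "(\<lambda>\<omega>. upper_bound g (hist_of_arms as \<omega>) n) \<in> borel_measurable \<Omega>" for n
    unfolding upper_bound_def length_hist_of_arms by (rule measurable_statistic) (rule g_measurable, simp)
  have r: "candidate N M i (hist_of_arms as \<omega>) = r" for \<omega>
    unfolding r_def as0_def by (rule candidate_hist_of_arms)
  have l: "leader h \<delta> N M i (hist_of_arms as \<omega>) = arg_max_on (point_estimate h (hist_of_arms as \<omega>)) S" for \<omega>
    unfolding leader_def S_def as0_def length_hist_of_arms
    using available_hist_of_arms[of "Suc (length as)" as i \<omega> "\<lambda>_. 0"]
      mini_index_hist_of_arms[of i as \<omega> "\<lambda>_. 0"] by (simp add: plays_hist_of_arms)
  have lm: "(\<lambda>\<omega>. leader h \<delta> N M i (hist_of_arms as \<omega>)) \<in> measurable \<Omega> (count_space UNIV)"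
    unfolding l by (intro measurable_arg_max_on pe) (simp add: S_def available_def)
  have plm: "(\<lambda>\<omega>. point_estimate h (hist_of_arms as \<omega>) (leader h \<delta> N M i (hist_of_arms as \<omega>))) \<in> borel_measurable \<Omega>"
    by (rule measurable_compose_countable[OF pe lm])
  have "{\<omega> \<in> space \<Omega>. upper_bound g (hist_of_arms as \<omega>) r
      < point_estimate h (hist_of_arms as \<omega>) (leader h \<delta> N M i (hist_of_arms as \<omega>))} \<in> sets \<Omega>"
    by (rule borel_measurable_less[OF ub plm])
  then show ?thesis
    unfolding TDFS_def Let_def r length_hist_of_arms
    by (intro measurable_If lm measurable_const) simp_all
qed

lemma measurable_arms: "(\<lambda>\<omega>. map fst (hist i \<omega> t)) \<in> measurable \<Omega> (count_space UNIV)"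
proof (induction t)
  case (Suc t)
  have act: "act i \<omega> (Suc t) = TDFS h g \<delta> N M i (hist_of_arms (map fst (hist i \<omega> t)) \<omega>)" for \<omega>
    using hist_eq_hist_of_arms[of i \<omega> t] by (simp add: act_eq)
  have eq: "map fst (hist i \<omega> (Suc t)) =
      (\<lambda>as \<omega>. as @ [TDFS h g \<delta> N M i (hist_of_arms as \<omega>)]) (map fst (hist i \<omega> t)) \<omega>" for \<omega>
    unfolding hist_Suc map_append act by simp
  show ?case
    unfolding eq
    by (rule measurable_compose_countable[OF _ Suc])
      (rule measurable_compose[OF measurable_TDFS], simp)
qed simp

lemma measurable_act [measurable]:
  assumes "1 \<le> t"
  shows "(\<lambda>\<omega>. act i \<omega> t) \<in> measurable \<Omega> (count_space UNIV)"
proof -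
  have eq: "act i \<omega> t = (\<lambda>as. as ! (t - 1)) (map fst (hist i \<omega> t))" for \<omega>
    using assms by (simp add: hist_nth)
  show ?thesis unfolding eq by (rule measurable_compose[OF measurable_arms]) simp
qed

lemma measurable_plays [measurable]: "(\<lambda>\<omega>. plays (hist i \<omega> t) n) \<in> measurable \<Omega> (count_space UNIV)"
proof -
  have eq: "plays (hist i \<omega> t) n = (\<lambda>as. length (filter (\<lambda>a. a = n) as)) (map fst (hist i \<omega> t))" for \<omega>
  proof -
    have "(\<lambda>(a, _). a = n) = (\<lambda>p :: nat \<times> real. fst p = n)" by (rule ext) (simp add: case_prod_beta)
    then show ?thesis by (simp add: plays_def filter_map o_def)
  qed
  show ?thesis unfolding eq by (rule measurable_compose[OF measurable_arms]) simp
qed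

end

section \<open>The observations of an arm are independent and identically distributed\<close>

lemma observed_append:
  assumes "k \<in> {1..plays hs n}"
  shows "observed (hs @ hs') n k = observed hs n k"
proof -
  have "k - 1 < length (filter (\<lambda>(a, _). a = n) hs)" using assms by (auto simp: plays_def)
  then show ?thesis using assms by (simp add: observed_def plays_def nth_append)
qed

lemma observed_snoc_new:
  "observed (hs @ [(n, y)]) n (Suc (plays hs n)) = y"
  by (simp add: observed_def plays_def nth_append)

context tdfs
begin

lemma observed_hist_Suc:
  "k \<in> {1..plays (hist i \<omega> t) n} \<Longrightarrow> observed (hist i \<omega> (Suc t)) n k = observed (hist i \<omega> t) n k"
  unfolding hist_Suc by (rule observed_append)

lemma observed_hist_mono:
  assumes "s \<le> t" "k \<in> {1..plays (hist i \<omega> s) n}"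
  shows "observed (hist i \<omega> t) n k = observed (hist i \<omega> s) n k"
  using assms(1)
proof (induction t rule: dec_induct)
  case (step t)
  have "k \<in> {1..plays (hist i \<omega> t) n}" using assms(2) plays_hist_mono[OF step.hyps(1), of i \<omega> n] by simp
  from observed_hist_Suc[OF this] step.IH show ?case by simp
qed simp

text \<open>A player learns nothing about the states of later slots, so changing them, as in the exchange of
  coordinates below, does not affect its actions so far.\<close>

lemma hist_cong:
  assumes "\<And>a s. 1 \<le> s \<Longrightarrow> s \<le> t \<Longrightarrow> \<omega> (a, s) = \<omega>' (a, s)"
  shows "hist i \<omega> t = hist i \<omega>' t"
  using assms
proof (induction t)
  case (Suc t)
  have IH: "hist i \<omega> t = hist i \<omega>' t" using Suc by simp
  then have "act i \<omega> (Suc t) = act i \<omega>' (Suc t)" by (simp add: act_eq)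
  then show ?case using IH Suc.prems by (simp add: hist_Suc)
qed simp

lemma act_cong:
  assumes "\<And>a s. 1 \<le> s \<Longrightarrow> s < t \<Longrightarrow> \<omega> (a, s) = \<omega>' (a, s)"
  shows "act i \<omega> t = act i \<omega>' t"
proof -
  have "hist i \<omega> (t - 1) = hist i \<omega>' (t - 1)" using assms by (intro hist_cong) auto
  then show ?thesis by (simp add: act_eq)
qed

end

context tdfs_bandit
begin

text \<open>The observations of arm \<open>n\<close> by player \<open>i\<close> up to time \<open>t\<close>, continued by states of that arm
  after the horizon \<open>T\<close>, which have not influenced the run.  This makes the sequence infinite
  without enlarging the probability space.\<close>

definition obs_seq :: "nat \<Rightarrow> nat \<Rightarrow> nat \<Rightarrow> nat \<Rightarrow> (nat \<times> nat \<Rightarrow> real) \<Rightarrow> nat \<Rightarrow> real" where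
  "obs_seq i n T t \<omega> = (\<lambda>k\<in>{1..}. if k \<le> plays (hist i \<omega> t) n then observed (hist i \<omega> t) n k else \<omega> (n, T + k))"

definition swap_states :: "nat \<times> nat \<Rightarrow> nat \<times> nat \<Rightarrow> (nat \<times> nat \<Rightarrow> real) \<Rightarrow> nat \<times> nat \<Rightarrow> real" where
  "swap_states a b \<omega> = (\<lambda>p\<in>coords. \<omega> (Transposition.transpose a b p))"

lemma distr_swap_states:
  assumes "n \<in> {1..N}" "1 \<le> s" "1 \<le> s'"
  shows "distr \<Omega> \<Omega> (swap_states (n, s) (n, s')) = \<Omega>"
proof -
  let ?f = "Transposition.transpose (n, s) (n, s')"
  have fst: "fst (?f p) = fst p" for p by (cases p) (auto simp: Transposition.transpose_def)
  have "inj_on ?f coords" by (rule inj_on_subset[OF inj_transpose]) simp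
  moreover have "?f \<in> coords \<rightarrow> coords" using assms by (auto simp: Transposition.transpose_def)
  ultimately have "distr (PiM coords (\<lambda>p. law (fst p))) (\<Pi>\<^sub>M p\<in>coords. law (fst (?f p))) (\<lambda>\<omega>. \<lambda>p\<in>coords. \<omega> (?f p))
      = (\<Pi>\<^sub>M p\<in>coords. law (fst (?f p)))"
    by (intro distr_PiM_reindex prob_space_law) auto
  then show ?thesis unfolding fst Omega_eq swap_states_def .
qed

lemma measurable_swap_states:
  assumes "n \<in> {1..N}" "1 \<le> s" "1 \<le> s'"
  shows "swap_states (n, s) (n, s') \<in> measurable \<Omega> \<Omega>"
proof -
  have "(\<lambda>\<omega>. \<lambda>p\<in>coords. \<omega> (Transposition.transpose (n, s) (n, s') p)) \<in>
      measurable \<Omega> (PiM coords (\<lambda>p. law (fst p)))"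
    using measurable_cong_sets[OF refl sets_law] measurable_coord by (intro measurable_restrict) blast
  then show ?thesis unfolding swap_states_def by (simp only: Omega_eq)
qed

lemma swap_states_past:
  assumes "\<omega> \<in> space \<Omega>" "t < s" "t < s'" "u \<le> t"
  shows "swap_states (n, s) (n, s') \<omega> (a, u) = \<omega> (a, u)"
proof (cases "(a, u) \<in> coords")
  case True
  then show ?thesis using assms by (auto simp: swap_states_def Transposition.transpose_def)
next
  case False
  have "\<omega> \<in> (\<Pi>\<^sub>E p\<in>coords. space (law (fst p)))"
    using assms(1) by (simp only: Omega_eq space_PiM)
  then have "\<omega> (a, u) = undefined" using False by (rule PiE_arb)
  then show ?thesis using False by (simp only: swap_states_def restrict_apply if_False)
qed

lemma sets_iid: "sets (obs_law n) = sets (PiM {1..} (\<lambda>_. borel))"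
  unfolding iid_def by (intro sets_PiM_cong refl sets_law)

lemma prob_space_iid: "n \<in> {1..N} \<Longrightarrow> prob_space (obs_law n)"
  unfolding iid_def by (intro prob_space_PiM prob_space_law)

text \<open>Positions in the sequence start at 1, so \<open>0\<close> is free to mean that slot \<open>Suc t\<close> adds no observation
  of arm \<open>n\<close>.\<close>

definition new_index :: "nat \<Rightarrow> nat \<Rightarrow> nat \<Rightarrow> (nat \<times> nat \<Rightarrow> real) \<Rightarrow> nat" where
  "new_index i n t \<omega> = (if act i \<omega> (Suc t) = n then Suc (plays (hist i \<omega> t) n) else 0)"

text \<open>The exchange of coordinates that brings the new observation to its place in the sequence.\<close>

definition renewal :: "nat \<Rightarrow> nat \<Rightarrow> nat \<Rightarrow> nat \<Rightarrow> (nat \<times> nat \<Rightarrow> real) \<Rightarrow> nat \<times> nat \<Rightarrow> real" where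
  "renewal n T t k = (if k = 0 then id else swap_states (n, Suc t) (n, T + k))"

lemma obs_seq_Suc:
  assumes "\<omega> \<in> space \<Omega>" "n \<in> {1..N}" "t < T"
  shows "obs_seq i n T (Suc t) \<omega> = obs_seq i n T t (renewal n T t (new_index i n t \<omega>) \<omega>)"
proof (cases "act i \<omega> (Suc t) = n")
  case False
  then show ?thesis
    using observed_hist_Suc[of _ i \<omega> t n]
    by (auto simp: obs_seq_def renewal_def new_index_def plays_hist_Suc restrict_def intro!: ext)
next
  case True
  define k where "k = plays (hist i \<omega> t) n"
  define \<omega>' where "\<omega>' = swap_states (n, Suc t) (n, T + Suc k) \<omega>"
  have past: "\<omega>' (a, u) = \<omega> (a, u)" if "u \<le> t" for a u
    unfolding \<omega>'_def using assms that by (intro swap_states_past[of \<omega> t]) auto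
  have hist': "hist i \<omega>' t = hist i \<omega> t" using past by (intro hist_cong) auto
  have pl: "plays (hist i \<omega> (Suc t)) n = Suc k" using True by (simp add: plays_hist_Suc k_def)
  have "obs_seq i n T (Suc t) \<omega> l = obs_seq i n T t \<omega>' l" for l
  proof (cases "1 \<le> l")
    case l: True
    consider "l \<le> k" | "l = Suc k" | "Suc k < l" by linarith
    then show ?thesis
    proof cases
      case 1
      then show ?thesis
        using l observed_hist_Suc[of l i \<omega> t n] pl by (simp add: obs_seq_def hist' k_def)
    next
      case 2
      have "observed (hist i \<omega> (Suc t)) n l = \<omega> (n, Suc t)"
        unfolding 2 hist_Suc True k_def by (rule observed_snoc_new)
      moreover have "\<omega>' (n, T + Suc k) = \<omega> (n, Suc t)"
        using assms(2) by (simp add: \<omega>'_def swap_states_def)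
      ultimately show ?thesis using 2 pl by (simp add: obs_seq_def hist' k_def)
    next
      case 3
      have "\<omega>' (n, T + l) = \<omega> (n, T + l)"
        using 3 assms(2,3) by (simp add: \<omega>'_def swap_states_def Transposition.transpose_def)
      then show ?thesis using 3 l pl by (simp add: obs_seq_def hist' k_def)
    qed
  qed (simp add: obs_seq_def)
  then show ?thesis using True by (auto simp: renewal_def new_index_def \<omega>'_def k_def)
qed

lemma measurable_new_index: "new_index i n t \<in> measurable \<Omega> (count_space UNIV)"
proof -
  have a: "(\<lambda>\<omega>. act i \<omega> (Suc t)) \<in> measurable \<Omega> (count_space UNIV)" by (rule measurable_act) simp
  have "{\<omega> \<in> space \<Omega>. act i \<omega> (Suc t) = n} \<in> sets \<Omega>"
    using measurable_sets[OF a, of "{n}"] by (simp add: vimage_def Int_def conj_commute)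
  moreover have "(\<lambda>\<omega>. Suc (plays (hist i \<omega> t) n)) \<in> measurable \<Omega> (count_space UNIV)"
    by (rule measurable_compose[OF measurable_plays]) simp
  ultimately show ?thesis
    unfolding new_index_def[abs_def] by (intro measurable_If measurable_const) simp_all
qed

lemma renewal_measurable: "n \<in> {1..N} \<Longrightarrow> renewal n T t k \<in> measurable \<Omega> \<Omega>"
  by (auto simp: renewal_def id_def intro!: measurable_swap_states)

lemma distr_renewal:
  assumes "n \<in> {1..N}"
  shows "distr \<Omega> \<Omega> (renewal n T t k) = \<Omega>"
proof (cases "k = 0")
  case True
  then show ?thesis by (simp add: renewal_def id_def distr_id)
next
  case False
  then show ?thesis using distr_swap_states[OF assms, of "Suc t" "T + k"] by (simp add: renewal_def)
qed

lemma new_index_renewal: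
  assumes "\<omega> \<in> space \<Omega>" "t < T"
  shows "new_index i n t (renewal n T t k \<omega>) = new_index i n t \<omega>"
proof (cases "k = 0")
  case False
  have past: "swap_states (n, Suc t) (n, T + k) \<omega> (a, u) = \<omega> (a, u)" if "u \<le> t" for a u
    using assms that by (intro swap_states_past[of \<omega> t]) auto
  have "hist i (renewal n T t k \<omega>) t = hist i \<omega> t"
    unfolding renewal_def using False past by (simp, intro hist_cong) auto
  then show ?thesis by (simp add: new_index_def act_eq)
qed (simp add: renewal_def)

lemma emeasure_eq_by_parts:
  fixes X :: "'a measure" and idx :: "'a \<Rightarrow> nat"
  assumes "idx \<in> measurable X (count_space UNIV)" "C \<in> sets X" "D \<in> sets X"
    and "\<And>k. emeasure X ({\<omega> \<in> space X. idx \<omega> = k} \<inter> C) = emeasure X ({\<omega> \<in> space X. idx \<omega> = k} \<inter> D)"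
  shows "emeasure X C = emeasure X D"
proof -
  define E where "E k = {\<omega> \<in> space X. idx \<omega> = k}" for k
  have E: "E k \<in> sets X" for k
    using measurable_sets[OF assms(1), of "{k}"] by (simp add: E_def vimage_def Int_def conj_commute)
  have sum: "emeasure X Z = (\<Sum>k. emeasure X (E k \<inter> Z))" if "Z \<in> sets X" for Z
  proof -
    have "range (\<lambda>k. E k \<inter> Z) \<subseteq> sets X" using E that by blast
    moreover have "disjoint_family (\<lambda>k. E k \<inter> Z)" by (auto simp: disjoint_family_on_def E_def)
    ultimately have "(\<Sum>k. emeasure X (E k \<inter> Z)) = emeasure X (\<Union>k. E k \<inter> Z)"
      by (rule suminf_emeasure)
    also have "(\<Union>k. E k \<inter> Z) = Z" using sets.sets_into_space[OF that] by (auto simp: E_def)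
    finally show ?thesis by simp
  qed
  show ?thesis
    unfolding sum[OF assms(2)] sum[OF assms(3)] using assms(4) by (simp add: E_def)
qed

text \<open>Playing arm \<open>n\<close> for the \<open>k\<close>-th time replaces the entry \<open>k\<close> of the sequence by a fresh state.
  Given that this happens, which depends on the past only, it amounts to exchanging two
  coordinates that have the same law, and so the law of the sequence stays the same.\<close>

theorem distr_obs_seq:
  assumes "n \<in> {1..N}" "t \<le> T"
  shows "obs_seq i n T t \<in> measurable \<Omega> (obs_law n)" (is "?meas t")
    and "distr \<Omega> (obs_law n) (obs_seq i n T t) = obs_law n" (is "?law t")
proof -
  have "?meas t \<and> ?law t" using assms(2)
  proof (induction t)
    case 0
    have eq: "obs_seq i n T 0 = (\<lambda>\<omega>. \<lambda>k\<in>{1..}. \<omega> (n, T + k))"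
      by (auto simp: obs_seq_def restrict_def intro!: ext)
    have "distr (PiM coords (\<lambda>p. law (fst p))) (\<Pi>\<^sub>M k\<in>{1..}. law (fst (n, T + k))) (\<lambda>\<omega>. \<lambda>k\<in>{1..}. \<omega> (n, T + k))
        = (\<Pi>\<^sub>M k\<in>{1..}. law (fst (n, T + k)))"
      using assms(1) by (intro distr_PiM_reindex prob_space_law) (auto simp: inj_on_def)
    then have "?law 0" unfolding eq Omega_eq iid_def by (simp only: fst_conv)
    moreover have "?meas 0"
      unfolding eq iid_def using measurable_cong_sets[OF refl sets_law] measurable_coord
      by (intro measurable_restrict) blast
    ultimately show ?case by simp
  next
    case (Suc t)
    then have m: "?meas t" and l: "?law t" and tT: "t < T" by simp_all
    note idx = measurable_new_index[of i n t]
    have "(\<lambda>\<omega>. (\<lambda>k \<omega>. obs_seq i n T t (renewal n T t k \<omega>)) (new_index i n t \<omega>) \<omega>)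
        \<in> measurable \<Omega> (obs_law n)"
      by (rule measurable_compose_countable[OF _ idx])
        (rule measurable_compose[OF renewal_measurable[OF assms(1)] m])
    then have m': "?meas (Suc t)"
      using obs_seq_Suc[OF _ assms(1) tT] by (subst measurable_cong) auto
    have "emeasure \<Omega> (obs_seq i n T (Suc t) -` Z \<inter> space \<Omega>) = emeasure \<Omega> (obs_seq i n T t -` Z \<inter> space \<Omega>)"
      if Z: "Z \<in> sets (obs_law n)" for Z
    proof (rule emeasure_eq_by_parts[OF idx])
      fix k
      define E where "E = {\<omega> \<in> space \<Omega>. new_index i n t \<omega> = k} \<inter> (obs_seq i n T t -` Z \<inter> space \<Omega>)"
      have E: "E \<in> sets \<Omega>"
        using measurable_sets[OF idx, of "{k}"] measurable_sets[OF m Z]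
        by (auto simp: E_def vimage_def Int_def conj_commute)
      note r = renewal_measurable[OF assms(1), of T t k]
      have "{\<omega> \<in> space \<Omega>. new_index i n t \<omega> = k} \<inter> (obs_seq i n T (Suc t) -` Z \<inter> space \<Omega>) =
          renewal n T t k -` E \<inter> space \<Omega>"
        using obs_seq_Suc[OF _ assms(1) tT] new_index_renewal[OF _ tT] measurable_space[OF r]
        by (auto simp: E_def)
      also have "emeasure \<Omega> \<dots> = emeasure (distr \<Omega> \<Omega> (renewal n T t k)) E"
        by (rule emeasure_distr[OF r E, symmetric])
      finally show "emeasure \<Omega> ({\<omega> \<in> space \<Omega>. new_index i n t \<omega> = k} \<inter> (obs_seq i n T (Suc t) -` Z \<inter> space \<Omega>))
          = emeasure \<Omega> ({\<omega> \<in> space \<Omega>. new_index i n t \<omega> = k} \<inter> (obs_seq i n T t -` Z \<inter> space \<Omega>))"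
        unfolding distr_renewal[OF assms(1)] E_def .
    qed (rule measurable_sets[OF m' Z] measurable_sets[OF m Z])+
    then have "distr \<Omega> (obs_law n) (obs_seq i n T (Suc t)) = distr \<Omega> (obs_law n) (obs_seq i n T t)"
      by (intro measure_eqI) (simp_all add: emeasure_distr m m')
    then show ?case using m' l by simp
  qed
  then show "?meas t" "?law t" by blast+
qed

lemma prob_obs_seq:
  assumes "n \<in> {1..N}" "{S \<in> space (obs_law n). Q S} \<in> sets (obs_law n)"
  shows "{\<omega> \<in> space \<Omega>. Q (obs_seq i n T T \<omega>)} \<in> sets \<Omega>"
    and "\<P>(\<omega> in \<Omega>. Q (obs_seq i n T T \<omega>)) = \<P>(S in obs_law n. Q S)"
proof -
  note m = distr_obs_seq(1)[OF assms(1) order_refl, of i T]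
  have eq: "{\<omega> \<in> space \<Omega>. Q (obs_seq i n T T \<omega>)} =
      obs_seq i n T T -` {S \<in> space (obs_law n). Q S} \<inter> space \<Omega>"
    using measurable_space[OF m] by auto
  show "{\<omega> \<in> space \<Omega>. Q (obs_seq i n T T \<omega>)} \<in> sets \<Omega>"
    unfolding eq by (rule measurable_sets[OF m assms(2)])
  show "\<P>(\<omega> in \<Omega>. Q (obs_seq i n T T \<omega>)) = \<P>(S in obs_law n. Q S)"
    unfolding eq measure_distr[OF m assms(2), symmetric] distr_obs_seq(2)[OF assms(1) order_refl] ..
qed

lemma observed_eq_obs_seq:
  assumes "t \<le> T"
  shows "observed (hist i \<omega> t) n = restrict (obs_seq i n T T \<omega>) {1..plays (hist i \<omega> t) n}"
proof
  fix k
  show "observed (hist i \<omega> t) n k = restrict (obs_seq i n T T \<omega>) {1..plays (hist i \<omega> t) n} k"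
  proof (cases "k \<in> {1..plays (hist i \<omega> t) n}")
    case True
    then show ?thesis
      using observed_hist_mono[OF assms True] plays_hist_mono[OF assms, of i \<omega> n]
      by (simp add: obs_seq_def)
  qed (simp only: observed_def restrict_apply if_False)
qed

end

section \<open>Expected number of plays of a suboptimal arm\<close>

lemma sum_inverse_le_ln:
  assumes "1 \<le> T"
  shows "(\<Sum>m=1..T. 1 / real m) \<le> 1 + ln (real T)"
proof -
  obtain n where n: "T = Suc n" using assms by (cases T) auto
  have "harm (Suc n) - ln (real (Suc n)) \<le> harm (Suc 0) - ln (real (Suc 0))"
    using decseqD[OF decseq_harm_diff_ln, of 0 n] by simp
  then have "harm T \<le> 1 + ln (real T)" by (simp add: n harm_def)
  then show ?thesis by (simp add: harm_def inverse_eq_divide)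
qed

lemma sum_dyadic_tail_le: "(\<Sum>e=q..T. 1 / 2 ^ e) \<le> (2 / 2 ^ q :: real)"
proof (cases "q \<le> T")
  case True
  have "(\<Sum>e=q..T. 1 / 2 ^ e) \<le> (2 / 2 ^ q - 1 / 2 ^ T :: real)"
    using True
  proof (induction T rule: dec_induct)
    case (step n)
    have "1 / 2 ^ n = (2 / 2 ^ Suc n :: real)" by simp
    moreover have "(\<Sum>e=q..Suc n. 1 / 2 ^ e) = (\<Sum>e=q..n. 1 / 2 ^ e) + (1 / 2 ^ Suc n :: real)"
      using step.hyps by (intro sum.cl_ivl_Suc[THEN trans]) simp
    ultimately show ?case using step.IH by linarith
  qed simp
  also have "\<dots> \<le> 2 / 2 ^ q" by simp
  finally show ?thesis .
qed simp

text \<open>The level \<open>2 ^ q\<close> up to which the observations are ignored is a fixed fraction of the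
  mini-index \<open>m\<close>.\<close>

definition level :: "real \<Rightarrow> nat \<Rightarrow> nat" where
  "level \<kappa> m = nat \<lfloor>log 2 (\<kappa> * real m)\<rfloor>"

lemma level_bounds:
  assumes "0 < \<kappa>" "1 \<le> \<kappa> * real m"
  shows "2 ^ level \<kappa> m \<le> \<kappa> * real m" "\<kappa> * real m < 2 * 2 ^ level \<kappa> m"
proof -
  have nn: "0 \<le> log 2 (\<kappa> * real m)" using assms by simp
  then have "real (level \<kappa> m) \<le> log 2 (\<kappa> * real m)" "log 2 (\<kappa> * real m) < real (level \<kappa> m) + 1"
    unfolding level_def by linarith+
  then have "2 powr real (level \<kappa> m) \<le> \<kappa> * real m" "\<kappa> * real m < 2 powr (real (level \<kappa> m) + 1)"
    using assms by (simp_all add: le_log_iff log_less_iff)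
  then show "2 ^ level \<kappa> m \<le> \<kappa> * real m" "\<kappa> * real m < 2 * 2 ^ level \<kappa> m"
    by (simp_all add: powr_realpow powr_add)
qed

lemma level_ge:
  assumes "0 < \<kappa>" "2 ^ q \<le> \<kappa> * real m"
  shows "q \<le> level \<kappa> m"
proof -
  have "(1::real) \<le> 2 ^ q" by simp
  then have "1 \<le> \<kappa> * real m" using assms(2) by linarith
  from level_bounds(2)[OF assms(1) this] assms(2) have "(2::real) ^ q < 2 ^ (level \<kappa> m + 1)" by simp
  then have "q < level \<kappa> m + 1" by (rule power_less_imp_less_exp[rotated]) simp
  then show ?thesis by simp
qed

text \<open>This is where \<open>\<delta> < 1 / N\<close> enters: the turns of the best arm between the counts \<open>v m\<close> and \<open>m\<close>
  give it the share \<open>\<delta>\<close>, although \<open>v m\<close> is already a fixed fraction of \<open>m\<close>.\<close>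

lemma (in tdfs) level_parameters:
  obtains \<kappa> m0 v where "0 < \<kappa>"
    "\<forall>m\<ge>m0. \<forall>j\<in>{1..M}.
      2 ^ level \<kappa> m \<le> \<delta> * real (v m) \<and> 2 ^ level \<kappa> m \<le> v m \<and> N + 1 \<le> v m \<and> v m \<le> m - 1 \<and>
      \<delta> * real (m - 1) \<le> real ((m - 1 - v m) div (N + 1 - j))"
proof -
  have N: "2 \<le> real N" using M_pos M_less_N by linarith
  have dN: "\<delta> * real N < 1" using \<delta>_less N by (simp add: field_simps)
  have d1: "\<delta> < 1" using dN N \<delta>_pos by (smt (verit) mult_less_cancel_left1)
  \<comment> \<open>After the first \<open>\<eta> * m\<close> slots, \<open>(1 - \<eta>) * m / N\<close> turns are left for each arm; with this \<open>\<eta>\<close> that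
    exceeds \<open>\<delta> * m\<close> by the positive multiple \<open>\<eta> / N\<close> of \<open>m\<close>.\<close>
  define \<eta> where "\<eta> = (1 - \<delta> * real N) / 2"
  have "0 < \<delta> * real N" using \<delta>_pos N by simp
  then have \<eta>: "0 < \<eta>" "\<eta> < 1 / 2" using dN by (auto simp: \<eta>_def)
  define \<kappa> where "\<kappa> = \<delta> * \<eta> / 2"
  define v where "v m = nat \<lfloor>\<eta> * real m\<rfloor>" for m
  define m0 where "m0 = nat \<lceil>(2 * real N + 2) / \<eta>\<rceil> + nat \<lceil>1 / \<kappa>\<rceil>"
  have \<kappa>: "0 < \<kappa>" using \<delta>_pos \<eta> by (simp add: \<kappa>_def)
  have "2 ^ level \<kappa> m \<le> \<delta> * real (v m) \<and> 2 ^ level \<kappa> m \<le> v m \<and> N + 1 \<le> v m \<and> v m \<le> m - 1 \<and>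
      \<delta> * real (m - 1) \<le> real ((m - 1 - v m) div (N + 1 - j))" if m: "m0 \<le> m" and j: "j \<in> {1..M}" for m j
  proof -
    have "(2 * real N + 2) / \<eta> \<le> real m" "1 / \<kappa> \<le> real m" using m unfolding m0_def by linarith+
    then have big: "2 * real N + 2 \<le> \<eta> * real m" "1 \<le> \<kappa> * real m"
      using \<eta> \<kappa> by (simp_all add: field_simps)
    have v: "real (v m) \<le> \<eta> * real m" "\<eta> * real m - 1 < real (v m)"
      using \<eta> unfolding v_def by (simp, linarith)
    have "2 ^ level \<kappa> m \<le> \<delta> * (\<eta> * real m / 2)"
      using level_bounds(1)[OF \<kappa> big(2)] by (simp add: \<kappa>_def field_simps)
    also have "\<dots> \<le> \<delta> * real (v m)" using v big N \<delta>_pos by (intro mult_left_mono) auto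
    finally have 1: "2 ^ level \<kappa> m \<le> \<delta> * real (v m)" .
    also have "\<dots> \<le> real (v m)" using d1 \<delta>_pos by (simp add: mult_left_le_one_le)
    finally have 2: "2 ^ level \<kappa> m \<le> v m" by (rule numeral_power_le_of_nat_cancel_iff[THEN iffD1])
    have 3: "N + 1 \<le> v m" using v big N by linarith
    have "\<eta> * real m \<le> 1 / 2 * real m" using \<eta> by (intro mult_right_mono) auto
    then have half: "real (v m) \<le> real m / 2" "2 \<le> real m" using v big N by linarith+
    then have 4: "v m \<le> m - 1" by linarith
    define L where "L = N + 1 - j"
    have L: "1 \<le> L" "L \<le> N" using j M_less_N by (auto simp: L_def)
    define a where "a = m - 1 - v m"
    have ra: "real a = real m - 1 - real (v m)" using 4 half unfolding a_def by (simp add: of_nat_diff)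
    have "a = a div L * L + a mod L" by simp
    moreover have "a mod L < L" using L by simp
    ultimately have "a < (a div L + 1) * L" by (simp only: distrib_right)
    then have "real a < real ((a div L + 1) * L)" by (simp only: of_nat_less_iff)
    then have "real a < (real (a div L) + 1) * real L" by (simp add: algebra_simps)
    also have "\<dots> \<le> (real (a div L) + 1) * real N" using L by (intro mult_left_mono) auto
    finally have "real a < (real (a div L) + 1) * real N" .
    moreover have "real a \<ge> real m - 1 - \<eta> * real m" using ra v by linarith
    moreover have "real m - 1 - \<eta> * real m \<ge> (\<delta> * real (m - 1) + 1) * real N"
    proof -
      have eq: "real m - 1 - \<eta> * real m - (\<delta> * (real m - 1) + 1) * real N
          = \<eta> * real m - 1 - real N + \<delta> * real N"
        by (simp add: \<eta>_def field_simps)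
      have "0 \<le> \<eta> * real m - 1 - real N + \<delta> * real N"
        using big N \<open>0 < \<delta> * real N\<close> by linarith
      then have "(\<delta> * (real m - 1) + 1) * real N \<le> real m - 1 - \<eta> * real m"
        unfolding eq[symmetric] by (rule diff_ge_0_iff_ge[THEN iffD1])
      moreover have "real (m - 1) = real m - 1" using half by (simp add: of_nat_diff)
      ultimately show ?thesis by simp
    qed
    ultimately have "(\<delta> * real (m - 1) + 1) * real N < (real (a div L) + 1) * real N" by linarith
    then have "\<delta> * real (m - 1) + 1 < real (a div L) + 1" using N by (simp add: mult_less_cancel_right)
    then have 5: "\<delta> * real (m - 1) \<le> real (a div L)" by linarith
    show ?thesis using 1 2 3 4 5 unfolding a_def L_def by blast
  qed
  then show ?thesis by (intro that[OF \<kappa>, of m0 v]) blast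
qed

context tdfs_bandit
begin

abbreviation best :: "nat set" where
  "best \<equiv> \<sigma> ` {1..M}"

lemma sigma_permutes: "\<sigma> permutes {1..N}"
  using rank by (simp add: ranking_def)

lemma sigma_in: "k \<in> {1..N} \<Longrightarrow> \<sigma> k \<in> {1..N}"
  using permutes_in_image[OF sigma_permutes] by blast

lemma sigma_image: "\<sigma> ` {1..N} = {1..N}"
  by (rule permutes_image[OF sigma_permutes])

lemma sigma_inj: "inj \<sigma>"
  by (rule permutes_inj[OF sigma_permutes])

lemma best_subset: "best \<subseteq> {1..N}"
  using sigma_in M_less_N by auto

lemma mu_antimono: "k \<le> l \<Longrightarrow> k \<in> {1..N} \<Longrightarrow> l \<in> {1..N} \<Longrightarrow> \<mu> (\<sigma> l) \<le> \<mu> (\<sigma> k)"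
  using rank unfolding ranking_def \<mu>_def by blast

lemma mu_strict:
  assumes "k \<in> {1..M}" "k < l" "l \<le> N"
  shows "\<mu> (\<sigma> l) < \<mu> (\<sigma> k)"
proof (cases "l \<le> M")
  case True
  have "inj_on (\<lambda>i. \<mu> (\<sigma> i)) {1..M}" using adm unfolding admissible_def \<mu>_def by blast
  then have "\<mu> (\<sigma> l) \<noteq> \<mu> (\<sigma> k)" using assms True by (auto dest!: inj_onD[where x = l and y = k])
  moreover have "\<mu> (\<sigma> l) \<le> \<mu> (\<sigma> k)" using assms by (intro mu_antimono) auto
  ultimately show ?thesis by simp
next
  case False
  then have "\<mu> (\<sigma> l) < \<mu> (\<sigma> M)" using adm assms unfolding admissible_def \<mu>_def by auto
  also have "\<dots> \<le> \<mu> (\<sigma> k)" using assms M_less_N by (intro mu_antimono) auto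
  finally show ?thesis .
qed

lemma mu_less_iff:
  assumes "k \<in> {1..M}" "l \<in> {1..N}"
  shows "\<mu> (\<sigma> l) < \<mu> (\<sigma> k) \<longleftrightarrow> k < l"
proof (cases "k < l")
  case True
  then show ?thesis using assms mu_strict[of k l] by simp
next
  case False
  have "\<mu> (\<sigma> k) \<le> \<mu> (\<sigma> l)" using assms False M_less_N by (intro mu_antimono) auto
  then show ?thesis using False by simp
qed

lemma mu_best_nonneg: "k \<in> {1..M} \<Longrightarrow> 0 \<le> \<mu> (\<sigma> k)"
  using adm by (simp add: admissible_def \<mu>_def)

lemma accuracy_exists:
  obtains \<epsilon>\<^sub>0 where "0 < \<epsilon>\<^sub>0"
    "\<And>\<epsilon> n b. \<epsilon> \<le> \<epsilon>\<^sub>0 \<Longrightarrow> n \<in> {1..N} \<Longrightarrow> b \<in> {1..N} \<Longrightarrow> \<mu> n < \<mu> b \<Longrightarrow> \<mu> n + \<epsilon> < \<mu> b - \<epsilon>"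
proof -
  define D where "D = insert 1 ((\<lambda>(n, b). \<mu> b - \<mu> n) ` {(n, b) \<in> {1..N} \<times> {1..N}. \<mu> n < \<mu> b})"
  have fin: "finite D" unfolding D_def
    by (intro finite.insertI finite_imageI) (rule finite_subset[of _ "{1..N} \<times> {1..N}"], auto)
  then have "Min D \<in> D" by (intro Min_in) (auto simp: D_def)
  then have pos: "0 < Min D" by (auto simp: D_def)
  have "\<mu> n + \<epsilon> < \<mu> b - \<epsilon>" if "\<epsilon> \<le> Min D / 3" "n \<in> {1..N}" "b \<in> {1..N}" "\<mu> n < \<mu> b" for \<epsilon> n b
  proof -
    have "(\<lambda>(n, b). \<mu> b - \<mu> n) (n, b) \<in> D" unfolding D_def using that(2-4) by (intro insertI2 imageI) simp
    then have "Min D \<le> \<mu> b - \<mu> n" using fin by simp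
    then show ?thesis using that(1) pos by linarith
  qed
  then show ?thesis using pos by (intro that[of "Min D / 3"]) auto
qed

lemma measurable_prefix: "(\<lambda>S. restrict S {1..k}) \<in> measurable (obs_law n) (obs_space k)"
proof -
  have "(\<lambda>S. restrict S {1..k}) \<in> measurable (PiM {1..} (\<lambda>_. borel)) (obs_space k)"
    by (rule measurable_restrict_subset) auto
  then show ?thesis using measurable_cong_sets[OF sets_iid refl] by blast
qed

lemma measurable_h_prefix: "1 \<le> k \<Longrightarrow> (\<lambda>S. h k (restrict S {1..k})) \<in> borel_measurable (obs_law n)"
  by (rule measurable_compose[OF measurable_prefix h_measurable])

lemma measurable_g_prefix:
  "1 \<le> t \<Longrightarrow> 1 \<le> k \<Longrightarrow> (\<lambda>S. g t k (restrict S {1..k})) \<in> borel_measurable (obs_law n)"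
  by (rule measurable_compose[OF measurable_prefix g_measurable])

lemma g_ge_sets:
  "1 \<le> t \<Longrightarrow> 1 \<le> k \<Longrightarrow> {S \<in> space (obs_law n). r \<le> g t k (restrict S {1..k})} \<in> sets (obs_law n)"
  by (intro borel_measurable_le borel_measurable_const measurable_g_prefix)

lemma g_monotone:
  assumes "1 \<le> k" "1 \<le> t" "t \<le> t'"
  shows "g t k (restrict y {1..k}) \<le> g t' k (restrict y {1..k})"
proof -
  have "restrict y {1..k} \<in> space (obs_space k)" by (simp add: space_PiM)
  then show ?thesis using C5[unfolded C5_def] assms by meson
qed

text \<open>The two ways in which a dyadic block can fail, in one event of a single observation sequence,
  so that C5 applies to it.\<close>

definition irregular :: "real \<Rightarrow> nat \<Rightarrow> nat \<Rightarrow> (nat \<Rightarrow> real) \<Rightarrow> bool" where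
  "irregular \<epsilon> n e S \<longleftrightarrow> (\<exists>k\<in>{2 ^ e..2 ^ (e + 1)}. \<epsilon> < \<bar>h k (restrict S {1..k}) - \<mu> n\<bar>) \<or>
     (\<exists>k\<in>{1..<2 ^ e}. \<not> \<mu> n - \<epsilon> \<le> g (2 ^ e) k (restrict S {1..k}))"

lemma estimate_deviation_sets:
  "{S \<in> space (obs_law n). \<exists>k\<in>{2 ^ e..2 ^ (e + 1)}. \<epsilon> < \<bar>h k (restrict S {1..k}) - \<mu> n\<bar>} \<in> sets (obs_law n)"
proof (intro sets.sets_Collect_finite_Ex borel_measurable_less borel_measurable_const borel_measurable_abs
    borel_measurable_diff measurable_h_prefix)
  fix k :: nat assume "k \<in> {2 ^ e..2 ^ (e + 1)}"
  then show "1 \<le> k" by (metis atLeastAtMost_iff le_trans one_le_numeral one_le_power)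
qed simp

lemma bound_failure_sets:
  "{S \<in> space (obs_law n). \<forall>k\<in>{1..<2 ^ e}. r \<le> g (2 ^ e) k (restrict S {1..k})} \<in> sets (obs_law n)"
  by (intro sets.sets_Collect_finite_All g_ge_sets) auto

lemma irregular_sets: "{S \<in> space (obs_law n). irregular \<epsilon> n e S} \<in> sets (obs_law n)"
proof -
  have "{S \<in> space (obs_law n). irregular \<epsilon> n e S} =
      {S \<in> space (obs_law n). \<exists>k\<in>{2 ^ e..2 ^ (e + 1)}. \<epsilon> < \<bar>h k (restrict S {1..k}) - \<mu> n\<bar>} \<union>
      (space (obs_law n) -
        {S \<in> space (obs_law n). \<forall>k\<in>{1..<2 ^ e}. \<mu> n - \<epsilon> \<le> g (2 ^ e) k (restrict S {1..k})})"
    unfolding irregular_def by blast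
  also have "\<dots> \<in> sets (obs_law n)"
    by (intro sets.Un sets.compl_sets estimate_deviation_sets bound_failure_sets)
  finally show ?thesis .
qed

lemma small_o_dyadic:
  fixes p :: "nat \<Rightarrow> real"
  assumes "p \<in> o(\<lambda>t. 1 / real t)" "0 < c"
  shows "eventually (\<lambda>t. p t \<le> c / real t) sequentially"
  using landau_o.smallD[OF assms] by eventually_elim (auto simp: abs_le_iff)

lemma prob_irregular:
  assumes n: "n \<in> {1..N}" and "0 < \<epsilon>" "0 < c"
  shows "eventually (\<lambda>e. \<P>(S in obs_law n. irregular \<epsilon> n e S) \<le> c / 2 ^ e) sequentially"
proof -
  interpret prob_space "obs_law n" by (rule prob_space_iid[OF n])
  define ph where "ph t = \<P>(S in obs_law n. Max ((\<lambda>k. \<bar>h k (restrict S {1..k}) - mean \<nu> f (\<Theta> n)\<bar>) `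
      {k. 1 / 2 * real t \<le> real k \<and> k \<le> t}) > \<epsilon>)" for t
  define pg where "pg t = 1 - \<P>(S in obs_law n. \<forall>k\<in>{1..<t}. \<mu> n - \<epsilon> \<le> g t k (restrict S {1..k}))" for t
  have "ph \<in> o(\<lambda>t. 1 / real t)"
    unfolding ph_def
    using C5[unfolded C5_def, THEN conjunct2, THEN conjunct2, THEN conjunct2, THEN conjunct2, THEN conjunct2,
      THEN conjunct2, rule_format, OF Theta_in_H[OF n] assms(2), of "1 / 2"] by simp
  then have 1: "eventually (\<lambda>t. ph t \<le> c / 2 / real t) sequentially"
    using assms(3) by (intro small_o_dyadic) auto
  have "pg \<in> o(\<lambda>t. 1 / real t)"
    unfolding pg_def
    using C5[unfolded C5_def, THEN conjunct2, THEN conjunct2, THEN conjunct1, rule_format, OF Theta_in_H[OF n],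
      of "\<mu> n - \<epsilon>"] assms(2) by (simp add: \<mu>_def)
  then have 2: "eventually (\<lambda>t. pg t \<le> c / 2 / real t) sequentially"
    using assms(3) by (intro small_o_dyadic) auto
  have lim: "filterlim (\<lambda>e. 2 ^ e :: nat) at_top sequentially"
    by (rule filterlim_at_top_mono[OF filterlim_ident]) (simp add: less_imp_le)
  have lim': "filterlim (\<lambda>e. 2 ^ (e + 1) :: nat) at_top sequentially"
    using filterlim_compose[OF lim filterlim_Suc] by (simp only: Suc_eq_plus1)
  from eventually_compose_filterlim[OF 1 lim'] eventually_compose_filterlim[OF 2 lim]
  show ?thesis
  proof eventually_elim
    case (elim e)
    \<comment> \<open>For \<open>\<delta> = 1 / 2\<close> and \<open>t = 2 ^ (e + 1)\<close>, the maximum in C5 ranges over one dyadic block.\<close>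
    have blk: "{k. 1 / 2 * real (2 ^ (e + 1)) \<le> real k \<and> k \<le> 2 ^ (e + 1)} = {2 ^ e..2 ^ (e + 1)}"
      by (auto simp: numeral_power_le_of_nat_cancel_iff)
    have ne: "{2 ^ e..2 ^ (e + 1)::nat} \<noteq> {}" by simp
    have "{S \<in> space (obs_law n). irregular \<epsilon> n e S} =
      {S \<in> space (obs_law n). \<exists>k\<in>{2 ^ e..2 ^ (e + 1)}. \<epsilon> < \<bar>h k (restrict S {1..k}) - \<mu> n\<bar>} \<union>
      (space (obs_law n) -
        {S \<in> space (obs_law n). \<forall>k\<in>{1..<2 ^ e}. \<mu> n - \<epsilon> \<le> g (2 ^ e) k (restrict S {1..k})})"
      unfolding irregular_def by blast
    then have "\<P>(S in obs_law n. irregular \<epsilon> n e S) \<le>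
        \<P>(S in obs_law n. \<exists>k\<in>{2 ^ e..2 ^ (e + 1)}. \<epsilon> < \<bar>h k (restrict S {1..k}) - \<mu> n\<bar>) +
        prob (space (obs_law n) -
        {S \<in> space (obs_law n). \<forall>k\<in>{1..<2 ^ e}. \<mu> n - \<epsilon> \<le> g (2 ^ e) k (restrict S {1..k})})"
      using measure_Un_le[OF estimate_deviation_sets[of n e \<epsilon>] sets.compl_sets[OF bound_failure_sets[of n e "\<mu> n - \<epsilon>"]]]
      by simp
    also have "prob (space (obs_law n) -
        {S \<in> space (obs_law n). \<forall>k\<in>{1..<2 ^ e}. \<mu> n - \<epsilon> \<le> g (2 ^ e) k (restrict S {1..k})}) = pg (2 ^ e)"
      unfolding pg_def by (rule prob_compl[OF bound_failure_sets])
    also have "\<P>(S in obs_law n. \<exists>k\<in>{2 ^ e..2 ^ (e + 1)}. \<epsilon> < \<bar>h k (restrict S {1..k}) - \<mu> n\<bar>) = ph (2 ^ (e + 1))"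
      unfolding ph_def blk \<mu>_def using ne by (subst Max_gr_iff) auto
    finally have "\<P>(S in obs_law n. irregular \<epsilon> n e S) \<le> ph (2 ^ (e + 1)) + pg (2 ^ e)" .
    moreover have c: "c / 2 / real (2 ^ (e + 1)) = (c / 2 ^ e) / 4" "c / 2 / real (2 ^ e) = (c / 2 ^ e) / 2"
      by simp_all
    define d where "d = c / 2 ^ e"
    have "ph (2 ^ (e + 1)) \<le> d / 4" "pg (2 ^ e) \<le> d / 2" "0 < d"
      using elim assms(3) unfolding c d_def by simp_all
    ultimately show ?case unfolding d_def[symmetric] by linarith
  qed
qed

text \<open>The block \<open>e\<close> starts at \<open>2 ^ e > e\<close>, so the blocks up to \<open>e = T\<close> cover all play counts before the
  horizon.\<close>

definition regular :: "nat \<Rightarrow> nat \<Rightarrow> real \<Rightarrow> nat \<Rightarrow> (nat \<times> nat \<Rightarrow> real) \<Rightarrow> bool" where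
  "regular i T \<epsilon> q \<omega> \<longleftrightarrow> (\<forall>n\<in>{1..N}. \<forall>e\<in>{q..T}. \<not> irregular \<epsilon> n e (obs_seq i n T T \<omega>))"

lemma not_regular_eq:
  "{\<omega> \<in> space \<Omega>. \<not> regular i T \<epsilon> q \<omega>} =
    (\<Union>p\<in>{1..N} \<times> {q..T}. {\<omega> \<in> space \<Omega>. irregular \<epsilon> (fst p) (snd p) (obs_seq i (fst p) T T \<omega>)})"
  unfolding regular_def by fastforce

lemma irregular_obs_sets: "n \<in> {1..N} \<Longrightarrow> {\<omega> \<in> space \<Omega>. irregular \<epsilon> n e (obs_seq i n T T \<omega>)} \<in> sets \<Omega>"
  by (rule prob_obs_seq(1)[OF _ irregular_sets])

lemma not_regular_sets: "{\<omega> \<in> space \<Omega>. \<not> regular i T \<epsilon> q \<omega>} \<in> sets \<Omega>"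
  unfolding not_regular_eq by (intro sets.finite_UN irregular_obs_sets) auto

lemma prob_not_regular_le:
  "\<P>(\<omega> in \<Omega>. \<not> regular i T \<epsilon> q \<omega>) \<le>
    (\<Sum>n=1..N. \<Sum>e=q..T. \<P>(S in obs_law n. irregular \<epsilon> n e S))"
proof -
  interpret prob_space \<Omega> by (rule prob_space_Omega)
  have "\<P>(\<omega> in \<Omega>. \<not> regular i T \<epsilon> q \<omega>) \<le>
      (\<Sum>p\<in>{1..N} \<times> {q..T}. \<P>(\<omega> in \<Omega>. irregular \<epsilon> (fst p) (snd p) (obs_seq i (fst p) T T \<omega>)))"
    unfolding not_regular_eq
    by (intro finite_measure_subadditive_finite) (auto intro!: irregular_obs_sets)
  also have "\<dots> = (\<Sum>n=1..N. \<Sum>e=q..T. \<P>(\<omega> in \<Omega>. irregular \<epsilon> n e (obs_seq i n T T \<omega>)))"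
    by (simp add: sum.cartesian_product case_prod_beta)
  also have "\<dots> = (\<Sum>n=1..N. \<Sum>e=q..T. \<P>(S in obs_law n. irregular \<epsilon> n e S))"
    by (intro sum.cong refl prob_obs_seq(2) irregular_sets)
  finally show ?thesis .
qed

text \<open>The failure probabilities of the dyadic blocks form a geometric series, so irregularity at
  mini-index \<open>m\<close> has probability \<open>o(1 / m)\<close>, uniformly in the horizon.\<close>

lemma prob_not_regular:
  assumes "0 < \<epsilon>" "0 < \<kappa>" "0 < c"
  obtains m1 where "\<And>m T i. m1 \<le> m \<Longrightarrow> \<P>(\<omega> in \<Omega>. \<not> regular i T \<epsilon> (level \<kappa> m) \<omega>) \<le> c / real m"
proof -
  have N: "0 < real N" using M_less_N by simp
  define c' where "c' = c * \<kappa> / (4 * real N)"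
  have c': "0 < c'" using assms N by (simp add: c'_def)
  have "eventually (\<lambda>e. \<forall>n\<in>{1..N}. \<P>(S in obs_law n. irregular \<epsilon> n e S) \<le> c' / 2 ^ e) sequentially"
    using prob_irregular[OF _ assms(1) c'] by (intro eventually_ball_finite) auto
  then obtain q0 where q0: "\<And>e n. q0 \<le> e \<Longrightarrow> n \<in> {1..N} \<Longrightarrow> \<P>(S in obs_law n. irregular \<epsilon> n e S) \<le> c' / 2 ^ e"
    unfolding eventually_sequentially by blast
  define m1 where "m1 = nat \<lceil>2 ^ q0 / \<kappa>\<rceil>"
  have "\<P>(\<omega> in \<Omega>. \<not> regular i T \<epsilon> (level \<kappa> m) \<omega>) \<le> c / real m" if m: "m1 \<le> m" for m T i
  proof -
    have "2 ^ q0 / \<kappa> \<le> real m" using m unfolding m1_def by linarith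
    then have big: "2 ^ q0 \<le> \<kappa> * real m" using assms(2) by (simp add: field_simps)
    have "(1::real) \<le> 2 ^ q0" by simp
    with big have big': "1 \<le> \<kappa> * real m" by linarith
    define q where "q = level \<kappa> m"
    have q: "q0 \<le> q" unfolding q_def by (rule level_ge[OF assms(2) big])
    have "\<P>(\<omega> in \<Omega>. \<not> regular i T \<epsilon> q \<omega>) \<le> (\<Sum>n=1..N. \<Sum>e=q..T. c' / 2 ^ e)"
      using q by (intro order_trans[OF prob_not_regular_le] sum_mono q0) auto
    also have "\<dots> = real N * c' * (\<Sum>e=q..T. 1 / 2 ^ e)" by (simp add: sum_distrib_left)
    also have "\<dots> \<le> real N * c' * (2 / 2 ^ q)"
      using N c' by (intro mult_left_mono sum_dyadic_tail_le) auto
    also have "\<dots> = c * (\<kappa> / (2 * 2 ^ q))" using N by (simp add: c'_def)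
    also have "\<dots> \<le> c * (1 / real m)"
    proof (intro mult_left_mono)
      have "0 < \<kappa> * real m" using big' by linarith
      then have "0 < real m" using assms(2) by (simp only: zero_less_mult_iff) linarith
      then show "\<kappa> / (2 * 2 ^ q) \<le> 1 / real m"
        using level_bounds(2)[OF assms(2) big'] by (simp add: q_def field_simps)
    qed (use assms in simp)
    finally show ?thesis by (simp add: q_def)
  qed
  then show ?thesis by (rule that)
qed

end

lemma (in prob_space) expectation_card:
  assumes "finite I" "\<And>t. t \<in> I \<Longrightarrow> A t \<in> events"
  shows "integrable M (\<lambda>\<omega>. real (card {t \<in> I. \<omega> \<in> A t}))"
    and "expectation (\<lambda>\<omega>. real (card {t \<in> I. \<omega> \<in> A t})) = (\<Sum>t\<in>I. prob (A t))"
proof -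
  have eq: "real (card {t \<in> I. \<omega> \<in> A t}) = (\<Sum>t\<in>I. indicator (A t) \<omega>)" for \<omega>
    using assms(1) by (simp add: indicator_def sum.If_cases Int_def)
  have int: "integrable M (indicator (A t) :: 'a \<Rightarrow> real)" if "t \<in> I" for t
    using assms(2)[OF that] emeasure_finite by (intro integrable_real_indicator) (simp_all add: less_top[symmetric])
  show "integrable M (\<lambda>\<omega>. real (card {t \<in> I. \<omega> \<in> A t}))"
    unfolding eq by (intro Bochner_Integration.integrable_sum int)
  have "expectation (\<lambda>\<omega>. \<Sum>t\<in>I. indicator (A t) \<omega> :: real) = (\<Sum>t\<in>I. expectation (indicator (A t)))"
    by (intro Bochner_Integration.integral_sum int)
  also have "\<dots> = (\<Sum>t\<in>I. prob (A t))" using assms(2) by (intro sum.cong refl) simp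
  finally show "expectation (\<lambda>\<omega>. real (card {t \<in> I. \<omega> \<in> A t})) = (\<Sum>t\<in>I. prob (A t))" unfolding eq .
qed

lemma (in prob_space) sum_prob_le_of_card_le:
  assumes "finite I" "finite J" "finite K"
    and "\<And>t. t \<in> I \<Longrightarrow> A t \<in> events" "\<And>t. t \<in> J \<Longrightarrow> B t \<in> events" "\<And>t. t \<in> K \<Longrightarrow> C t \<in> events"
    and le: "\<And>\<omega>. \<omega> \<in> space M \<Longrightarrow>
      card {t \<in> I. \<omega> \<in> A t} \<le> card {t \<in> J. \<omega> \<in> B t} + c * card {t \<in> K. \<omega> \<in> C t}"
  shows "(\<Sum>t\<in>I. prob (A t)) \<le> (\<Sum>t\<in>J. prob (B t)) + real c * (\<Sum>t\<in>K. prob (C t))"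
proof -
  note A = expectation_card[OF assms(1,4)] and B = expectation_card[OF assms(2,5)]
    and C = expectation_card[OF assms(3,6)]
  have "expectation (\<lambda>\<omega>. real (card {t \<in> I. \<omega> \<in> A t})) \<le>
      expectation (\<lambda>\<omega>. real (card {t \<in> J. \<omega> \<in> B t}) + real c * real (card {t \<in> K. \<omega> \<in> C t}))"
  proof (rule integral_mono)
    fix \<omega> assume "\<omega> \<in> space M"
    show "real (card {t \<in> I. \<omega> \<in> A t}) \<le>
        real (card {t \<in> J. \<omega> \<in> B t}) + real c * real (card {t \<in> K. \<omega> \<in> C t})"
      using le[OF \<open>\<omega> \<in> space M\<close>] by (simp only: of_nat_add[symmetric] of_nat_mult[symmetric] of_nat_le_iff)
  qed (use A B C in simp_all)
  also have "\<dots> = (\<Sum>t\<in>J. prob (B t)) + real c * (\<Sum>t\<in>K. prob (C t))"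
    using B C by simp
  finally show ?thesis using A(2) by simp
qed

context tdfs_bandit
begin

lemma arms_event_sets: "{\<omega> \<in> space \<Omega>. P (map fst (hist i \<omega> t))} \<in> sets \<Omega>"
  using measurable_sets[OF measurable_arms, of "{as. P as}" i t] by (simp add: vimage_def Int_def conj_commute)

lemma run_good:
  assumes "i \<in> {1..M}" "regular i T \<epsilon> q \<omega>"
  shows "tdfs_run N M \<delta> h g i \<omega> T (\<lambda>n. obs_seq i n T T \<omega>)"
    and "tdfs_run.good N h g T (\<lambda>n. obs_seq i n T T \<omega>) \<mu> \<epsilon> best q"
proof -
  show run: "tdfs_run N M \<delta> h g i \<omega> T (\<lambda>n. obs_seq i n T T \<omega>)"
    using assms(1) observed_eq_obs_seq[of _ T i \<omega>] g_monotone by unfold_locales auto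
  have irr: "\<not> irregular \<epsilon> n e (obs_seq i n T T \<omega>)" if "n \<in> {1..N}" "e \<in> {q..T}" for n e
    using assms(2) that unfolding regular_def by blast
  have "estimates_accurate h q T (\<mu> n) \<epsilon> (obs_seq i n T T \<omega>)" if "n \<in> {1..N}" for n
    using irr[OF that] unfolding estimates_accurate_def irregular_def by (meson not_le)
  moreover have "bounds_valid g q T (\<mu> b - \<epsilon>) (obs_seq i b T T \<omega>)" if "b \<in> best" for b
    using irr[OF subsetD[OF best_subset that]] unfolding bounds_valid_def irregular_def by meson
  ultimately show "tdfs_run.good N h g T (\<lambda>n. obs_seq i n T T \<omega>) \<mu> \<epsilon> best q"
    unfolding tdfs_run.good_def[OF run] by blast
qed

text \<open>C5 bounds the rate only in the limit \<open>\<epsilon> \<rightarrow> 0\<close>; for a tolerance \<open>\<eta>\<close> a single small \<open>\<epsilon>\<close> is enough.\<close>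

lemma bound_exceedance_rate:
  assumes n: "n \<in> {1..N}" and k: "k \<in> {1..N}" and "\<mu> n < \<mu> (\<sigma> k)" "0 < \<eta>" "0 < \<epsilon>\<^sub>0"
  obtains \<epsilon> where "0 < \<epsilon>" "\<epsilon> \<le> \<epsilon>\<^sub>0"
    "eventually (\<lambda>T. (\<Sum>l\<in>{1..<T}. \<P>(S in obs_law n. \<mu> (\<sigma> k) - \<epsilon> \<le> g T l (restrict S {1..l})))
      \<le> (1 / KL \<nu> f (\<Theta> n) (\<Theta> (\<sigma> k)) + \<eta>) * ln (real T)) sequentially"
proof -
  define X where "X \<epsilon> T = 1 / ln (real T) *
    (\<Sum>l=1..T-1. \<P>(S in obs_law n. mean \<nu> f (\<Theta> (\<sigma> k)) - \<epsilon> \<le> g T l (restrict S {1..l})))" for \<epsilon> T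
  define c where "c = 1 / KL \<nu> f (\<Theta> n) (\<Theta> (\<sigma> k))"
  have "\<exists>L. ((\<lambda>\<epsilon>. limsup (\<lambda>T. ereal (X \<epsilon> T))) \<longlongrightarrow> L) (at_right 0) \<and> L \<le> ereal c"
    unfolding X_def c_def
    by (rule C5[unfolded C5_def, THEN conjunct2, THEN conjunct2, THEN conjunct2, THEN conjunct1, rule_format,
          OF Theta_in_H[OF n] Theta_in_H[OF sigma_in[OF k]]])
      (use assms(3) in \<open>simp add: \<mu>_def\<close>)
  then obtain L where L: "((\<lambda>\<epsilon>. limsup (\<lambda>T. ereal (X \<epsilon> T))) \<longlongrightarrow> L) (at_right 0)" "L \<le> ereal c" by blast
  have "L < ereal (c + \<eta>)" using L(2) assms(4) by (metis ereal_less(2) le_less_trans less_add_same_cancel1 less_ereal.simps(1))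
  from order_tendstoD(2)[OF L(1) this]
  obtain b where b: "0 < b" "\<And>\<epsilon>. 0 < \<epsilon> \<Longrightarrow> \<epsilon> < b \<Longrightarrow> limsup (\<lambda>T. ereal (X \<epsilon> T)) < ereal (c + \<eta>)"
    unfolding eventually_at_right_field by blast
  define \<epsilon> where "\<epsilon> = min \<epsilon>\<^sub>0 (b / 2)"
  have \<epsilon>: "0 < \<epsilon>" "\<epsilon> \<le> \<epsilon>\<^sub>0" "\<epsilon> < b" using b(1) assms(5) by (auto simp: \<epsilon>_def)
  have "eventually (\<lambda>T. ereal (X \<epsilon> T) < ereal (c + \<eta>)) sequentially"
    by (rule Limsup_lessD[OF b(2)[OF \<epsilon>(1,3)]])
  moreover have "eventually (\<lambda>T. 3 \<le> T) sequentially" by (rule eventually_ge_at_top)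
  ultimately have "eventually (\<lambda>T. (\<Sum>l\<in>{1..<T}. \<P>(S in obs_law n. \<mu> (\<sigma> k) - \<epsilon> \<le> g T l (restrict S {1..l})))
      \<le> (c + \<eta>) * ln (real T)) sequentially"
  proof eventually_elim
    case (elim T)
    then have ln: "0 < ln (real T)" by simp
    have "{1..<T} = {1..T - 1}" using elim by auto
    then have "(\<Sum>l\<in>{1..<T}. \<P>(S in obs_law n. \<mu> (\<sigma> k) - \<epsilon> \<le> g T l (restrict S {1..l}))) = X \<epsilon> T * ln (real T)"
      using ln by (simp add: X_def \<mu>_def)
    also have "\<dots> \<le> (c + \<eta>) * ln (real T)" using elim ln by (intro mult_right_mono) auto
    finally show ?case .
  qed
  then show ?thesis unfolding c_def by (rule that[OF \<epsilon>(1,2)])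
qed

text \<open>The expected form of the pathwise bound.  The first summand is governed by C5, and the
  irregular mini-indices contribute \<open>\<Sum>\<^sub>m o(1 / m) = o(ln T)\<close>.\<close>

lemma wrong_plays_rate:
  fixes F :: "(nat \<times> nat set \<times> nat) set"
  assumes i: "i \<in> {1..M}" and n: "n \<in> {1..N}" and k: "k \<in> {1..M}" and less: "\<mu> n < \<mu> (\<sigma> k)"
    and "finite F"
    and F: "\<And>j A b. (j, A, b) \<in> F \<Longrightarrow> A \<subseteq> {1..N} \<and> card A = N + 1 - j \<and> b \<in> A \<and> b \<in> best \<and>
      (\<forall>n'\<in>A - {b}. \<mu> n' < \<mu> b) \<and> n \<noteq> b \<and> \<mu> (\<sigma> k) \<le> \<mu> b"
    and Vm: "\<And>t. 1 \<le> t \<Longrightarrow> {\<omega> \<in> space \<Omega>. V t \<omega>} \<in> sets \<Omega>"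
    and V: "\<And>t \<omega>. 1 \<le> t \<Longrightarrow> V t \<omega> \<Longrightarrow>
      act i \<omega> t = n \<and> (\<exists>j A b. (j, A, b) \<in> F \<and> t \<in> mini i \<omega> j A)"
    and "0 < \<eta>"
  shows "eventually (\<lambda>T. (\<Sum>t=1..T. \<P>(\<omega> in \<Omega>. V t \<omega>))
    \<le> (1 / KL \<nu> f (\<Theta> n) (\<Theta> (\<sigma> k)) + \<eta>) * ln (real T)) sequentially"
proof -
  interpret prob_space \<Omega> by (rule prob_space_Omega)
  define I where "I = 1 / KL \<nu> f (\<Theta> n) (\<Theta> (\<sigma> k))"
  have kN: "k \<in> {1..N}" using k M_less_N by auto
  obtain \<epsilon>\<^sub>0 where \<epsilon>\<^sub>0: "0 < \<epsilon>\<^sub>0"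
    "\<And>\<epsilon> n b. \<epsilon> \<le> \<epsilon>\<^sub>0 \<Longrightarrow> n \<in> {1..N} \<Longrightarrow> b \<in> {1..N} \<Longrightarrow> \<mu> n < \<mu> b \<Longrightarrow> \<mu> n + \<epsilon> < \<mu> b - \<epsilon>"
    using accuracy_exists by blast
  obtain \<epsilon> where \<epsilon>: "0 < \<epsilon>" "\<epsilon> \<le> \<epsilon>\<^sub>0"
    and rate: "eventually (\<lambda>T. (\<Sum>l\<in>{1..<T}. \<P>(S in obs_law n. \<mu> (\<sigma> k) - \<epsilon> \<le> g T l (restrict S {1..l})))
      \<le> (I + \<eta> / 2) * ln (real T)) sequentially"
    using bound_exceedance_rate[OF n kN less, of "\<eta> / 2" \<epsilon>\<^sub>0] \<open>0 < \<eta>\<close> \<epsilon>\<^sub>0(1) unfolding I_def by auto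
  obtain \<kappa> m0 v where \<kappa>: "0 < \<kappa>"
    and lev: "\<forall>m\<ge>m0. \<forall>j\<in>{1..M}.
      2 ^ level \<kappa> m \<le> \<delta> * real (v m) \<and> 2 ^ level \<kappa> m \<le> v m \<and> N + 1 \<le> v m \<and> v m \<le> m - 1 \<and>
      \<delta> * real (m - 1) \<le> real ((m - 1 - v m) div (N + 1 - j))"
    by (rule level_parameters)
  \<comment> \<open>The irregular indices are weighted by \<open>card F\<close> and may use a quarter of the tolerance.\<close>
  define c where "c = \<eta> / (4 * real (card F + 1))"
  have c: "0 < c" "real (card F) * c \<le> \<eta> / 4"
    using \<open>0 < \<eta>\<close> by (simp_all add: c_def field_simps)
  obtain m1 where m1: "\<And>m T i. m1 \<le> m \<Longrightarrow> \<P>(\<omega> in \<Omega>. \<not> regular i T \<epsilon> (level \<kappa> m) \<omega>) \<le> c / real m"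
    using prob_not_regular[OF \<epsilon>(1) \<kappa> c(1)] by blast
  define m2 where "m2 = max m0 m1"
  define R where "R T = (\<Sum>l\<in>{1..<T}. \<P>(S in obs_law n. \<mu> (\<sigma> k) - \<epsilon> \<le> g T l (restrict S {1..l})))" for T
  have bound: "(\<Sum>t=1..T. \<P>(\<omega> in \<Omega>. V t \<omega>)) \<le> R T + real (card F) * (real m2 + c * (1 + ln (real T)))"
    if T: "1 \<le> T" for T
  proof -
    define G where "G l = {\<omega> \<in> space \<Omega>. \<mu> (\<sigma> k) - \<epsilon> \<le> g T l (restrict (obs_seq i n T T \<omega>) {1..l})}" for l
    define Z where "Z m = {\<omega> \<in> space \<Omega>. m < m2 \<or> \<not> regular i T \<epsilon> (level \<kappa> m) \<omega>}" for m
    have G: "G l \<in> sets \<Omega>" "prob (G l) = \<P>(S in obs_law n. \<mu> (\<sigma> k) - \<epsilon> \<le> g T l (restrict S {1..l}))"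
      if "l \<in> {1..<T}" for l
      using prob_obs_seq[OF n g_ge_sets[of T l n "\<mu> (\<sigma> k) - \<epsilon>"], of i T] that T unfolding G_def by auto
    have Z: "Z m \<in> sets \<Omega>" for m
      unfolding Z_def using not_regular_sets by (cases "m < m2") auto
    have "(\<Sum>t\<in>{1..T}. \<P>(\<omega> in \<Omega>. V t \<omega>)) \<le> (\<Sum>l\<in>{1..<T}. prob (G l)) + real (card F) * (\<Sum>m\<in>{1..T}. prob (Z m))"
    proof (rule sum_prob_le_of_card_le)
      fix \<omega> assume \<omega>: "\<omega> \<in> space \<Omega>"
      interpret run: tdfs_run N M \<delta> h g i \<omega> T "\<lambda>n. obs_seq i n T T \<omega>" \<mu> \<epsilon> best
        using i observed_eq_obs_seq[of _ T i \<omega>] g_monotone by unfold_locales auto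
      have good: "run.good q" if "regular i T \<epsilon> q \<omega>" for q
        by (rule run_good(2)[OF i that])
      have "card {t \<in> {1..T}. V t \<omega>} \<le>
          card {l \<in> {1..<T}. \<mu> (\<sigma> k) - \<epsilon> \<le> g T l (restrict (obs_seq i n T T \<omega>) {1..l})} +
          card F * card {m \<in> {1..T}. m < m2 \<or> \<not> run.good (level \<kappa> m)}"
      proof (rule run.card_wrong_plays_le[OF \<open>finite F\<close>])
        fix t assume t: "t \<in> {t \<in> {1..T}. V t \<omega>}"
        then obtain j A b where jA: "(j, A, b) \<in> F" "t \<in> mini i \<omega> j A" and act: "act i \<omega> t = n"
          using V[of t \<omega>] by auto
        have A: "A \<subseteq> {1..N}" "card A = N + 1 - j" "b \<in> A" "b \<in> best" "\<And>n'. n' \<in> A - {b} \<Longrightarrow> \<mu> n' < \<mu> b"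
          "n \<noteq> b" "\<mu> (\<sigma> k) \<le> \<mu> b" using F[OF jA(1)] by blast+
        have "\<mu> n' + \<epsilon> < \<mu> b - \<epsilon>" if "n' \<in> A - {b}" for n'
          using A(1,3) that by (intro \<epsilon>\<^sub>0(2) \<epsilon>(2) A(5)) auto
        then have "run.clear_best j A b" unfolding run.clear_best_def using A by blast
        then show "act i \<omega> t = n \<and> (\<exists>j A b. (j, A, b) \<in> F \<and> t \<in> mini i \<omega> j A \<and>
            run.clear_best j A b \<and> n \<noteq> b \<and> \<mu> (\<sigma> k) - \<epsilon> \<le> \<mu> b - \<epsilon>)"
          using jA act A(6,7) by (intro conjI exI[of _ j] exI[of _ A] exI[of _ b]) simp_all
      next
        fix m j assume "m2 \<le> m" "j \<in> {1..M}"
        then show "2 ^ level \<kappa> m \<le> \<delta> * real (v m) \<and> 2 ^ level \<kappa> m \<le> v m \<and> N + 1 \<le> v m \<and> v m \<le> m - 1 \<and>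
            \<delta> * real (m - 1) \<le> real ((m - 1 - v m) div (N + 1 - j))"
          by (intro lev[rule_format]) (simp_all add: m2_def)
      qed auto
      moreover have "card {m \<in> {1..T}. m < m2 \<or> \<not> run.good (level \<kappa> m)} \<le>
          card {m \<in> {1..T}. m < m2 \<or> \<not> regular i T \<epsilon> (level \<kappa> m) \<omega>}"
        using good by (intro card_mono) auto
      then have "card F * card {m \<in> {1..T}. m < m2 \<or> \<not> run.good (level \<kappa> m)} \<le>
          card F * card {m \<in> {1..T}. m < m2 \<or> \<not> regular i T \<epsilon> (level \<kappa> m) \<omega>}"
        by (rule mult_le_mono2)
      ultimately have "card {t \<in> {1..T}. V t \<omega>} \<le>
          card {l \<in> {1..<T}. \<mu> (\<sigma> k) - \<epsilon> \<le> g T l (restrict (obs_seq i n T T \<omega>) {1..l})} +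
          card F * card {m \<in> {1..T}. m < m2 \<or> \<not> regular i T \<epsilon> (level \<kappa> m) \<omega>}"
        by linarith
      then show "card {t \<in> {1..T}. \<omega> \<in> {\<omega> \<in> space \<Omega>. V t \<omega>}} \<le>
          card {l \<in> {1..<T}. \<omega> \<in> G l} + card F * card {m \<in> {1..T}. \<omega> \<in> Z m}"
        using \<omega> by (simp only: G_def Z_def mem_Collect_eq simp_thms)
    qed (use Vm G Z in auto)
    also have "(\<Sum>l\<in>{1..<T}. prob (G l)) = R T" unfolding R_def by (intro sum.cong refl G)
    also have "(\<Sum>m\<in>{1..T}. prob (Z m)) \<le> (\<Sum>m\<in>{1..T}. (if m < m2 then 1 else 0) + c / real m)"
    proof (rule sum_mono)
      fix m assume "m \<in> {1..T}"
      show "prob (Z m) \<le> (if m < m2 then 1 else 0) + c / real m"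
      proof (cases "m < m2")
        case True
        then show ?thesis using prob_le_1[of "Z m"] c(1) by (simp add: add_increasing2)
      next
        case False
        then show ?thesis using m1[of m i T] by (simp add: Z_def m2_def)
      qed
    qed
    also have "(\<Sum>m\<in>{1..T}. (if m < m2 then 1 else 0) + c / real m) =
        (\<Sum>m\<in>{1..T}. if m < m2 then 1 else 0) + c * (\<Sum>m=1..T. 1 / real m)"
      by (simp add: sum.distrib sum_distrib_left)
    also have "\<dots> \<le> real m2 + c * (1 + ln (real T))"
    proof (intro add_mono mult_left_mono sum_inverse_le_ln T)
      have "(\<Sum>m\<in>{1..T}. if m < m2 then 1 else 0 :: real) = real (card ({1..T} \<inter> {m. m < m2}))"
        by (simp add: sum.If_cases)
      also have "card ({1..T} \<inter> {m. m < m2}) \<le> card {..<m2}" by (intro card_mono) auto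
      finally show "(\<Sum>m\<in>{1..T}. if m < m2 then 1 else 0 :: real) \<le> real m2" by simp
    qed (use c in simp)
    finally show ?thesis by (simp add: mult_left_mono)
  qed
  have "eventually (\<lambda>T. real (card F) * (real m2 + c) \<le> \<eta> / 4 * ln (real T)) sequentially"
  proof -
    have "filterlim (\<lambda>T. \<eta> / 4 * ln (real T)) at_top sequentially"
      using \<open>0 < \<eta>\<close>
      by (intro filterlim_tendsto_pos_mult_at_top[OF tendsto_const] filterlim_compose[OF ln_at_top]
          filterlim_real_sequentially) simp
    then show ?thesis unfolding filterlim_at_top by blast
  qed
  moreover have "eventually (\<lambda>T. 1 \<le> T) sequentially" by (rule eventually_ge_at_top)
  ultimately show ?thesis using rate
  proof eventually_elim
    case (elim T)
    have ln: "0 \<le> ln (real T)" using elim by simp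
    have "(\<Sum>t=1..T. \<P>(\<omega> in \<Omega>. V t \<omega>)) \<le> R T + real (card F) * (real m2 + c * (1 + ln (real T)))"
      by (rule bound[OF elim(2)])
    also have "\<dots> = R T + real (card F) * (real m2 + c) + real (card F) * c * ln (real T)"
      by (simp add: algebra_simps)
    also have "\<dots> \<le> (I + \<eta> / 2) * ln (real T) + \<eta> / 4 * ln (real T) + \<eta> / 4 * ln (real T)"
      using elim c(2) ln by (intro add_mono mult_right_mono) (simp_all add: R_def)
    also have "\<dots> = (I + \<eta>) * ln (real T)" by (simp add: algebra_simps)
    finally show ?case by (simp add: I_def)
  qed
qed

end

section \<open>Expected rewards\<close>

lemma (in prob_space) expectation_of_bool:
  assumes "{\<omega> \<in> space M. Q \<omega>} \<in> events"
  shows "integrable M (\<lambda>\<omega>. of_bool (Q \<omega>) :: real)" and "expectation (\<lambda>\<omega>. of_bool (Q \<omega>)) = \<P>(\<omega> in M. Q \<omega>)"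
proof -
  have cong: "of_bool (Q \<omega>) = (indicator {\<omega> \<in> space M. Q \<omega>} \<omega> :: real)" if "\<omega> \<in> space M" for \<omega>
    using that by (simp add: indicator_def)
  have "integrable M (indicator {\<omega> \<in> space M. Q \<omega>} :: 'a \<Rightarrow> real)"
    using assms emeasure_finite by (intro integrable_real_indicator) (simp_all add: less_top[symmetric])
  then show "integrable M (\<lambda>\<omega>. of_bool (Q \<omega>) :: real)"
    using cong by (subst Bochner_Integration.integrable_cong[OF refl]) auto
  have "expectation (\<lambda>\<omega>. of_bool (Q \<omega>) :: real) = expectation (indicator {\<omega> \<in> space M. Q \<omega>})"
    by (rule Bochner_Integration.integral_cong[OF refl cong])
  then show "expectation (\<lambda>\<omega>. of_bool (Q \<omega>)) = \<P>(\<omega> in M. Q \<omega>)" using assms by simp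
qed

context tdfs_bandit
begin

text \<open>An event that does not involve the coordinate \<open>(n, t)\<close> is independent of it; here by Fubini
  on the decomposition of the product measure along this coordinate.\<close>

lemma integral_coord_factor:
  fixes u :: "real \<Rightarrow> real"
  assumes p: "n \<in> {1..N}" "1 \<le> t" and Q: "{\<omega> \<in> space \<Omega>. Q \<omega>} \<in> sets \<Omega>"
    and inv: "\<And>\<omega> y. \<omega> \<in> space \<Omega> \<Longrightarrow> Q (fun_upd \<omega> (n, t) y) = Q \<omega>"
    and u: "integrable (law n) u"
  defines "P' \<equiv> PiM (coords - {(n, t)}) (\<lambda>p. law (fst p))"
  shows "integrable \<Omega> (\<lambda>\<omega>. of_bool (Q \<omega>) * u (\<omega> (n, t)))" (is ?int)
    and "(\<integral>\<omega>. of_bool (Q \<omega>) * u (\<omega> (n, t)) \<partial>\<Omega>) =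
      (\<integral>X. of_bool (Q (fun_upd X (n, t) 0)) \<partial>P') * (\<integral>y. u y \<partial>law n)" (is ?eq)
proof -
  define Tm where "Tm = (\<lambda>(y::real, X). fun_upd X (n, t) y)"
  have ins: "insert (n, t) (coords - {(n, t)}) = coords" using p by auto
  interpret L: prob_space "law n" by (rule prob_space_law[OF p(1)])
  interpret P': prob_space P' unfolding P'_def by (intro prob_space_PiM prob_space_law) auto
  interpret K: pair_sigma_finite "law n" P' ..
  have dist: "distr (law n \<Otimes>\<^sub>M P') \<Omega> Tm = \<Omega>"
    using distr_pair_PiM_eq_PiM[of "coords - {(n, t)}" "\<lambda>p. law (fst p)" "(n, t)"] p prob_space_law
    unfolding ins P'_def Tm_def Omega_eq by auto
  have Tmeas: "Tm \<in> measurable (law n \<Otimes>\<^sub>M P') \<Omega>"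
  proof -
    have "(\<lambda>x. (snd x)((n, t) := fst x)) \<in> measurable (law n \<Otimes>\<^sub>M P') (PiM coords (\<lambda>p. law (fst p)))"
      by (rule measurable_fun_upd[where J = "coords - {(n, t)}"]) (use ins p in \<open>auto simp: P'_def\<close>)
    then show ?thesis unfolding Tm_def Omega_eq by (simp add: case_prod_beta)
  qed
  define \<phi> :: "(nat \<times> nat \<Rightarrow> real) \<Rightarrow> real" where "\<phi> X = of_bool (Q (fun_upd X (n, t) 0))" for X
  have fill: "fun_upd X (n, t) y \<in> space \<Omega>" if "X \<in> space P'" for X y
    using measurable_space[OF Tmeas, of "(y, X)"] that by (simp add: Tm_def space_pair_measure)
  have Qb: "(\<lambda>\<omega>. of_bool (Q \<omega>) :: real) \<in> borel_measurable \<Omega>"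
    by (rule borel_measurable_integrable, rule prob_space.expectation_of_bool(1)[OF prob_space_Omega Q])
  have \<phi>m: "\<phi> \<in> borel_measurable P'"
  proof -
    have "(\<lambda>X. Tm (0, X)) \<in> measurable P' \<Omega>"
      by (intro measurable_compose[OF _ Tmeas] measurable_Pair1') simp
    from measurable_compose[OF this Qb] show ?thesis by (simp add: \<phi>_def[abs_def] Tm_def)
  qed
  have um: "u \<in> borel_measurable (law n)" using u by simp
  define F where "F \<omega> = of_bool (Q \<omega>) * u (\<omega> (n, t))" for \<omega>
  have Fm: "F \<in> borel_measurable \<Omega>"
  proof -
    have "(\<lambda>\<omega>. \<omega> (n, t)) \<in> measurable \<Omega> (law n)"
      using measurable_coord measurable_cong_sets[OF refl sets_law[of n]] by blast
    from measurable_compose[OF this um] Qb show ?thesis unfolding F_def by (intro borel_measurable_times)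
  qed
  have FT: "F (Tm (y, X)) = u y * \<phi> X" if "X \<in> space P'" for y X
    using inv[OF fill[OF that, of y], of 0] by (simp add: F_def Tm_def \<phi>_def)
  have \<phi>i: "integrable P' \<phi>"
    by (rule P'.integrable_const_bound[of _ 1]) (use \<phi>m in \<open>auto simp: \<phi>_def\<close>)
  have Ki: "integrable (law n \<Otimes>\<^sub>M P') (\<lambda>z. u (fst z) * \<phi> (snd z))"
  proof (rule K.Fubini_integrable)
    show "(\<lambda>z. u (fst z) * \<phi> (snd z)) \<in> borel_measurable (law n \<Otimes>\<^sub>M P')"
      using um \<phi>m by (intro borel_measurable_times measurable_compose[OF measurable_fst] measurable_compose[OF measurable_snd])
    show "integrable (law n) (\<lambda>x. \<integral>y. norm (u (fst (x, y)) * \<phi> (snd (x, y))) \<partial>P')"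
      using u by (simp add: abs_mult)
    show "AE x in law n. integrable P' (\<lambda>y. u (fst (x, y)) * \<phi> (snd (x, y)))"
      using \<phi>i by simp
  qed
  have cong: "F (Tm z) = u (fst z) * \<phi> (snd z)" if "z \<in> space (law n \<Otimes>\<^sub>M P')" for z
    using FT[of "snd z" "fst z"] that by (auto simp: space_pair_measure)
  have "integrable (law n \<Otimes>\<^sub>M P') (\<lambda>z. F (Tm z))"
    using Ki cong by (subst Bochner_Integration.integrable_cong[OF refl]) auto
  then have "integrable (distr (law n \<Otimes>\<^sub>M P') \<Omega> Tm) F"
    using integrable_distr_eq[OF Tmeas Fm] by simp
  then show ?int unfolding dist F_def .
  have "integral\<^sup>L \<Omega> F = integral\<^sup>L (distr (law n \<Otimes>\<^sub>M P') \<Omega> Tm) F" by (simp add: dist)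
  also have "\<dots> = (\<integral>z. F (Tm z) \<partial>(law n \<Otimes>\<^sub>M P'))" by (rule integral_distr[OF Tmeas Fm])
  also have "\<dots> = (\<integral>z. u (fst z) * \<phi> (snd z) \<partial>(law n \<Otimes>\<^sub>M P'))"
    by (rule Bochner_Integration.integral_cong[OF refl cong])
  also have "\<dots> = (\<integral>x. \<integral>y. u (fst (x, y)) * \<phi> (snd (x, y)) \<partial>P' \<partial>law n)"
    by (rule K.integral_fst'[OF Ki, symmetric])
  also have "\<dots> = (\<integral>X. \<phi> X \<partial>P') * (\<integral>y. u y \<partial>law n)" by simp
  finally show ?eq unfolding F_def \<phi>_def .
qed

lemma integrable_state: "n \<in> {1..N} \<Longrightarrow> integrable (law n) (\<lambda>y. y)"
  using C1 Theta_in_H by (simp add: C1_def)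

lemma expected_reward:
  assumes p: "n \<in> {1..N}" "1 \<le> t" and Q: "{\<omega> \<in> space \<Omega>. Q \<omega>} \<in> sets \<Omega>"
    and inv: "\<And>\<omega> y. \<omega> \<in> space \<Omega> \<Longrightarrow> Q (fun_upd \<omega> (n, t) y) = Q \<omega>"
  shows "integrable \<Omega> (\<lambda>\<omega>. of_bool (Q \<omega>) * \<omega> (n, t))"
    and "(\<integral>\<omega>. of_bool (Q \<omega>) * \<omega> (n, t) \<partial>\<Omega>) = \<P>(\<omega> in \<Omega>. Q \<omega>) * \<mu> n"
proof -
  interpret L: prob_space "law n" by (rule prob_space_law[OF p(1)])
  note id = integral_coord_factor[OF p Q inv integrable_state[OF p(1)]]
    and const = integral_coord_factor[OF p Q inv, of "\<lambda>_. 1"]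
  show "integrable \<Omega> (\<lambda>\<omega>. of_bool (Q \<omega>) * \<omega> (n, t))" by (rule id(1))
  define J :: real where
    "J = (\<integral>X. of_bool (Q (fun_upd X (n, t) 0)) \<partial>PiM (coords - {(n, t)}) (\<lambda>p. law (fst p)))"
  have "(\<integral>\<omega>. of_bool (Q \<omega>) * 1 \<partial>\<Omega>) = J * (\<integral>y. 1 \<partial>law n)"
    unfolding J_def by (rule const(2), assumption, rule L.integrable_const)
  then have "J = \<P>(\<omega> in \<Omega>. Q \<omega>)"
    using prob_space.expectation_of_bool(2)[OF prob_space_Omega Q] L.prob_space by simp
  moreover have "(\<integral>\<omega>. of_bool (Q \<omega>) * \<omega> (n, t) \<partial>\<Omega>) = J * (\<integral>y. y \<partial>law n)"
    unfolding J_def by (rule id(2))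
  ultimately show "(\<integral>\<omega>. of_bool (Q \<omega>) * \<omega> (n, t) \<partial>\<Omega>) = \<P>(\<omega> in \<Omega>. Q \<omega>) * \<mu> n"
    by (simp add: \<mu>_def mean_def)
qed

abbreviation rewarded_arm :: "collision_model \<Rightarrow> nat \<Rightarrow> nat \<Rightarrow> (nat \<times> nat \<Rightarrow> real) \<Rightarrow> bool" where
  "rewarded_arm c t n \<omega> \<equiv> rewarded c M (\<lambda>i. act i \<omega> t) n"

lemma act_event_sets: "1 \<le> t \<Longrightarrow> {\<omega> \<in> space \<Omega>. P (act i \<omega> t)} \<in> sets \<Omega>"
  using measurable_sets[OF measurable_act, of t "{a. P a}" i] by (simp add: vimage_def Int_def conj_commute)

lemma rewarded_sets:
  assumes "1 \<le> t"
  shows "{\<omega> \<in> space \<Omega>. rewarded_arm c t n \<omega>} \<in> sets \<Omega>"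
proof (cases c)
  case Model1
  have "{\<omega> \<in> space \<Omega>. \<exists>i\<in>{1..M}. act i \<omega> t = n} \<in> sets \<Omega>"
    by (intro sets.sets_Collect_finite_Ex act_event_sets assms) simp
  then show ?thesis by (simp add: Model1)
next
  case Model2
  have "{\<omega> \<in> space \<Omega>. \<exists>i\<in>{1..M}. act i \<omega> t = n \<and> (\<forall>i'\<in>{1..M}. \<not> act i' \<omega> t = n \<or> i' = i)} \<in> sets \<Omega>"
    by (intro sets.sets_Collect_finite_Ex sets.sets_Collect_conj sets.sets_Collect_finite_All
        sets.sets_Collect_disj sets.sets_Collect_neg sets.sets_Collect_const act_event_sets assms) simp_all
  moreover have "(\<exists>!i. i \<in> {1..M} \<and> act i \<omega> t = n) \<longleftrightarrow>
      (\<exists>i\<in>{1..M}. act i \<omega> t = n \<and> (\<forall>i'\<in>{1..M}. \<not> act i' \<omega> t = n \<or> i' = i))" for \<omega>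
    unfolding Ex1_def by blast
  ultimately show ?thesis by (simp add: Model2)
qed

lemma regret_eq:
  "tdfs_regret c T =
    (\<Sum>t=1..T. (\<Sum>k=1..M. \<mu> (\<sigma> k)) - (\<Sum>n=1..N. \<P>(\<omega> in \<Omega>. rewarded_arm c t n \<omega>) * \<mu> n))"
proof -
  have reward: "total_reward c N M (TDFS h g \<delta> N M) \<omega> t = (\<Sum>n=1..N. of_bool (rewarded_arm c t n \<omega>) * \<omega> (n, t))" for \<omega> t
    unfolding total_reward_def act_def by (intro sum.cong refl) simp
  have inv: "rewarded_arm c t n (fun_upd \<omega> (n', t) y) = rewarded_arm c t n \<omega>" for t n n' \<omega> y
  proof -
    have "act i (fun_upd \<omega> (n', t) y) t = act i \<omega> t" for i by (intro act_cong) auto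
    then show ?thesis by simp
  qed
  note er = expected_reward[OF _ _ rewarded_sets inv]
  have int: "integrable \<Omega> (\<lambda>\<omega>. total_reward c N M (TDFS h g \<delta> N M) \<omega> t)" if "t \<in> {1..T}" for t
    unfolding reward using that by (intro Bochner_Integration.integrable_sum er(1)) auto
  have "(\<integral>\<omega>. (\<Sum>t=1..T. total_reward c N M (TDFS h g \<delta> N M) \<omega> t) \<partial>\<Omega>) =
      (\<Sum>t=1..T. \<integral>\<omega>. total_reward c N M (TDFS h g \<delta> N M) \<omega> t \<partial>\<Omega>)"
    by (rule Bochner_Integration.integral_sum[OF int])
  also have "\<dots> = (\<Sum>t=1..T. \<Sum>n=1..N. \<P>(\<omega> in \<Omega>. rewarded_arm c t n \<omega>) * \<mu> n)"
  proof (intro sum.cong refl)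
    fix t assume t: "t \<in> {1..T}"
    have "(\<integral>\<omega>. total_reward c N M (TDFS h g \<delta> N M) \<omega> t \<partial>\<Omega>) =
        (\<Sum>n=1..N. \<integral>\<omega>. of_bool (rewarded_arm c t n \<omega>) * \<omega> (n, t) \<partial>\<Omega>)"
      unfolding reward using t by (intro Bochner_Integration.integral_sum er(1)) auto
    also have "\<dots> = (\<Sum>n=1..N. \<P>(\<omega> in \<Omega>. rewarded_arm c t n \<omega>) * \<mu> n)"
      using t by (intro sum.cong refl er(2)) auto
    finally show "(\<integral>\<omega>. total_reward c N M (TDFS h g \<delta> N M) \<omega> t \<partial>\<Omega>) =
        (\<Sum>n=1..N. \<P>(\<omega> in \<Omega>. rewarded_arm c t n \<omega>) * \<mu> n)" .
  qed
  finally show ?thesis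
    by (simp add: regret_def \<mu>_def sum_subtractf)
qed

section \<open>Wrong slots\<close>

definition worse :: "nat \<Rightarrow> nat set" where
  "worse k = {n \<in> {1..N}. \<mu> n < \<mu> (\<sigma> k)}"

lemma finite_worse [simp]: "finite (worse k)"
  by (simp add: worse_def)

lemma worse_eq:
  assumes "k \<in> {1..M}"
  shows "worse k = \<sigma> ` {k<..N}"
proof -
  have "n \<in> worse k \<longleftrightarrow> n \<in> \<sigma> ` {k<..N}" for n
  proof
    assume n: "n \<in> worse k"
    then obtain l where l: "n = \<sigma> l" "l \<in> {1..N}" using sigma_image unfolding worse_def by blast
    then show "n \<in> \<sigma> ` {k<..N}" using n mu_less_iff[OF assms l(2)] unfolding worse_def by auto
  next
    assume "n \<in> \<sigma> ` {k<..N}"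
    then show "n \<in> worse k" using mu_strict[OF assms] sigma_in unfolding worse_def by auto
  qed
  then show ?thesis by blast
qed

text \<open>A wrong play of \<open>n\<close> in a frame in which the better targets have all been played correctly.  The
  bound on \<open>t\<close> keeps the slots of the frame before \<open>t\<close> clear of the initialization.\<close>

definition first_wrong :: "nat \<Rightarrow> nat \<Rightarrow> nat \<Rightarrow> nat \<Rightarrow> (nat \<times> nat \<Rightarrow> real) \<Rightarrow> bool" where
  "first_wrong i j n t \<omega> \<longleftrightarrow>
    N * M + M < t \<and> target M i t = j \<and> avail i \<omega> t = \<sigma> ` {j..N} \<and> act i \<omega> t = n"

lemma avail_of_arms:
  assumes "M < t" "i \<in> {1..M}"
  shows "avail i \<omega> t = {1..N} - (\<lambda>r. map fst (hist i \<omega> t) ! (r - 1)) ` {t + 1 - target M i t..<t}"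
proof -
  have "target M i t \<le> M" using target_bounds[of i M t] assms by simp
  then have "map fst (hist i \<omega> t) ! (r - 1) = act i \<omega> r" if "r \<in> {t + 1 - target M i t..<t}" for r
  proof -
    have "r - 1 < t" "Suc (r - 1) = r"
      using that \<open>target M i t \<le> M\<close> assms(1) by auto
    then show ?thesis by (simp add: hist_nth del: One_nat_def)
  qed
  then show ?thesis by (simp add: avail_def)
qed

lemma first_wrong_sets:
  assumes "i \<in> {1..M}" "1 \<le> t"
  shows "{\<omega> \<in> space \<Omega>. first_wrong i j n t \<omega>} \<in> sets \<Omega>"
proof (cases "N * M + M < t")
  case True
  then have "M < t" by simp
  have act: "act i \<omega> t = map fst (hist i \<omega> t) ! (t - 1)" for \<omega> using assms(2) by (simp add: hist_nth)
  show ?thesis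
    unfolding first_wrong_def avail_of_arms[OF \<open>M < t\<close> assms(1)] act by (rule arms_event_sets)
qed (simp add: first_wrong_def)

lemma first_wrong_rate:
  assumes i: "i \<in> {1..M}" and j: "j \<in> {1..M}" and n: "n \<in> worse j" and "0 < \<eta>"
  shows "eventually (\<lambda>T. (\<Sum>t=1..T. \<P>(\<omega> in \<Omega>. first_wrong i j n t \<omega>))
    \<le> (1 / KL \<nu> f (\<Theta> n) (\<Theta> (\<sigma> j)) + \<eta>) * ln (real T)) sequentially"
proof (rule wrong_plays_rate[OF i _ j, where F = "{(j, \<sigma> ` {j..N}, \<sigma> j)}"])
  show "n \<in> {1..N}" "\<mu> n < \<mu> (\<sigma> j)" using n by (auto simp: worse_def)
  show "{\<omega> \<in> space \<Omega>. first_wrong i j n t \<omega>} \<in> sets \<Omega>" if "1 \<le> t" for t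
    by (rule first_wrong_sets[OF i that])
  fix t \<omega> assume t: "1 \<le> t" and w: "first_wrong i j n t \<omega>"
  have "N < slot_index M t" using w t by (subst after_init_iff) (auto simp: first_wrong_def)
  then have "t \<in> mini i \<omega> j (\<sigma> ` {j..N})" using w t unfolding mini_def first_wrong_def by blast
  then show "act i \<omega> t = n \<and> (\<exists>j' A b. (j', A, b) \<in> {(j, \<sigma> ` {j..N}, \<sigma> j)} \<and> t \<in> mini i \<omega> j' A)"
    using w by (auto simp: first_wrong_def)
next
  fix j' A b assume "(j', A, b) \<in> {(j, \<sigma> ` {j..N}, \<sigma> j)}"
  then have eq: "j' = j" "A = \<sigma> ` {j..N}" "b = \<sigma> j" by auto
  have "card A = N + 1 - j" unfolding eq by (subst card_image[OF inj_on_subset[OF sigma_inj]]) auto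
  moreover have "A \<subseteq> {1..N}" using sigma_in j unfolding eq by auto
  moreover have "\<sigma> j \<in> A" using j M_less_N unfolding eq by auto
  moreover have "\<mu> n' < \<mu> (\<sigma> j)" if n': "n' \<in> A - {\<sigma> j}" for n'
  proof -
    obtain l where l: "n' = \<sigma> l" "l \<in> {j..N}" using n' unfolding eq by blast
    then have "l \<noteq> j" using n' by auto
    then show ?thesis using mu_strict[OF j, of l] l by auto
  qed
  moreover have "n \<noteq> \<sigma> j" using n by (auto simp: worse_def)
  ultimately show "A \<subseteq> {1..N} \<and> card A = N + 1 - j' \<and> b \<in> A \<and> b \<in> best \<and>
      (\<forall>n'\<in>A - {b}. \<mu> n' < \<mu> b) \<and> n \<noteq> b \<and> \<mu> (\<sigma> j) \<le> \<mu> b"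
    using j unfolding eq by auto
qed (use \<open>0 < \<eta>\<close> in simp_all)

text \<open>The plays of a bad arm in all mini-sequences together.  Every mini-sequence contains one of
  the \<open>M\<close> best arms, so all of these plays need a confidence bound of about \<open>\<mu> (\<sigma> M)\<close> at least, and
  the observations are shared between the mini-sequences.\<close>

lemma total_plays_rate:
  assumes i: "i \<in> {1..M}" and n: "n \<in> worse M" and "0 < \<eta>"
  shows "eventually (\<lambda>T. (\<Sum>t=1..T. \<P>(\<omega> in \<Omega>. N * M + M < t \<and> act i \<omega> t = n))
    \<le> (1 / KL \<nu> f (\<Theta> n) (\<Theta> (\<sigma> M)) + \<eta>) * ln (real T)) sequentially"
proof -
  define F where "F = {(j, A, b). j \<in> {1..M} \<and> A \<in> Pow {1..N} \<and> b \<in> {1..N} \<and> card A = N + 1 - j \<and>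
    b \<in> A \<and> b \<in> best \<and> (\<forall>n'\<in>A - {b}. \<mu> n' < \<mu> b)}"
  have M: "M \<in> {1..M}" using M_pos by simp
  have finF: "finite F"
    by (rule finite_subset[of _ "{1..M} \<times> Pow {1..N} \<times> {1..N}"]) (auto simp: F_def)
  show ?thesis
  proof (rule wrong_plays_rate[OF i _ M _ finF])
    show "n \<in> {1..N}" "\<mu> n < \<mu> (\<sigma> M)" using n by (auto simp: worse_def)
    show "{\<omega> \<in> space \<Omega>. N * M + M < t \<and> act i \<omega> t = n} \<in> sets \<Omega>" if "1 \<le> t" for t
      by (rule act_event_sets[OF that])
    fix t \<omega> assume t: "1 \<le> t" and w: "N * M + M < t \<and> act i \<omega> t = n"
    define j A where "j = target M i t" and "A = avail i \<omega> t"
    have j: "j \<in> {1..M}" unfolding j_def by (rule target_bounds[OF i t])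
    have A: "A \<subseteq> {1..N}" "card A = N + 1 - j" unfolding A_def j_def
      using avail_subset card_avail[OF i] w by auto
    have "N < slot_index M t" using w t by (subst after_init_iff) auto
    then have mini: "t \<in> mini i \<omega> j A" using t unfolding mini_def j_def A_def by blast
    have "\<exists>l. l \<in> {1..M} \<and> \<sigma> l \<in> A"
    proof (rule ccontr)
      assume "\<nexists>l. l \<in> {1..M} \<and> \<sigma> l \<in> A"
      then have "best \<inter> A = {}" by blast
      moreover have "card best = M" using card_image[OF inj_on_subset[OF sigma_inj], of "{1..M}"] by simp
      moreover have "finite A" using A(1) finite_subset by blast
      ultimately have "card (best \<union> A) = M + (N + 1 - j)" using A(2) by (subst card_Un_disjoint) auto
      moreover have "card (best \<union> A) \<le> card {1..N}" using A(1) best_subset by (intro card_mono) auto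
      ultimately show False using j M_less_N by auto
    qed
    \<comment> \<open>The removed arms are at most \<open>M - 1\<close>, so one of the \<open>M\<close> best arms is left.\<close>
    define l where "l = (LEAST l. l \<in> {1..M} \<and> \<sigma> l \<in> A)"
    have l: "l \<in> {1..M}" "\<sigma> l \<in> A"
      using LeastI_ex[OF \<open>\<exists>l. l \<in> {1..M} \<and> \<sigma> l \<in> A\<close>] unfolding l_def by blast+
    have "\<mu> n' < \<mu> (\<sigma> l)" if "n' \<in> A - {\<sigma> l}" for n'
    proof -
      obtain l' where l': "n' = \<sigma> l'" "l' \<in> {1..N}" using \<open>n' \<in> A - {\<sigma> l}\<close> A(1) sigma_image by blast
      have "\<not> l' < l"
      proof
        assume "l' < l"
        then have "\<not> (l' \<in> {1..M} \<and> \<sigma> l' \<in> A)" unfolding l_def by (rule not_less_Least)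
        then show False using l' that l(1) \<open>l' < l\<close> by auto
      qed
      moreover have "l' \<noteq> l" using that l' by auto
      ultimately show ?thesis using l' mu_strict[OF l(1), of l'] by auto
    qed
    then have "(j, A, \<sigma> l) \<in> F" using j A l sigma_in[of l] M_less_N unfolding F_def by auto
    then show "act i \<omega> t = n \<and> (\<exists>j A b. (j, A, b) \<in> F \<and> t \<in> mini i \<omega> j A)"
      using mini w by blast
  next
    fix j A b assume F: "(j, A, b) \<in> F"
    then obtain l where l: "b = \<sigma> l" "l \<in> {1..M}" by (auto simp: F_def)
    have "\<mu> (\<sigma> M) \<le> \<mu> b" unfolding l using l(2) M_less_N by (intro mu_antimono) auto
    moreover from this have "n \<noteq> b" using n by (auto simp: worse_def)
    ultimately show "A \<subseteq> {1..N} \<and> card A = N + 1 - j \<and> b \<in> A \<and> b \<in> best \<and>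
        (\<forall>n'\<in>A - {b}. \<mu> n' < \<mu> b) \<and> n \<noteq> b \<and> \<mu> (\<sigma> M) \<le> \<mu> b"
      using F unfolding F_def by auto
  qed (use \<open>0 < \<eta>\<close> in simp_all)
qed

end

context tdfs_bandit
begin

definition wrong :: "nat \<Rightarrow> nat \<Rightarrow> nat \<Rightarrow> (nat \<times> nat \<Rightarrow> real) \<Rightarrow> bool" where
  "wrong i k t \<omega> \<longleftrightarrow> target M i t = k \<and> act i \<omega> t \<noteq> \<sigma> k"

text \<open>The first wrong slot of a frame has the right set of available arms.  Charging a wrong slot
  to the first one of its frame thus leaves one mini-sequence per target to be counted.\<close>

lemma wrong_has_first_wrong:
  assumes i: "i \<in> {1..M}" and t: "N * M + 2 * M < t" and w: "wrong i k t \<omega>"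
  shows "\<exists>j\<in>{1..k}. \<exists>n\<in>worse j. first_wrong i j n (t - (k - j)) \<omega>"
proof -
  have k: "k \<in> {1..M}" "target M i t = k" using w target_bounds[OF i, of t] t by (auto simp: wrong_def)
  define b where "b = t - k"
  have b: "t = b + k" "N * M + M < b" using t k by (auto simp: b_def)
  have tj: "t - (k - j) = b + j" if "j \<in> {1..k}" for j using that b by auto
  have target: "target M i (b + j) = j" if "j \<in> {1..k}" for j
  proof -
    have "target M i (t - (k - j)) = target M i t - (k - j)"
      using i k t that by (intro target_shift) auto
    then show ?thesis using tj[OF that] k that by simp
  qed
  define j where "j = (LEAST j. j \<in> {1..k} \<and> act i \<omega> (b + j) \<noteq> \<sigma> j)"
  have "k \<in> {1..k} \<and> act i \<omega> (b + k) \<noteq> \<sigma> k" using w k b by (simp add: wrong_def)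
  then have j: "j \<in> {1..k}" "act i \<omega> (b + j) \<noteq> \<sigma> j"
    unfolding j_def by (rule LeastI2, blast)+
  have right: "act i \<omega> (b + j') = \<sigma> j'" if "j' \<in> {1..<j}" for j'
  proof -
    have "j' < j" using that by simp
    then have "\<not> (j' \<in> {1..k} \<and> act i \<omega> (b + j') \<noteq> \<sigma> j')" unfolding j_def by (rule not_less_Least)
    then show ?thesis using that j(1) by auto
  qed
  have "{b + j + 1 - j..<b + j} = (\<lambda>j'. b + j') ` {1..<j}"
    using image_add_atLeastLessThan[of b 1 j] by (simp add: add.commute)
  then have "act i \<omega> ` {b + j + 1 - j..<b + j} = (\<lambda>j'. act i \<omega> (b + j')) ` {1..<j}"
    by (simp only: image_image)
  also have "\<dots> = \<sigma> ` {1..<j}" using right by (rule image_cong[OF refl])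
  finally have "avail i \<omega> (b + j) = \<sigma> ` {1..N} - \<sigma> ` {1..<j}"
    unfolding avail_def target[OF j(1)] sigma_image by simp
  also have "\<dots> = \<sigma> ` ({1..N} - {1..<j})" by (rule image_set_diff[OF sigma_inj, symmetric])
  also have "{1..N} - {1..<j} = {j..N}" using j(1) by auto
  finally have av: "avail i \<omega> (b + j) = \<sigma> ` {j..N}" .
  have "N < slot_index M (b + j)" using b by (subst after_init_iff) auto
  then have "act i \<omega> (b + j) \<in> \<sigma> ` {j..N}"
    using act_in_avail[OF i, of "b + j" \<omega>] b unfolding av by simp
  then obtain l where l: "act i \<omega> (b + j) = \<sigma> l" "l \<in> {j..N}" by blast
  then have "l \<noteq> j" using j(2) by auto
  moreover have jM: "j \<in> {1..M}" using j(1) k(1) by auto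
  ultimately have "\<sigma> l \<in> worse j" using l(2) unfolding worse_eq[OF jM] by auto
  moreover have "first_wrong i j (\<sigma> l) (b + j) \<omega>"
    using b av l(1) target[OF j(1)] by (simp add: first_wrong_def)
  ultimately show ?thesis using j(1) tj[OF j(1)] by (intro bexI[of _ j] bexI[of _ "\<sigma> l"]) simp_all
qed

lemma wrong_sets: "1 \<le> t \<Longrightarrow> {\<omega> \<in> space \<Omega>. wrong i k t \<omega>} \<in> sets \<Omega>"
  unfolding wrong_def by (rule act_event_sets)

lemma sum_shift_le:
  fixes p :: "nat \<Rightarrow> real"
  assumes "\<And>t. 0 \<le> p t"
  shows "(\<Sum>t=1..T. if d < t then p (t - d) else 0) \<le> (\<Sum>t=1..T. p t)"
proof -
  have "(\<Sum>t=1..T. if d < t then p (t - d) else 0) = (\<Sum>t\<in>{t \<in> {1..T}. d < t}. p (t - d))"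
    by (simp add: sum.If_cases Int_def)
  also have "\<dots> = (\<Sum>s\<in>(\<lambda>t. t - d) ` {t \<in> {1..T}. d < t}. p s)"
    by (subst sum.reindex) (auto simp: inj_on_def)
  also have "\<dots> \<le> (\<Sum>s=1..T. p s)" using assms by (intro sum_mono2) auto
  finally show ?thesis .
qed

text \<open>A wrong slot and the first wrong slot of its frame are \<open>k - j\<close> apart, so no first wrong slot is
  used twice for the same pair of targets.\<close>

lemma sum_prob_wrong_le:
  assumes i: "i \<in> {1..M}"
  shows "(\<Sum>t=1..T. \<P>(\<omega> in \<Omega>. wrong i k t \<omega>)) \<le> real (N * M + 2 * M) +
    (\<Sum>j=1..k. \<Sum>n\<in>worse j. \<Sum>t=1..T. \<P>(\<omega> in \<Omega>. first_wrong i j n t \<omega>))"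
proof -
  interpret prob_space \<Omega> by (rule prob_space_Omega)
  define t0 where "t0 = N * M + 2 * M"
  define p where "p j n t = \<P>(\<omega> in \<Omega>. first_wrong i j n t \<omega>)" for j n t
  have step: "\<P>(\<omega> in \<Omega>. wrong i k t \<omega>) \<le> (if t \<le> t0 then 1 else 0) +
      (\<Sum>j=1..k. \<Sum>n\<in>worse j. if k - j < t then p j n (t - (k - j)) else 0)" if t: "t \<in> {1..T}" for t
  proof (cases "t \<le> t0")
    case True
    have "0 \<le> (\<Sum>j=1..k. \<Sum>n\<in>worse j. if k - j < t then p j n (t - (k - j)) else 0)"
      by (intro sum_nonneg) (simp add: p_def)
    moreover have "\<P>(\<omega> in \<Omega>. wrong i k t \<omega>) \<le> 1" by (rule prob_le_1)
    ultimately show ?thesis unfolding if_P[OF True] by linarith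
  next
    case False
    show ?thesis
    proof (cases "k \<le> M")
      case True
      define E where "E = (\<lambda>(j, n). {\<omega> \<in> space \<Omega>. first_wrong i j n (t - (k - j)) \<omega>})"
      have kt: "k - j < t" for j using False True by (simp add: t0_def)
      have sub: "{\<omega> \<in> space \<Omega>. wrong i k t \<omega>} \<subseteq> (\<Union>q\<in>Sigma {1..k} worse. E q)"
      proof
        fix \<omega> assume "\<omega> \<in> {\<omega> \<in> space \<Omega>. wrong i k t \<omega>}"
        then have \<omega>: "\<omega> \<in> space \<Omega>" "wrong i k t \<omega>" by auto
        obtain j n where "j \<in> {1..k}" "n \<in> worse j" "first_wrong i j n (t - (k - j)) \<omega>"
          using wrong_has_first_wrong[OF i _ \<omega>(2)] False by (auto simp: t0_def)
        then have "(j, n) \<in> Sigma {1..k} worse" "\<omega> \<in> E (j, n)" using \<omega>(1) by (auto simp: E_def)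
        then show "\<omega> \<in> (\<Union>q\<in>Sigma {1..k} worse. E q)" by blast
      qed
      have ev: "E ` Sigma {1..k} worse \<subseteq> events"
      proof -
        have "1 \<le> t - (k - j)" for j using kt[of j] by simp
        then show ?thesis using first_wrong_sets[OF i] by (auto simp: E_def)
      qed
      have "\<P>(\<omega> in \<Omega>. wrong i k t \<omega>) \<le> prob (\<Union>q\<in>Sigma {1..k} worse. E q)"
        using sub ev by (intro finite_measure_mono sets.finite_UN) auto
      also have "\<dots> \<le> (\<Sum>q\<in>Sigma {1..k} worse. prob (E q))"
        using ev by (intro finite_measure_subadditive_finite) auto
      also have "\<dots> = (\<Sum>j=1..k. \<Sum>n\<in>worse j. p j n (t - (k - j)))"
        by (subst sum.Sigma) (auto simp: E_def p_def case_prod_beta)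
      finally show ?thesis using False kt by simp
    next
      case False': False
      have "{\<omega> \<in> space \<Omega>. wrong i k t \<omega>} = {}"
        using target_bounds[OF i, of t] t False' by (auto simp: wrong_def)
      then have "\<P>(\<omega> in \<Omega>. wrong i k t \<omega>) = 0" by (simp only: measure_empty)
      moreover have "0 \<le> (\<Sum>j=1..k. \<Sum>n\<in>worse j. if k - j < t then p j n (t - (k - j)) else 0)"
        by (intro sum_nonneg) (simp add: p_def)
      ultimately show ?thesis unfolding if_not_P[OF False] by linarith
    qed
  qed
  have "(\<Sum>t=1..T. \<P>(\<omega> in \<Omega>. wrong i k t \<omega>)) \<le> (\<Sum>t=1..T. (if t \<le> t0 then 1 else 0) +
      (\<Sum>j=1..k. \<Sum>n\<in>worse j. if k - j < t then p j n (t - (k - j)) else 0))"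
    by (rule sum_mono[OF step])
  also have "\<dots> = (\<Sum>t=1..T. if t \<le> t0 then 1 else 0) +
      (\<Sum>t=1..T. \<Sum>j=1..k. \<Sum>n\<in>worse j. if k - j < t then p j n (t - (k - j)) else 0)"
    by (rule sum.distrib)
  also have "(\<Sum>t=1..T. \<Sum>j=1..k. \<Sum>n\<in>worse j. if k - j < t then p j n (t - (k - j)) else 0) =
      (\<Sum>j=1..k. \<Sum>t=1..T. \<Sum>n\<in>worse j. if k - j < t then p j n (t - (k - j)) else 0)"
    by (rule sum.swap)
  also have "\<dots> = (\<Sum>j=1..k. \<Sum>n\<in>worse j. \<Sum>t=1..T. if k - j < t then p j n (t - (k - j)) else 0)"
    by (intro sum.cong refl sum.swap)
  also have "(\<Sum>t=1..T. if t \<le> t0 then 1 else 0 :: real) + \<dots> \<le>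
      real t0 + (\<Sum>j=1..k. \<Sum>n\<in>worse j. \<Sum>t=1..T. p j n t)"
  proof (rule add_mono)
    show "(\<Sum>j=1..k. \<Sum>n\<in>worse j. \<Sum>t=1..T. if k - j < t then p j n (t - (k - j)) else 0) \<le>
        (\<Sum>j=1..k. \<Sum>n\<in>worse j. \<Sum>t=1..T. p j n t)"
      by (rule sum_mono, rule sum_mono, rule sum_shift_le) (simp add: p_def)
    have "(\<Sum>t=1..T. if t \<le> t0 then 1 else 0 :: real) = real (card ({1..T} \<inter> {t. t \<le> t0}))"
      by (simp add: sum.If_cases)
    also have "card ({1..T} \<inter> {t. t \<le> t0}) \<le> card {1..t0}" by (intro card_mono) auto
    finally show "(\<Sum>t=1..T. if t \<le> t0 then 1 else 0 :: real) \<le> real t0" by simp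
  qed
  finally show ?thesis by (simp add: p_def t0_def)
qed

lemma sum_prob_plays_le:
  "(\<Sum>t=1..T. \<P>(\<omega> in \<Omega>. act i \<omega> t = n)) \<le> real (N * M + M) +
    (\<Sum>t=1..T. \<P>(\<omega> in \<Omega>. N * M + M < t \<and> act i \<omega> t = n))"
proof -
  interpret prob_space \<Omega> by (rule prob_space_Omega)
  have "(\<Sum>t=1..T. \<P>(\<omega> in \<Omega>. act i \<omega> t = n)) \<le>
      (\<Sum>t=1..T. (if t \<le> N * M + M then 1 else 0) + \<P>(\<omega> in \<Omega>. N * M + M < t \<and> act i \<omega> t = n))"
    by (rule sum_mono) (auto intro: add_increasing2)
  also have "\<dots> = (\<Sum>t=1..T. if t \<le> N * M + M then 1 else 0) +
      (\<Sum>t=1..T. \<P>(\<omega> in \<Omega>. N * M + M < t \<and> act i \<omega> t = n))" by (rule sum.distrib)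
  also have "(\<Sum>t=1..T. if t \<le> N * M + M then 1 else 0 :: real) = real (card ({1..T} \<inter> {t. t \<le> N * M + M}))"
    by (simp add: sum.If_cases)
  also have "card ({1..T} \<inter> {t. t \<le> N * M + M}) \<le> card {1..N * M + M}" by (intro card_mono) auto
  finally show ?thesis by simp
qed

section \<open>From the loss of a slot to the regret\<close>

definition loss :: "collision_model \<Rightarrow> nat \<Rightarrow> (nat \<times> nat \<Rightarrow> real) \<Rightarrow> real" where
  "loss c t \<omega> = (\<Sum>k=1..M. \<mu> (\<sigma> k)) - (\<Sum>n=1..N. \<mu> n * of_bool (rewarded_arm c t n \<omega>))"

text \<open>The common form of the slot-wise loss bounds.  In collision model 1 a wrong player costs the mean
  of the arm that it misses, in collision model 2 possibly the whole reward.  The gain \<open>d n\<close> is what a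
  bad arm earns if it is played at the last target, and \<open>e n\<close> accounts for negative means.\<close>

definition charge :: "(nat \<Rightarrow> real) \<Rightarrow> (nat \<Rightarrow> real) \<Rightarrow> (nat \<Rightarrow> real) \<Rightarrow> nat \<Rightarrow> (nat \<times> nat \<Rightarrow> real) \<Rightarrow> real" where
  "charge a d e t \<omega> = (\<Sum>i=1..M. (\<Sum>k=1..M. a k * of_bool (wrong i k t \<omega>))
     - (\<Sum>n\<in>worse M. d n * of_bool (first_wrong i M n t \<omega>))
     + (\<Sum>n\<in>worse M. e n * of_bool (act i \<omega> t = n)))"

lemma regret_le_charge:
  assumes "\<And>t \<omega>. 1 \<le> t \<Longrightarrow> \<omega> \<in> space \<Omega> \<Longrightarrow> loss c t \<omega> \<le> charge a d e t \<omega>"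
  shows "tdfs_regret c T \<le>
    (\<Sum>i=1..M. (\<Sum>k=1..M. a k * (\<Sum>t=1..T. \<P>(\<omega> in \<Omega>. wrong i k t \<omega>)))
     - (\<Sum>n\<in>worse M. d n * (\<Sum>t=1..T. \<P>(\<omega> in \<Omega>. first_wrong i M n t \<omega>)))
     + (\<Sum>n\<in>worse M. e n * (\<Sum>t=1..T. \<P>(\<omega> in \<Omega>. act i \<omega> t = n))))"
proof -
  interpret prob_space \<Omega> by (rule prob_space_Omega)
  have E: "has_bochner_integral \<Omega> (\<lambda>\<omega>. of_bool (Q \<omega>)) \<P>(\<omega> in \<Omega>. Q \<omega>)"
    if "{\<omega> \<in> space \<Omega>. Q \<omega>} \<in> sets \<Omega>" for Q
    using expectation_of_bool[OF that] by (simp add: has_bochner_integral_iff)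
  have const: "has_bochner_integral \<Omega> (\<lambda>\<omega>. y) y" for y :: real
    using prob_space by (simp add: has_bochner_integral_iff)
  define A where "A t = (\<Sum>i=1..M. (\<Sum>k=1..M. a k * \<P>(\<omega> in \<Omega>. wrong i k t \<omega>))
     - (\<Sum>n\<in>worse M. d n * \<P>(\<omega> in \<Omega>. first_wrong i M n t \<omega>))
     + (\<Sum>n\<in>worse M. e n * \<P>(\<omega> in \<Omega>. act i \<omega> t = n)))" for t
  have slot: "(\<Sum>k=1..M. \<mu> (\<sigma> k)) - (\<Sum>n=1..N. \<P>(\<omega> in \<Omega>. rewarded_arm c t n \<omega>) * \<mu> n) \<le> A t"
    if t: "1 \<le> t" for t
  proof -
    have L: "has_bochner_integral \<Omega> (loss c t)
        ((\<Sum>k=1..M. \<mu> (\<sigma> k)) - (\<Sum>n=1..N. \<mu> n * \<P>(\<omega> in \<Omega>. rewarded_arm c t n \<omega>)))"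
      unfolding loss_def[abs_def]
      by (intro has_bochner_integral_diff has_bochner_integral_sum has_bochner_integral_mult_right E const
          rewarded_sets t)
    have R: "has_bochner_integral \<Omega> (charge a d e t) (A t)"
      unfolding charge_def[abs_def] A_def using t
      by (intro has_bochner_integral_add has_bochner_integral_diff has_bochner_integral_sum
          has_bochner_integral_mult_right E wrong_sets first_wrong_sets act_event_sets) auto
    have "integral\<^sup>L \<Omega> (loss c t) \<le> integral\<^sup>L \<Omega> (charge a d e t)"
      using L R assms[OF t] by (intro integral_mono) (auto simp: has_bochner_integral_iff)
    then show ?thesis using L R by (simp add: has_bochner_integral_iff mult.commute)
  qed
  have "tdfs_regret c T \<le> (\<Sum>t=1..T. A t)"
    unfolding regret_eq by (intro sum_mono slot) auto
  also have "\<dots> = (\<Sum>i=1..M. \<Sum>t=1..T. (\<Sum>k=1..M. a k * \<P>(\<omega> in \<Omega>. wrong i k t \<omega>))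
     - (\<Sum>n\<in>worse M. d n * \<P>(\<omega> in \<Omega>. first_wrong i M n t \<omega>))
     + (\<Sum>n\<in>worse M. e n * \<P>(\<omega> in \<Omega>. act i \<omega> t = n)))"
    unfolding A_def by (rule sum.swap)
  also have "\<dots> = (\<Sum>i=1..M. (\<Sum>k=1..M. a k * (\<Sum>t=1..T. \<P>(\<omega> in \<Omega>. wrong i k t \<omega>)))
     - (\<Sum>n\<in>worse M. d n * (\<Sum>t=1..T. \<P>(\<omega> in \<Omega>. first_wrong i M n t \<omega>)))
     + (\<Sum>n\<in>worse M. e n * (\<Sum>t=1..T. \<P>(\<omega> in \<Omega>. act i \<omega> t = n))))"
    unfolding sum.distrib sum_subtractf sum_distrib_left
    by (intro sum.cong refl arg_cong2[where f = plus] arg_cong2[where f = minus] sum.swap)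
  finally show ?thesis .
qed

text \<open>Linear in the counts \<open>u j n\<close> of first wrong plays, so that a common tolerance \<open>\<eta>\<close> in all rates
  becomes one error term.\<close>

definition total_charge :: "(nat \<Rightarrow> real) \<Rightarrow> (nat \<Rightarrow> real) \<Rightarrow> (nat \<Rightarrow> real) \<Rightarrow> (nat \<Rightarrow> nat \<Rightarrow> real) \<Rightarrow> real" where
  "total_charge a d e u = (\<Sum>k=1..M. a k * (\<Sum>j=1..k. \<Sum>n\<in>worse j. u j n))
     - (\<Sum>n\<in>worse M. d n * u M n) + (\<Sum>n\<in>worse M. e n * u M n)"

lemma total_charge_add: "total_charge a d e (\<lambda>j n. u j n + w j n) = total_charge a d e u + total_charge a d e w"
  unfolding total_charge_def by (simp add: sum.distrib distrib_left)

lemma total_charge_scale: "total_charge a d e (\<lambda>j n. u j n * y) = total_charge a d e u * y"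
  unfolding total_charge_def
  by (simp add: sum_distrib_right sum_distrib_left distrib_right left_diff_distrib mult.assoc)

text \<open>The gain \<open>d n\<close> never exceeds the charge \<open>a M\<close> of the same slot.  So upper bounds on the counts
  suffice, although the gain enters with a negative sign.\<close>

lemma charge_mono:
  fixes a d :: "nat \<Rightarrow> real" and u w :: "nat \<Rightarrow> nat \<Rightarrow> real"
  assumes a: "\<And>k. k \<in> {1..M} \<Longrightarrow> 0 \<le> a k" and d: "\<And>n. n \<in> worse M \<Longrightarrow> d n \<le> a M"
    and le: "\<And>j n. j \<in> {1..M} \<Longrightarrow> n \<in> worse j \<Longrightarrow> w j n \<le> u j n"
  shows "(\<Sum>k=1..M. a k * (\<Sum>j=1..k. \<Sum>n\<in>worse j. w j n)) - (\<Sum>n\<in>worse M. d n * w M n) \<le>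
    (\<Sum>k=1..M. a k * (\<Sum>j=1..k. \<Sum>n\<in>worse j. u j n)) - (\<Sum>n\<in>worse M. d n * u M n)"
proof -
  define v where "v j n = u j n - w j n" for j n
  have v: "0 \<le> v j n" if "j \<in> {1..M}" "n \<in> worse j" for j n using le[OF that] by (simp add: v_def)
  have inner: "0 \<le> (\<Sum>n\<in>worse j. v j n)" if "j \<in> {1..M}" for j using v[OF that] by (rule sum_nonneg)
  have "(\<Sum>n\<in>worse M. d n * v M n) \<le> (\<Sum>n\<in>worse M. a M * v M n)"
    using d v[of M] M_pos by (intro sum_mono mult_right_mono) auto
  also have "\<dots> = a M * (\<Sum>n\<in>worse M. v M n)" by (simp add: sum_distrib_left)
  also have "\<dots> \<le> a M * (\<Sum>j=1..M. \<Sum>n\<in>worse j. v j n)"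
    using a M_pos inner by (intro mult_left_mono member_le_sum[of M "{1..M}" "\<lambda>j. \<Sum>n\<in>worse j. v j n"]) auto
  also have "\<dots> \<le> (\<Sum>k=1..M. a k * (\<Sum>j=1..k. \<Sum>n\<in>worse j. v j n))"
    using a M_pos v
    by (intro member_le_sum[of M "{1..M}" "\<lambda>k. a k * (\<Sum>j=1..k. \<Sum>n\<in>worse j. v j n)"] mult_nonneg_nonneg sum_nonneg) auto
  finally have "(\<Sum>n\<in>worse M. d n * v M n) \<le> (\<Sum>k=1..M. a k * (\<Sum>j=1..k. \<Sum>n\<in>worse j. v j n))" .
  then show ?thesis
    unfolding v_def by (simp add: sum_subtractf right_diff_distrib)
qed

text \<open>The limit superior of the regret is the value of the charges at the rates \<open>1 / I\<close> of the counts.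
  A slot-wise loss bound is all that depends on the collision model.\<close>

theorem regret_rate:
  assumes a: "\<And>k. k \<in> {1..M} \<Longrightarrow> 0 \<le> a k" and d: "\<And>n. n \<in> worse M \<Longrightarrow> d n \<le> a M"
    and e: "\<And>n. n \<in> worse M \<Longrightarrow> 0 \<le> e n"
    and loss: "\<And>t \<omega>. 1 \<le> t \<Longrightarrow> \<omega> \<in> space \<Omega> \<Longrightarrow> loss c t \<omega> \<le> charge a d e t \<omega>"
  shows "limsup (\<lambda>T. ereal (tdfs_regret c T / ln (real T))) \<le>
    ereal (real M * total_charge a d e (\<lambda>j n. 1 / KL \<nu> f (\<Theta> n) (\<Theta> (\<sigma> j))))"
proof -
  define r where "r j n = 1 / KL \<nu> f (\<Theta> n) (\<Theta> (\<sigma> j))" for j n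
  define C1 where "C1 = total_charge a d e (\<lambda>j n. 1)"
  define K where "K = real M * ((\<Sum>k=1..M. a k * real (N * M + 2 * M)) + (\<Sum>n\<in>worse M. e n * real (N * M + M)))"
  define R where "R T = tdfs_regret c T" for T
  have bound: "limsup (\<lambda>T. ereal (R T / ln (real T))) \<le> ereal (real M * total_charge a d e r + \<gamma>)"
    if \<gamma>: "0 < \<gamma>" for \<gamma>
  proof -
    define \<eta> where "\<eta> = \<gamma> / (2 * (\<bar>real M * C1\<bar> + 1))"
    have \<eta>: "0 < \<eta>" "real M * C1 * \<eta> \<le> \<gamma> / 2"
    proof -
      show "0 < \<eta>" using \<gamma> by (simp add: \<eta>_def)
      have "real M * C1 * \<eta> \<le> (\<bar>real M * C1\<bar> + 1) * \<eta>" using \<open>0 < \<eta>\<close> by (intro mult_right_mono) auto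
      also have "\<dots> = \<gamma> / 2"
      proof -
        have "A * (\<gamma> / (2 * A)) = \<gamma> / 2" if "A \<noteq> 0" for A :: real using that by simp
        moreover have "\<bar>real M * C1\<bar> + 1 \<noteq> 0" using abs_ge_zero[of "real M * C1"] by linarith
        ultimately show ?thesis unfolding \<eta>_def by blast
      qed
      finally show "real M * C1 * \<eta> \<le> \<gamma> / 2" .
    qed
    have ev1: "eventually (\<lambda>T. \<forall>i\<in>{1..M}. \<forall>j\<in>{1..M}. \<forall>n\<in>worse j.
        (\<Sum>t=1..T. \<P>(\<omega> in \<Omega>. first_wrong i j n t \<omega>)) \<le> (r j n + \<eta>) * ln (real T)) sequentially"
      unfolding r_def using first_wrong_rate \<eta>(1) by (intro eventually_ball_finite ballI) auto
    have ev2: "eventually (\<lambda>T. \<forall>i\<in>{1..M}. \<forall>n\<in>worse M.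
        (\<Sum>t=1..T. \<P>(\<omega> in \<Omega>. N * M + M < t \<and> act i \<omega> t = n)) \<le> (r M n + \<eta>) * ln (real T)) sequentially"
      unfolding r_def using total_plays_rate \<eta>(1) by (intro eventually_ball_finite ballI) auto
    have "filterlim (\<lambda>T. \<gamma> / 2 * ln (real T)) at_top sequentially"
      using \<gamma>
      by (intro filterlim_tendsto_pos_mult_at_top[OF tendsto_const] filterlim_compose[OF ln_at_top]
          filterlim_real_sequentially) simp
    then have ev3: "eventually (\<lambda>T. K \<le> \<gamma> / 2 * ln (real T)) sequentially"
      unfolding filterlim_at_top by blast
    have ev4: "eventually (\<lambda>T. 3 \<le> T) sequentially" by (rule eventually_ge_at_top)
    have "eventually (\<lambda>T. R T / ln (real T) \<le> real M * total_charge a d e r + \<gamma>) sequentially"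
      using ev1 ev2 ev3 ev4
    proof eventually_elim
      case (elim T)
      have ln: "0 < ln (real T)" using elim(4) by simp
      define u where "u j n = (r j n + \<eta>) * ln (real T)" for j n
      have player: "(\<Sum>k=1..M. a k * (\<Sum>t=1..T. \<P>(\<omega> in \<Omega>. wrong i k t \<omega>)))
           - (\<Sum>n\<in>worse M. d n * (\<Sum>t=1..T. \<P>(\<omega> in \<Omega>. first_wrong i M n t \<omega>)))
           + (\<Sum>n\<in>worse M. e n * (\<Sum>t=1..T. \<P>(\<omega> in \<Omega>. act i \<omega> t = n)))
         \<le> (\<Sum>k=1..M. a k * real (N * M + 2 * M)) + (\<Sum>n\<in>worse M. e n * real (N * M + M)) + total_charge a d e u"
        if i: "i \<in> {1..M}" for i
      proof -
        define w where "w j n = (\<Sum>t=1..T. \<P>(\<omega> in \<Omega>. first_wrong i j n t \<omega>))" for j n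
        have "(\<Sum>k=1..M. a k * (\<Sum>t=1..T. \<P>(\<omega> in \<Omega>. wrong i k t \<omega>))) \<le>
            (\<Sum>k=1..M. a k * (real (N * M + 2 * M) + (\<Sum>j=1..k. \<Sum>n\<in>worse j. w j n)))"
          unfolding w_def by (intro sum_mono mult_left_mono sum_prob_wrong_le i a)
        also have "\<dots> = (\<Sum>k=1..M. a k * real (N * M + 2 * M)) + (\<Sum>k=1..M. a k * (\<Sum>j=1..k. \<Sum>n\<in>worse j. w j n))"
          unfolding distrib_left sum.distrib ..
        finally have 1: "(\<Sum>k=1..M. a k * (\<Sum>t=1..T. \<P>(\<omega> in \<Omega>. wrong i k t \<omega>))) \<le> \<dots>" .
        have "(\<Sum>n\<in>worse M. e n * (\<Sum>t=1..T. \<P>(\<omega> in \<Omega>. act i \<omega> t = n))) \<le>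
            (\<Sum>n\<in>worse M. e n * (real (N * M + M) + u M n))"
          unfolding u_def using elim(2) i
          by (intro sum_mono mult_left_mono e order_trans[OF sum_prob_plays_le] add_left_mono) auto
        also have "\<dots> = (\<Sum>n\<in>worse M. e n * real (N * M + M)) + (\<Sum>n\<in>worse M. e n * u M n)"
          unfolding distrib_left sum.distrib ..
        finally have 2: "(\<Sum>n\<in>worse M. e n * (\<Sum>t=1..T. \<P>(\<omega> in \<Omega>. act i \<omega> t = n))) \<le> \<dots>" .
        have 3: "(\<Sum>k=1..M. a k * (\<Sum>j=1..k. \<Sum>n\<in>worse j. w j n)) - (\<Sum>n\<in>worse M. d n * w M n) \<le>
            (\<Sum>k=1..M. a k * (\<Sum>j=1..k. \<Sum>n\<in>worse j. u j n)) - (\<Sum>n\<in>worse M. d n * u M n)"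
          using elim(1) i unfolding w_def u_def by (intro charge_mono a d) auto
        show ?thesis using 1 2 3 unfolding total_charge_def w_def[symmetric] by linarith
      qed
      have "R T \<le> (\<Sum>i=1..M. (\<Sum>k=1..M. a k * real (N * M + 2 * M)) +
          (\<Sum>n\<in>worse M. e n * real (N * M + M)) + total_charge a d e u)"
        unfolding R_def by (rule order_trans[OF regret_le_charge[OF loss] sum_mono[OF player]])
      also have "\<dots> = K + real M * total_charge a d e u" by (simp add: K_def distrib_left)
      also have "total_charge a d e u = (total_charge a d e r + C1 * \<eta>) * ln (real T)"
      proof -
        have "u = (\<lambda>j n. (r j n + 1 * \<eta>) * ln (real T))" by (simp add: u_def fun_eq_iff)
        then have "total_charge a d e u = total_charge a d e (\<lambda>j n. r j n + 1 * \<eta>) * ln (real T)"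
          by (simp only: total_charge_scale)
        also have "total_charge a d e (\<lambda>j n. r j n + 1 * \<eta>) = total_charge a d e r + C1 * \<eta>"
          unfolding C1_def total_charge_scale[symmetric] by (rule total_charge_add)
        finally show ?thesis .
      qed
      also have "K + real M * ((total_charge a d e r + C1 * \<eta>) * ln (real T)) =
          K + (real M * total_charge a d e r + real M * C1 * \<eta>) * ln (real T)"
        by (simp add: algebra_simps)
      also have "\<dots> \<le> \<gamma> / 2 * ln (real T) + (real M * total_charge a d e r + \<gamma> / 2) * ln (real T)"
        by (rule add_mono, use elim(3) in simp, rule mult_right_mono, use \<eta>(2) in simp, use ln in simp)
      also have "\<dots> = (real M * total_charge a d e r + \<gamma>) * ln (real T)" by (simp add: algebra_simps)
      finally show ?case using ln by (simp add: pos_divide_le_eq)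
    qed
    then show ?thesis by (intro Limsup_bounded) simp
  qed
  have "limsup (\<lambda>T. ereal (R T / ln (real T))) \<le> ereal (real M * total_charge a d e r)"
    by (rule ereal_le_epsilon2) (use bound in \<open>simp add: plus_ereal.simps(1)[symmetric] del: plus_ereal.simps\<close>)
  then show ?thesis unfolding R_def r_def .
qed

end

section \<open>The loss of a slot in the two collision models\<close>

context tdfs_bandit
begin

lemma sum_arms_split:
  fixes F :: "nat \<Rightarrow> real"
  shows "(\<Sum>n=1..N. F n) = (\<Sum>k=1..M. F (\<sigma> k)) + (\<Sum>n\<in>worse M. F n)"
proof -
  have M: "M \<in> {1..M}" using M_pos by simp
  have "{1..N} = \<sigma> ` ({1..M} \<union> {M<..N})"
    using sigma_image ivl_disj_un_two(8)[of 1 M N] M_pos M_less_N by simp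
  then have "{1..N} = best \<union> worse M" unfolding worse_eq[OF M] image_Un .
  moreover have "best \<inter> worse M = {}"
    unfolding worse_eq[OF M] image_Int[OF sigma_inj, symmetric] by auto
  ultimately have "(\<Sum>n=1..N. F n) = (\<Sum>n\<in>best. F n) + (\<Sum>n\<in>worse M. F n)"
    by (simp add: sum.union_disjoint)
  also have "(\<Sum>n\<in>best. F n) = (\<Sum>k=1..M. F (\<sigma> k))"
    by (rule sum.reindex_cong[OF inj_on_subset[OF sigma_inj subset_UNIV] refl refl])
  finally show ?thesis .
qed

lemma charge_eq:
  "charge a d e t \<omega> = (\<Sum>k=1..M. a k * (\<Sum>i=1..M. of_bool (wrong i k t \<omega>)))
     - (\<Sum>n\<in>worse M. d n * (\<Sum>i=1..M. of_bool (first_wrong i M n t \<omega>)))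
     + (\<Sum>n\<in>worse M. e n * (\<Sum>i=1..M. of_bool (act i \<omega> t = n)))"
  unfolding charge_def sum.distrib sum_subtractf sum_distrib_left
  by (intro arg_cong2[where f = plus] arg_cong2[where f = minus] sum.swap)

text \<open>The sum has one possibly nonzero term, since exactly one player has the last target.\<close>

lemma sum_first_wrong:
  assumes "1 \<le> t"
  obtains i where "i \<in> {1..M}" "target M i t = M"
    "\<And>n. (\<Sum>i'=1..M. of_bool (first_wrong i' M n t \<omega>) :: real) = of_bool (first_wrong i M n t \<omega>)"
proof -
  have "\<exists>!i. i \<in> {1..M} \<and> target M i t = M"
    using M_pos by (intro ex1_player_with_target[OF assms]) simp
  then obtain i where i: "i \<in> {1..M} \<and> target M i t = M"
    and uniq: "\<forall>i'. i' \<in> {1..M} \<and> target M i' t = M \<longrightarrow> i' = i"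
    by (rule ex1E)
  have "(\<Sum>i'=1..M. of_bool (first_wrong i' M n t \<omega>) :: real) = (\<Sum>i'\<in>{i}. of_bool (first_wrong i' M n t \<omega>))" for n
  proof (rule sum.mono_neutral_right)
    show "{i} \<subseteq> {1..M}" using i by blast
    show "\<forall>i'\<in>{1..M} - {i}. of_bool (first_wrong i' M n t \<omega>) = (0 :: real)"
    proof
      fix i' assume "i' \<in> {1..M} - {i}"
      then have "target M i' t \<noteq> M" using uniq by blast
      then show "of_bool (first_wrong i' M n t \<omega>) = (0 :: real)" by (simp add: first_wrong_def)
    qed
  qed simp
  then show ?thesis using i by (intro that[of i]) simp_all
qed

text \<open>If \<open>\<sigma> k\<close> is not played at all, then the player with target \<open>k\<close> is wrong.  A bad arm of nonnegative
  mean earns this mean at least when the player with the last target plays it; one of negative mean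
  costs at most once per player who plays it.\<close>

lemma loss_model1:
  assumes t: "1 \<le> t"
  shows "loss Model1 t \<omega> \<le> charge (\<lambda>k. \<mu> (\<sigma> k)) (\<lambda>n. max (\<mu> n) 0) (\<lambda>n. max (- \<mu> n) 0) t \<omega>"
proof -
  define P where "P n = (\<exists>i\<in>{1..M}. act i \<omega> t = n)" for n
  have "loss Model1 t \<omega> = (\<Sum>k=1..M. \<mu> (\<sigma> k) * (1 - of_bool (P (\<sigma> k)))) + (\<Sum>n\<in>worse M. - (\<mu> n * of_bool (P n)))"
    unfolding loss_def sum_arms_split by (simp add: P_def right_diff_distrib sum_subtractf sum_negf)
  also have "\<dots> \<le> (\<Sum>k=1..M. \<mu> (\<sigma> k) * (\<Sum>i=1..M. of_bool (wrong i k t \<omega>))) +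
     (\<Sum>n\<in>worse M. max (- \<mu> n) 0 * (\<Sum>i=1..M. of_bool (act i \<omega> t = n))
       - max (\<mu> n) 0 * (\<Sum>i=1..M. of_bool (first_wrong i M n t \<omega>)))"
  proof (rule add_mono; rule sum_mono)
    fix k assume k: "k \<in> {1..M}"
    obtain i where i: "i \<in> {1..M}" "target M i t = k" using ex1_player_with_target[OF t k] by blast
    have "1 - of_bool (P (\<sigma> k)) \<le> (of_bool (wrong i k t \<omega>) :: real)"
      using i by (auto simp: P_def wrong_def)
    also have "\<dots> \<le> (\<Sum>i=1..M. of_bool (wrong i k t \<omega>))"
      by (rule member_le_sum) (use i in auto)
    finally show "\<mu> (\<sigma> k) * (1 - of_bool (P (\<sigma> k))) \<le> \<mu> (\<sigma> k) * (\<Sum>i=1..M. of_bool (wrong i k t \<omega>))"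
      by (rule mult_left_mono) (rule mu_best_nonneg[OF k])
  next
    fix n assume "n \<in> worse M"
    obtain i where i: "i \<in> {1..M}" and
      fw: "\<And>n. (\<Sum>i'=1..M. of_bool (first_wrong i' M n t \<omega>) :: real) = of_bool (first_wrong i M n t \<omega>)"
      using sum_first_wrong[OF t] by metis
    show "- (\<mu> n * of_bool (P n)) \<le> max (- \<mu> n) 0 * (\<Sum>i=1..M. of_bool (act i \<omega> t = n))
       - max (\<mu> n) 0 * (\<Sum>i=1..M. of_bool (first_wrong i M n t \<omega>))"
    proof (cases "0 \<le> \<mu> n")
      case True
      have "of_bool (first_wrong i M n t \<omega>) \<le> (of_bool (P n) :: real)"
        using i by (auto simp: first_wrong_def P_def)
      then have "\<mu> n * of_bool (first_wrong i M n t \<omega>) \<le> \<mu> n * of_bool (P n)" using True by (rule mult_left_mono)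
      then show ?thesis using True unfolding fw by (simp add: max_def)
    next
      case False
      have "of_bool (P n) \<le> (\<Sum>i=1..M. of_bool (act i \<omega> t = n) :: real)"
      proof (cases "P n")
        case True
        then obtain i where i: "i \<in> {1..M}" "act i \<omega> t = n" by (auto simp: P_def)
        have "of_bool (act i \<omega> t = n) \<le> (\<Sum>i=1..M. of_bool (act i \<omega> t = n) :: real)"
          by (rule member_le_sum) (use i in auto)
        then show ?thesis using True i by simp
      qed (simp add: sum_nonneg)
      then have "- \<mu> n * of_bool (P n) \<le> - \<mu> n * (\<Sum>i=1..M. of_bool (act i \<omega> t = n))"
        using False by (intro mult_left_mono) auto
      then show ?thesis using False by (simp add: max_def)
    qed
  qed
  also have "\<dots> = charge (\<lambda>k. \<mu> (\<sigma> k)) (\<lambda>n. max (\<mu> n) 0) (\<lambda>n. max (- \<mu> n) 0) t \<omega>"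
    unfolding charge_eq by (simp add: sum_subtractf)
  finally show ?thesis .
qed

definition wrong_players :: "nat \<Rightarrow> (nat \<times> nat \<Rightarrow> real) \<Rightarrow> nat set" where
  "wrong_players t \<omega> = {i \<in> {1..M}. act i \<omega> t \<noteq> \<sigma> (target M i t)}"

lemma finite_wrong_players: "finite (wrong_players t \<omega>)"
  by (simp add: wrong_players_def)

lemma sum_wrong:
  assumes "1 \<le> t"
  shows "(\<Sum>k=1..M. y * (\<Sum>i=1..M. of_bool (wrong i k t \<omega>))) = (y :: real) * real (card (wrong_players t \<omega>))"
proof -
  have "(\<Sum>k=1..M. of_bool (wrong i k t \<omega>)) = (of_bool (i \<in> wrong_players t \<omega>) :: real)" if i: "i \<in> {1..M}" for i
  proof -
    have "(\<Sum>k=1..M. of_bool (wrong i k t \<omega>) :: real) = (\<Sum>k\<in>{target M i t}. of_bool (wrong i k t \<omega>))"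
      using target_bounds[OF i assms] by (intro sum.mono_neutral_right) (auto simp: wrong_def)
    then show ?thesis using i by (simp add: wrong_def wrong_players_def)
  qed
  then have "(\<Sum>i=1..M. \<Sum>k=1..M. of_bool (wrong i k t \<omega>)) = (\<Sum>i=1..M. of_bool (i \<in> wrong_players t \<omega>) :: real)"
    by (intro sum.cong refl)
  also have "\<dots> = real (card (wrong_players t \<omega>))"
    by (simp add: sum.If_cases of_bool_def Int_def wrong_players_def)
  finally show ?thesis
    unfolding sum_distrib_left[symmetric] by (subst sum.swap) simp
qed

text \<open>If nobody is wrong, the offsets assign the \<open>M\<close> best arms to the \<open>M\<close> players one to one.\<close>

lemma loss_model2_correct:
  assumes t: "1 \<le> t" and none: "wrong_players t \<omega> = {}"
  shows "loss Model2 t \<omega> = 0"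
proof -
  have act: "act i \<omega> t = \<sigma> (target M i t)" if "i \<in> {1..M}" for i
    using none that by (auto simp: wrong_players_def)
  have "rewarded_arm Model2 t (\<sigma> k) \<omega>" if k: "k \<in> {1..M}" for k
  proof -
    have "i \<in> {1..M} \<and> act i \<omega> t = \<sigma> k \<longleftrightarrow> i \<in> {1..M} \<and> target M i t = k" for i
      using act[of i] injD[OF sigma_inj] by metis
    then show ?thesis using ex1_player_with_target[OF t k] by simp
  qed
  moreover have "\<not> rewarded_arm Model2 t n \<omega>" if n: "n \<in> worse M" for n
  proof
    assume "rewarded_arm Model2 t n \<omega>"
    then obtain i where i: "i \<in> {1..M}" "act i \<omega> t = n" by auto
    have M: "M \<in> {1..M}" using M_pos by simp
    have "n = \<sigma> (target M i t)" "target M i t \<le> M" using act[OF i(1)] i target_bounds[OF i(1) t] by auto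
    then show False using n inj_image_mem_iff[OF sigma_inj] unfolding worse_eq[OF M] by auto
  qed
  ultimately show ?thesis unfolding loss_def sum_arms_split by simp
qed

text \<open>With means of any sign, a wrong player may both spoil the reward of the best arms by a collision
  and expose the negative means of other arms.\<close>

lemma loss_model2_general:
  fixes \<omega> t
  defines "y \<equiv> (\<Sum>k=1..M. \<mu> (\<sigma> k)) + (\<Sum>n=1..N. \<bar>\<mu> n\<bar>)"
  assumes t: "1 \<le> t"
  shows "loss Model2 t \<omega> \<le> charge (\<lambda>_. y) (\<lambda>_. 0) (\<lambda>_. 0) t \<omega>"
proof -
  have S: "0 \<le> (\<Sum>k=1..M. \<mu> (\<sigma> k))" by (rule sum_nonneg) (rule mu_best_nonneg)
  have "0 \<le> (\<Sum>n=1..N. \<bar>\<mu> n\<bar>)" by (rule sum_nonneg) simp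
  with S have y: "0 \<le> y" by (simp add: y_def)
  have ch: "charge (\<lambda>_. y) (\<lambda>_. 0) (\<lambda>_. 0) t \<omega> = y * real (card (wrong_players t \<omega>))"
    unfolding charge_eq sum_wrong[OF t] by simp
  show ?thesis
  proof (cases "wrong_players t \<omega> = {}")
    case True
    then show ?thesis unfolding ch using loss_model2_correct[OF t True] by simp
  next
    case False
    have "- (\<Sum>n=1..N. \<bar>\<mu> n\<bar>) \<le> (\<Sum>n=1..N. \<mu> n * of_bool (rewarded_arm Model2 t n \<omega>))"
      unfolding sum_negf[symmetric] by (rule sum_mono) (auto simp: of_bool_def)
    then have "loss Model2 t \<omega> \<le> y" unfolding loss_def y_def by linarith
    moreover have "1 \<le> card (wrong_players t \<omega>)"
      using False finite_wrong_players by (simp add: Suc_le_eq card_gt_0_iff)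
    then have "y * 1 \<le> y * real (card (wrong_players t \<omega>))" using y by (intro mult_left_mono) auto
    ultimately show ?thesis unfolding ch by simp
  qed
qed

text \<open>A slot with one wrong player who is at the last target still collects the mean of the arm
  played by mistake.  If several players are wrong, the loss is charged several times, and the
  surplus covers that mean.\<close>

lemma loss_model2_nonneg:
  fixes \<omega> t
  defines "S \<equiv> (\<Sum>k=1..M. \<mu> (\<sigma> k))"
  assumes t: "1 \<le> t" and nonneg: "\<And>n. n \<in> {1..N} \<Longrightarrow> 0 \<le> \<mu> n"
  shows "loss Model2 t \<omega> \<le> charge (\<lambda>_. S) \<mu> (\<lambda>_. 0) t \<omega>"
proof -
  have MM: "M \<in> {1..M}" using M_pos by simp
  obtain i where i: "i \<in> {1..M}" "target M i t = M" and
    fw: "\<And>n. (\<Sum>i'=1..M. of_bool (first_wrong i' M n t \<omega>) :: real) = of_bool (first_wrong i M n t \<omega>)"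
    using sum_first_wrong[OF t] by metis
  define C where "C = card (wrong_players t \<omega>)"
  define G where "G = (\<Sum>n\<in>worse M. \<mu> n * of_bool (first_wrong i M n t \<omega>))"
  have ch: "charge (\<lambda>_. S) \<mu> (\<lambda>_. 0) t \<omega> = S * real C - G"
    unfolding charge_eq sum_wrong[OF t] fw C_def G_def by simp
  have S: "\<mu> (\<sigma> M) \<le> S" "0 \<le> S"
    unfolding S_def using mu_best_nonneg MM by (auto intro!: member_le_sum sum_nonneg)
  define R where "R n = \<mu> n * of_bool (rewarded_arm Model2 t n \<omega>)" for n
  have R: "0 \<le> R n" if "n \<in> {1..N}" for n using nonneg[OF that] by (simp add: R_def)
  have L: "loss Model2 t \<omega> = S - (\<Sum>n=1..N. R n)" unfolding loss_def S_def R_def ..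
  have LS: "loss Model2 t \<omega> \<le> S" unfolding L using sum_nonneg[of "{1..N}" R] R by simp
  show ?thesis
  proof (cases "act i \<omega> t \<in> worse M \<and> first_wrong i M (act i \<omega> t) t \<omega>")
    case False
    have "G = 0" unfolding G_def using False by (intro sum.neutral) (auto simp: first_wrong_def)
    moreover have "loss Model2 t \<omega> \<le> S * real C"
    proof (cases "C = 0")
      case True
      then have "wrong_players t \<omega> = {}" using finite_wrong_players by (simp add: C_def)
      then show ?thesis using loss_model2_correct[OF t] True by simp
    next
      case False
      then have "S * 1 \<le> S * real C" using S by (intro mult_left_mono) auto
      then show ?thesis using LS by simp
    qed
    ultimately show ?thesis unfolding ch by simp
  next
    case True
    define n where "n = act i \<omega> t"
    have n: "n \<in> worse M" "first_wrong i M n t \<omega>" using True by (auto simp: n_def)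
    have nN: "n \<in> {1..N}" "\<mu> n < \<mu> (\<sigma> M)" using n(1) by (auto simp: worse_def)
    have "G = (\<Sum>n'\<in>{n}. \<mu> n' * of_bool (first_wrong i M n' t \<omega>))"
      unfolding G_def using n by (intro sum.mono_neutral_right) (auto simp: first_wrong_def n_def)
    then have G: "G = \<mu> n" using n(2) by simp
    have iW: "i \<in> wrong_players t \<omega>" using i nN by (auto simp: wrong_players_def n_def)
    then have C1: "1 \<le> C" unfolding C_def using finite_wrong_players by (auto simp: Suc_le_eq card_gt_0_iff)
    show ?thesis
    proof (cases "C = 1")
      case True
      then have W: "wrong_players t \<omega> = {i}" using iW unfolding C_def by (auto simp: card_1_singleton_iff)
      have "i' = i" if i': "i' \<in> {1..M}" "act i' \<omega> t = n" for i'
      proof (rule ccontr)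
        assume "i' \<noteq> i"
        then have "i' \<notin> wrong_players t \<omega>" using W by simp
        then have "n = \<sigma> (target M i' t)" "target M i' t \<le> M"
          using i' target_bounds[OF i'(1) t] by (auto simp: wrong_players_def)
        then show False using n(1) inj_image_mem_iff[OF sigma_inj] unfolding worse_eq[OF MM] by auto
      qed
      then have "rewarded_arm Model2 t n \<omega>" using i(1) by (auto simp: n_def)
      then have "\<mu> n = R n" by (simp add: R_def)
      also have "\<dots> \<le> (\<Sum>n=1..N. R n)" using nN R by (intro member_le_sum) auto
      finally show ?thesis unfolding ch L G True by simp
    next
      case False
      then have "2 \<le> C" using C1 by simp
      then have "S * 2 \<le> S * real C" using S by (intro mult_left_mono) auto
      then show ?thesis unfolding ch G using LS S nN(2) by linarith
    qed
  qed
qed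

lemma x_coef_eq: "x_coef \<nu> f N \<Theta> \<sigma> k = (\<Sum>j=1..k. \<Sum>n\<in>worse j. 1 / KL \<nu> f (\<Theta> n) (\<Theta> (\<sigma> j)))"
  unfolding x_coef_def worse_def \<mu>_def ..

lemma const1_eq:
  "const1 \<nu> f N M \<Theta> \<sigma> = real M * total_charge (\<lambda>k. \<mu> (\<sigma> k)) (\<lambda>n. max (\<mu> n) 0) (\<lambda>n. max (- \<mu> n) 0)
    (\<lambda>j n. 1 / KL \<nu> f (\<Theta> n) (\<Theta> (\<sigma> j)))"
proof -
  have m: "\<mu> n = max (\<mu> n) 0 - max (- \<mu> n) 0" for n by simp
  have "(\<Sum>n\<in>worse M. \<mu> n / KL \<nu> f (\<Theta> n) (\<Theta> (\<sigma> M))) =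
      (\<Sum>n\<in>worse M. max (\<mu> n) 0 * (1 / KL \<nu> f (\<Theta> n) (\<Theta> (\<sigma> M)))) -
      (\<Sum>n\<in>worse M. max (- \<mu> n) 0 * (1 / KL \<nu> f (\<Theta> n) (\<Theta> (\<sigma> M))))"
    unfolding sum_subtractf[symmetric] left_diff_distrib[symmetric] m[symmetric] by simp
  then show ?thesis
    unfolding const1_def total_charge_def x_coef_eq[symmetric]
    by (simp add: worse_def \<mu>_def mult.commute)
qed

text \<open>The stated constant credits at most \<open>1 / I(n, \<sigma> M)\<close> to a bad arm \<open>n\<close>, since plays of \<open>n\<close> by
  other players at better targets may collide with its gain.  The slot-wise bound above already pays for
  collisions, so the full credit is available.\<close>

lemma const2_ge:
  assumes "\<And>n. n \<in> {1..N} \<Longrightarrow> 0 \<le> \<mu> n"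
  shows "real M * total_charge (\<lambda>_. \<Sum>k=1..M. \<mu> (\<sigma> k)) \<mu> (\<lambda>_. 0) (\<lambda>j n. 1 / KL \<nu> f (\<Theta> n) (\<Theta> (\<sigma> j)))
    \<le> const2 \<nu> f N M \<Theta> \<sigma>"
proof -
  define I where "I n j = 1 / KL \<nu> f (\<Theta> n) (\<Theta> (\<sigma> j))" for n j
  have I: "0 \<le> I n j" if "n \<in> worse M" "j \<in> {1..M}" for n j
  proof -
    have "\<mu> (\<sigma> M) \<le> \<mu> (\<sigma> j)" using that M_less_N by (intro mu_antimono) auto
    then have "mean \<nu> f (\<Theta> n) < mean \<nu> f (\<Theta> (\<sigma> j))" using that(1) by (simp add: worse_def \<mu>_def)
    moreover have "\<Theta> n \<in> H" "\<Theta> (\<sigma> j) \<in> H"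
      using that Theta_in_H sigma_in[of j] M_less_N by (auto simp: worse_def)
    ultimately show ?thesis using C2 unfolding C2_def I_def by (simp add: less_imp_le)
  qed
  have "(\<Sum>n\<in>worse M. \<mu> n * max (I n M - (\<Sum>j=1..M-1. I n j)) 0) \<le> (\<Sum>n\<in>worse M. \<mu> n * I n M)"
  proof (intro sum_mono mult_left_mono)
    fix n assume n: "n \<in> worse M"
    have "0 \<le> (\<Sum>j=1..M-1. I n j)" using I[OF n] by (intro sum_nonneg) auto
    moreover have "0 \<le> I n M" using I[OF n] M_pos by simp
    ultimately show "max (I n M - (\<Sum>j=1..M-1. I n j)) 0 \<le> I n M" by simp
    show "0 \<le> \<mu> n" using n assms by (simp add: worse_def)
  qed
  moreover have "(\<Sum>k=1..M. \<Sum>j=1..M. x_coef \<nu> f N \<Theta> \<sigma> j * \<mu> (\<sigma> k)) =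
      (\<Sum>k=1..M. (\<Sum>k=1..M. \<mu> (\<sigma> k)) * x_coef \<nu> f N \<Theta> \<sigma> k)"
    by (subst sum.swap) (simp add: sum_distrib_left mult.commute)
  ultimately have "total_charge (\<lambda>_. \<Sum>k=1..M. \<mu> (\<sigma> k)) \<mu> (\<lambda>_. 0) (\<lambda>j n. I n j) \<le>
      (\<Sum>k=1..M. \<Sum>j=1..M. x_coef \<nu> f N \<Theta> \<sigma> j * \<mu> (\<sigma> k)) -
      (\<Sum>n\<in>worse M. \<mu> n * max (I n M - (\<Sum>j=1..M-1. I n j)) 0)"
    unfolding total_charge_def I_def x_coef_eq[symmetric] by simp
  then have "real M * total_charge (\<lambda>_. \<Sum>k=1..M. \<mu> (\<sigma> k)) \<mu> (\<lambda>_. 0) (\<lambda>j n. I n j) \<le>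
      real M * ((\<Sum>k=1..M. \<Sum>j=1..M. x_coef \<nu> f N \<Theta> \<sigma> j * \<mu> (\<sigma> k)) -
      (\<Sum>n\<in>worse M. \<mu> n * max (I n M - (\<Sum>j=1..M-1. I n j)) 0))"
    by (rule mult_left_mono) simp
  then show ?thesis unfolding const2_def I_def worse_def \<mu>_def .
qed

lemma regret_model1:
  "limsup (\<lambda>T. ereal (tdfs_regret Model1 T / ln (real T))) \<le> ereal (const1 \<nu> f N M \<Theta> \<sigma>)"
  unfolding const1_eq
proof (rule regret_rate[OF mu_best_nonneg _ _ loss_model1])
  fix n assume "n \<in> worse M"
  then show "max (\<mu> n) 0 \<le> \<mu> (\<sigma> M)" using mu_best_nonneg[of M] M_pos by (auto simp: worse_def)
qed auto

lemma regret_model2_bounded: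
  "\<exists>C. limsup (\<lambda>T. ereal (tdfs_regret Model2 T / ln (real T))) \<le> ereal C"
proof -
  define y where "y = (\<Sum>k=1..M. \<mu> (\<sigma> k)) + (\<Sum>n=1..N. \<bar>\<mu> n\<bar>)"
  have y: "0 \<le> y"
    unfolding y_def by (intro add_nonneg_nonneg sum_nonneg mu_best_nonneg) auto
  have "limsup (\<lambda>T. ereal (tdfs_regret Model2 T / ln (real T))) \<le>
      ereal (real M * total_charge (\<lambda>_. y) (\<lambda>_. 0) (\<lambda>_. 0) (\<lambda>j n. 1 / KL \<nu> f (\<Theta> n) (\<Theta> (\<sigma> j))))"
  proof (rule regret_rate)
    fix t :: nat and \<omega> :: "nat \<times> nat \<Rightarrow> real" assume "1 \<le> t"
    then show "loss Model2 t \<omega> \<le> charge (\<lambda>_. y) (\<lambda>_. 0) (\<lambda>_. 0) t \<omega>"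
      unfolding y_def by (rule loss_model2_general)
  qed (use y in simp_all)
  then show ?thesis by blast
qed

lemma regret_model2:
  assumes "\<And>n. n \<in> {1..N} \<Longrightarrow> 0 \<le> \<mu> n"
  shows "limsup (\<lambda>T. ereal (tdfs_regret Model2 T / ln (real T))) \<le> ereal (const2 \<nu> f N M \<Theta> \<sigma>)"
proof -
  have S: "0 \<le> (\<Sum>k=1..M. \<mu> (\<sigma> k))" by (rule sum_nonneg) (rule mu_best_nonneg)
  have "\<mu> n \<le> (\<Sum>k=1..M. \<mu> (\<sigma> k))" if "n \<in> worse M" for n
  proof -
    have "\<mu> n \<le> \<mu> (\<sigma> M)" using that by (simp add: worse_def)
    also have "\<dots> \<le> (\<Sum>k=1..M. \<mu> (\<sigma> k))"
      using mu_best_nonneg M_pos by (intro member_le_sum[of M "{1..M}" "\<lambda>k. \<mu> (\<sigma> k)"]) auto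
    finally show ?thesis .
  qed
  then have "limsup (\<lambda>T. ereal (tdfs_regret Model2 T / ln (real T))) \<le>
      ereal (real M * total_charge (\<lambda>_. \<Sum>k=1..M. \<mu> (\<sigma> k)) \<mu> (\<lambda>_. 0) (\<lambda>j n. 1 / KL \<nu> f (\<Theta> n) (\<Theta> (\<sigma> j))))"
    using S assms by (intro regret_rate[OF _ _ _ loss_model2_nonneg]) auto
  also have "\<dots> \<le> ereal (const2 \<nu> f N M \<Theta> \<sigma>)" using const2_ge[OF assms] by simp
  finally show ?thesis .
qed

end

theorem theorem2:
  fixes \<nu> :: "real measure" and f :: "'p \<Rightarrow> real \<Rightarrow> real" and H :: "'p set"
    and h :: "nat \<Rightarrow> (nat \<Rightarrow> real) \<Rightarrow> real" and g :: "nat \<Rightarrow> nat \<Rightarrow> (nat \<Rightarrow> real) \<Rightarrow> real"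
    and N M :: nat and \<delta> :: real and \<Theta> :: "nat \<Rightarrow> 'p" and \<sigma> :: "nat \<Rightarrow> nat"
  assumes "density_family \<nu> f H"
    and "C1 \<nu> f H" and "C2 \<nu> f H" and "C3 \<nu> f H" and "C4 \<nu> f H" and "C5 \<nu> f H h g"
    and "1 \<le> M" and "M < N" and "0 < \<delta>" and "\<delta> < 1 / real N"
    and "ranking \<nu> f N \<Theta> \<sigma>" and "admissible \<nu> f H N M \<Theta> \<sigma>"
  shows "(\<forall>c. \<exists>C::real. limsup (\<lambda>T. ereal (regret \<nu> f c N M (TDFS h g \<delta> N M) \<Theta> \<sigma> T / ln (real T))) \<le> ereal C) \<and>
    limsup (\<lambda>T. ereal (regret \<nu> f Model1 N M (TDFS h g \<delta> N M) \<Theta> \<sigma> T / ln (real T))) \<le> ereal (const1 \<nu> f N M \<Theta> \<sigma>) \<and>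
    ((\<forall>n\<in>{1..N}. 0 \<le> mean \<nu> f (\<Theta> n)) \<longrightarrow>
     limsup (\<lambda>T. ereal (regret \<nu> f Model2 N M (TDFS h g \<delta> N M) \<Theta> \<sigma> T / ln (real T))) \<le> ereal (const2 \<nu> f N M \<Theta> \<sigma>))"
proof -
  interpret tdfs_bandit N M \<delta> h g \<nu> f H \<Theta> \<sigma>
    using assms by unfold_locales
  show ?thesis
  proof (intro conjI allI impI)
    fix c
    show "\<exists>C. limsup (\<lambda>T. ereal (regret \<nu> f c N M (TDFS h g \<delta> N M) \<Theta> \<sigma> T / ln (real T))) \<le> ereal C"
      using regret_model1 regret_model2_bounded by (cases c) blast+
  qed (rule regret_model1, rule regret_model2, simp add: \<mu>_def)
qed

end
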